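(* Let $M$ be a smooth manifold, let $r\ge1$, and let $s$ be a non-negative integer. (i) If a function $f\in C^\infty(T^rM\setminus\{0\})$ is $s$-homogeneous, then its vertical and complete lifts $f^v,f^c\in C^\infty(T^{r+1}M\setminus\{0\})$ are $s$-homogeneous functions. (ii) If a vector field $A\in\mathfrak{X}(T^rM\setminus\{0\})$ is $s$-homogeneous, then its vertical and complete lifts $A^v,A^c\in\mathfrak{X}(T^{r+1}M\setminus\{0\})$ are $s$-homogeneous vector fields.
   Context: $M$ is a real $C^\infty$ manifold of dimension $n$; all objects are smooth. $T^0M=M$, $T^rM=T(T^{r-1}M)$, $\pi_r\colon T^{r+1}M\to T^rM$ is the canonical projection, $D$ is the tangent map. The slashed tangent bundles are the open sets $TM\setminus\{0\}=\{(x,y)\in TM:y\neq0\}$ and, for $r\ge2$, $T^rM\setminus\{0\}=\{\xi\in T^rM: D(\pi_0\circ\cdots\circ\pi_{r-2})(\xi)\in TM\setminus\{0\}\}$. For a map $c$ of real variables into $T^rM$, $\partial_{t}c$ denotes its derivative with respect to the variable $t$, as a map into $T^{r+1}M$. For $r\ge2$, $\kappa_r\colon T^rM\to T^rM$ is the unique diffeomorphism with $\partial_t\partial_sc(t,s)=\kappa_r\partial_s\partial_tc(t,s)$ for every map $c\colon(-\varepsilon,\varepsilon)^2\to T^{r-2}M$; $\kappa_1=\mathrm{id}_{TM}$. One has $\kappa_r^2=\mathrm{id}$ and $\pi_{r-1}\circ\kappa_r=D\pi_{r-2}$ for $r\ge2$. For $f\in C^\infty(T^rM\setminus\{0\})$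 and $\xi\in T^{r+1}M\setminus\{0\}$, the vertical and complete lifts are $$f^v(\xi)=(f\circ\pi_r\circ\kappa_{r+1})(\xi),\qquad f^c(\xi)=df(\kappa_{r+1}(\xi)).$$ For $A\in\mathfrak{X}(T^rM\setminus\{0\})$ and $\xi\in T^{r+1}M\setminus\{0\}$, the vertical and complete lifts are $$A^v(\xi)=D\kappa_{r+1}\Big(\partial_\sigma\big(\kappa_{r+1}(\xi)+\sigma\,A(\pi_r(\kappa_{r+1}(\xi)))\big)\big|_{\sigma=0}\Big),\qquad A^c=D\kappa_{r+1}\circ\kappa_{r+2}\circ DA\circ\kappa_{r+1}.$$ These lifts are smooth functions, respectively vector fields, on $T^{r+1}M\setminus\{0\}$. The Liouville vector field $\mathbb{C}_r\in\mathfrak{X}(T^rM)$ is $\mathbb{C}_r(\xi)=\partial_\sigma(\xi+\sigma\xi)|_{\sigma=0}$, with fibrewise operations in the bundle $\pi_{r-1}\colon T^rM\to T^{r-1}M$. A function $f\colon T^rM\setminus\{0\}\to\mathbb{R}$ is (positively) $s$-homogeneous if $f(\lambda\xi)=\lambda^sf(\xi)$ for all $\xi\in T^rM\setminus\{0\}$ and $\lambda>0$ (scalar multiplication in the bundle $\pi_{r-1}$); for smooth $f$ this is equivalent to $\mathbb{C}_r(f)=sf$. A vector field $A\in\mathfrak{X}(T^rM\setminus\{0\})$ is $s$-homogeneous if $[\mathbb{C}_r,A]=(s-1)A$. *)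

theory Defs
  imports "HOL-Analysis.Analysis"
begin

section \<open>Smooth functions on open subsets of Euclidean space\<close>

text \<open>
  The dimension of the iterated tangent bundles depends on the number of iterations, so
  coordinates live in \<^const>\<open>Euclidean_space\<close> \<open>d\<close>, i.e. the sequences of type
  \<^typ>\<open>nat \<Rightarrow> real\<close> that vanish from index \<open>d\<close> on.
\<close>

definition partial :: "nat \<Rightarrow> ((nat \<Rightarrow> real) \<Rightarrow> real) \<Rightarrow> (nat \<Rightarrow> real) \<Rightarrow> real" where
  "partial l g x = deriv (\<lambda>t. g (x(l := t))) (x l)"

fun Ck_on :: "nat \<Rightarrow> nat \<Rightarrow> (nat \<Rightarrow> real) set \<Rightarrow> ((nat \<Rightarrow> real) \<Rightarrow> real) \<Rightarrow> bool" where
  "Ck_on d 0 U g \<longleftrightarrow> continuous_on U g"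
| "Ck_on d (Suc m) U g \<longleftrightarrow> continuous_on U g \<and>
     (\<forall>l<d. (\<forall>x\<in>U. (\<lambda>t. g (x(l := t))) field_differentiable at (x l)) \<and> Ck_on d m U (partial l g))"

definition Cinf_on :: "nat \<Rightarrow> (nat \<Rightarrow> real) set \<Rightarrow> ((nat \<Rightarrow> real) \<Rightarrow> real) \<Rightarrow> bool" where
  "Cinf_on d U g \<longleftrightarrow> openin (Euclidean_space d) U \<and> (\<forall>m. Ck_on d m U g)"


section \<open>Smooth manifolds\<close>

text \<open>
  A manifold is given by a smooth atlas whose charts are indexed by a set \<open>idx\<close>:
  the chart with index \<open>i\<close> is the map \<open>chart i\<close> on the domain \<open>cdom i\<close>. The underlying
  topology is the one determined by the atlas.
\<close>

record ('i, 'p) atlas =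
  mdim :: nat
  idx :: "'i set"
  cdom :: "'i \<Rightarrow> 'p set"
  chart :: "'i \<Rightarrow> 'p \<Rightarrow> nat \<Rightarrow> real"

definition mcarrier :: "('i, 'p) atlas \<Rightarrow> 'p set" where
  "mcarrier N = (\<Union>i\<in>idx N. cdom N i)"

definition chart_inv :: "('i, 'p) atlas \<Rightarrow> 'i \<Rightarrow> (nat \<Rightarrow> real) \<Rightarrow> 'p" where
  "chart_inv N i = inv_into (cdom N i) (chart N i)"

definition mtopology :: "('i, 'p) atlas \<Rightarrow> 'p topology" where
  "mtopology N = topology (\<lambda>U. U \<subseteq> mcarrier N \<and>
     (\<forall>i\<in>idx N. openin (Euclidean_space (mdim N)) (chart N i ` (U \<inter> cdom N i))))"

definition smooth_atlas :: "('i, 'p) atlas \<Rightarrow> bool" where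
  "smooth_atlas N \<longleftrightarrow>
     (\<forall>i\<in>idx N. inj_on (chart N i) (cdom N i) \<and>
        openin (Euclidean_space (mdim N)) (chart N i ` cdom N i)) \<and>
     (\<forall>i\<in>idx N. \<forall>j\<in>idx N.
        openin (Euclidean_space (mdim N)) (chart N i ` (cdom N i \<inter> cdom N j)) \<and>
        (\<forall>k<mdim N. Cinf_on (mdim N) (chart N i ` (cdom N i \<inter> cdom N j))
                        (\<lambda>x. chart N j (chart_inv N i x) k)))"

definition smooth_manifold :: "('i, 'p) atlas \<Rightarrow> bool" where
  "smooth_manifold N \<longleftrightarrow> smooth_atlas N \<and> Hausdorff_space (mtopology N) \<and>
     (\<exists>\<B>. countable \<B> \<and> (\<forall>V\<in>\<B>. openin (mtopology N) V) \<and>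
        (\<forall>U p. openin (mtopology N) U \<and> p \<in> U \<longrightarrow> (\<exists>V\<in>\<B>. p \<in> V \<and> V \<subseteq> U)))"

lemma openin_mtopology:
  assumes "smooth_atlas N"
  shows "openin (mtopology N) U \<longleftrightarrow> U \<subseteq> mcarrier N \<and>
     (\<forall>i\<in>idx N. openin (Euclidean_space (mdim N)) (chart N i ` (U \<inter> cdom N i)))"
proof -
  have "istopology (\<lambda>U. U \<subseteq> mcarrier N \<and>
     (\<forall>i\<in>idx N. openin (Euclidean_space (mdim N)) (chart N i ` (U \<inter> cdom N i))))"
    unfolding istopology_def
  proof (intro conjI allI impI ballI)
    fix S T i
    assume S: "S \<subseteq> mcarrier N \<and> (\<forall>i\<in>idx N. openin (Euclidean_space (mdim N)) (chart N i ` (S \<inter> cdom N i)))"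
      and T: "T \<subseteq> mcarrier N \<and> (\<forall>i\<in>idx N. openin (Euclidean_space (mdim N)) (chart N i ` (T \<inter> cdom N i)))"
    show "S \<inter> T \<subseteq> mcarrier N" using S by blast
    assume i: "i \<in> idx N"
    then have "inj_on (chart N i) (cdom N i)" using assms by (simp add: smooth_atlas_def)
    then have "chart N i ` (S \<inter> T \<inter> cdom N i)
        = chart N i ` (S \<inter> cdom N i) \<inter> chart N i ` (T \<inter> cdom N i)"
      by (auto simp: inj_on_def)
    then show "openin (Euclidean_space (mdim N)) (chart N i ` (S \<inter> T \<inter> cdom N i))"
      using S T i by (simp add: openin_Int)
  next
    fix \<K> i
    assume K: "\<forall>K\<in>\<K>. K \<subseteq> mcarrier N \<and> (\<forall>i\<in>idx N. openin (Euclidean_space (mdim N)) (chart N i ` (K \<inter> cdom N i)))"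
    show "\<Union>\<K> \<subseteq> mcarrier N" using K by blast
    assume i: "i \<in> idx N"
    have "chart N i ` (\<Union>\<K> \<inter> cdom N i) = (\<Union>K\<in>\<K>. chart N i ` (K \<inter> cdom N i))"
      by blast
    then show "openin (Euclidean_space (mdim N)) (chart N i ` (\<Union>\<K> \<inter> cdom N i))"
      using K i by (auto intro!: openin_Union)
  qed
  then show ?thesis by (simp add: mtopology_def)
qed

definition chart_at :: "('i, 'p) atlas \<Rightarrow> 'p \<Rightarrow> 'i" where
  "chart_at N p = (SOME i. i \<in> idx N \<and> p \<in> cdom N i)"

text \<open>Smooth functions and smooth maps on an open subset \<open>U\<close> of a manifold; openness of \<open>U\<close> and,
  for maps, continuity are part of the requirement that the sets below are open.\<close>

definition smooth_fun_on :: "('i, 'p) atlas \<Rightarrow> 'p set \<Rightarrow> ('p \<Rightarrow> real) \<Rightarrow> bool" where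
  "smooth_fun_on N U f \<longleftrightarrow> U \<subseteq> mcarrier N \<and>
     (\<forall>i\<in>idx N. Cinf_on (mdim N) (chart N i ` (U \<inter> cdom N i)) (\<lambda>x. f (chart_inv N i x)))"

definition smooth_map_on ::
    "('i, 'p) atlas \<Rightarrow> 'p set \<Rightarrow> ('j, 'q) atlas \<Rightarrow> ('p \<Rightarrow> 'q) \<Rightarrow> bool" where
  "smooth_map_on N U N' f \<longleftrightarrow> U \<subseteq> mcarrier N \<and> f ` U \<subseteq> mcarrier N' \<and>
     (\<forall>i\<in>idx N. \<forall>j\<in>idx N'.
        let W = chart N i ` {p \<in> U \<inter> cdom N i. f p \<in> cdom N' j} in
        openin (Euclidean_space (mdim N)) W \<and>
        (\<forall>k<mdim N'. Cinf_on (mdim N) W (\<lambda>x. chart N' j (f (chart_inv N i x)) k)))"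

definition diffeomorphism :: "('i, 'p) atlas \<Rightarrow> ('j, 'q) atlas \<Rightarrow> ('p \<Rightarrow> 'q) \<Rightarrow> bool" where
  "diffeomorphism N N' f \<longleftrightarrow> bij_betw f (mcarrier N) (mcarrier N') \<and>
     smooth_map_on N (mcarrier N) N' f \<and>
     smooth_map_on N' (mcarrier N') N (inv_into (mcarrier N) f)"

definition euclidean :: "nat \<Rightarrow> (unit, nat \<Rightarrow> real) atlas" where
  "euclidean d = \<lparr>mdim = d, idx = UNIV, cdom = (\<lambda>_. topspace (Euclidean_space d)), chart = (\<lambda>_ x. x)\<rparr>"


section \<open>Tangent bundles\<close>

text \<open>
  \<open>Base\<close> embeds the points of \<open>M\<close>. A tangent vector \<open>Tan p v\<close> at \<open>p\<close> consists of its
  components \<open>v i\<close> in all charts \<open>i\<close> around \<open>p\<close>, subject to the transformation law in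
  \<open>tangent_space\<close> below (and \<open>v i = 0\<close> for the other \<open>i\<close>). The charts of the tangent bundle are
  indexed by those of the manifold, so a single type holds the points of all \<open>T\<^sup>rM\<close>.
  The selector \<open>foot\<close> is the bundle projection \<open>\<pi>\<^sub>r\<close>, for every \<open>r\<close>.
\<close>

datatype ('i, 'a) tpoint =
    Base (the_base: 'a)
  | Tan (foot: "('i, 'a) tpoint") (comp: "'i \<Rightarrow> nat \<Rightarrow> real")

type_synonym ('i, 'a) tmanifold = "('i, ('i, 'a) tpoint) atlas"

definition tangent_space :: "('i, 'p) atlas \<Rightarrow> 'p \<Rightarrow> ('i \<Rightarrow> nat \<Rightarrow> real) set" where
  "tangent_space N p = {v.
     (\<forall>i. i \<in> idx N \<and> p \<in> cdom N i \<longrightarrow> v i \<in> topspace (Euclidean_space (mdim N))) \<and>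
     (\<forall>i. \<not> (i \<in> idx N \<and> p \<in> cdom N i) \<longrightarrow> v i = (\<lambda>k. 0)) \<and>
     (\<forall>i\<in>idx N. \<forall>j\<in>idx N. p \<in> cdom N i \<inter> cdom N j \<longrightarrow> (\<forall>k<mdim N.
        v j k = (\<Sum>l<mdim N. partial l (\<lambda>x. chart N j (chart_inv N i x) k) (chart N i p) * v i l)))}"

definition tangent_bundle :: "('i, 'a) tmanifold \<Rightarrow> ('i, 'a) tmanifold" where
  "tangent_bundle N = \<lparr>mdim = 2 * mdim N, idx = idx N,
     cdom = (\<lambda>i. {Tan p v | p v. p \<in> cdom N i \<and> v \<in> tangent_space N p}),
     chart = (\<lambda>i \<xi> k. if k < mdim N then chart N i (foot \<xi>) k else comp \<xi> i (k - mdim N))\<rparr>"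

definition tadd :: "('i, 'a) tpoint \<Rightarrow> ('i, 'a) tpoint \<Rightarrow> ('i, 'a) tpoint" where
  "tadd \<xi> \<eta> = Tan (foot \<xi>) (\<lambda>i k. comp \<xi> i k + comp \<eta> i k)"

definition tscale :: "real \<Rightarrow> ('i, 'a) tpoint \<Rightarrow> ('i, 'a) tpoint" where
  "tscale a \<xi> = Tan (foot \<xi>) (\<lambda>i k. a * comp \<xi> i k)"

text \<open>The derivative \<open>\<partial>\<^sub>t \<gamma>\<close> of a curve \<open>\<gamma>\<close> in \<open>N\<close> at \<open>t\<close>.\<close>

definition velocity :: "('i, 'a) tmanifold \<Rightarrow> (real \<Rightarrow> ('i, 'a) tpoint) \<Rightarrow> real \<Rightarrow> ('i, 'a) tpoint" where
  "velocity N \<gamma> t = Tan (\<gamma> t) (\<lambda>i k. if i \<in> idx N \<and> \<gamma> t \<in> cdom N i \<and> k < mdim N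
     then deriv (\<lambda>u. chart N i (\<gamma> u) k) t else 0)"

text \<open>The tangent map \<open>Df\<close> and, for real-valued \<open>f\<close>, the differential \<open>df\<close>. By the chain rule neither
  depends on the chart chosen by \<open>chart_at\<close>. Both only use \<open>f\<close> near the base point of \<open>\<xi>\<close>, so they
  also serve for maps that are defined on an open subset of \<open>N\<close>.\<close>

definition tangent_map ::
    "('i, 'a) tmanifold \<Rightarrow> ('j, 'b) tmanifold \<Rightarrow> (('i, 'a) tpoint \<Rightarrow> ('j, 'b) tpoint)
      \<Rightarrow> ('i, 'a) tpoint \<Rightarrow> ('j, 'b) tpoint" where
  "tangent_map N N' f \<xi> = (let p = foot \<xi>; i = chart_at N p in
     Tan (f p) (\<lambda>j k. if j \<in> idx N' \<and> f p \<in> cdom N' j \<and> k < mdim N'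
       then \<Sum>l<mdim N. partial l (\<lambda>x. chart N' j (f (chart_inv N i x)) k) (chart N i p) * comp \<xi> i l
       else 0))"

definition differential ::
    "('i, 'a) tmanifold \<Rightarrow> (('i, 'a) tpoint \<Rightarrow> real) \<Rightarrow> ('i, 'a) tpoint \<Rightarrow> real" where
  "differential N f \<xi> = (let p = foot \<xi>; i = chart_at N p in
     \<Sum>l<mdim N. partial l (\<lambda>x. f (chart_inv N i x)) (chart N i p) * comp \<xi> i l)"

definition vector_field_on ::
    "('i, 'a) tmanifold \<Rightarrow> ('i, 'a) tpoint set \<Rightarrow> (('i, 'a) tpoint \<Rightarrow> ('i, 'a) tpoint) \<Rightarrow> bool" where
  "vector_field_on N U A \<longleftrightarrow> smooth_map_on N U (tangent_bundle N) A \<and> (\<forall>p\<in>U. foot (A p) = p)"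

text \<open>\<open>[X, Y] = (X\<^sup>l \<partial>\<^sub>l Y\<^sup>k - Y\<^sup>l \<partial>\<^sub>l X\<^sup>k) \<partial>\<^sub>k\<close> in every chart.\<close>

definition lie_bracket ::
    "('i, 'a) tmanifold \<Rightarrow> (('i, 'a) tpoint \<Rightarrow> ('i, 'a) tpoint) \<Rightarrow> (('i, 'a) tpoint \<Rightarrow> ('i, 'a) tpoint)
      \<Rightarrow> ('i, 'a) tpoint \<Rightarrow> ('i, 'a) tpoint" where
  "lie_bracket N X Y p = Tan p (\<lambda>i k. if i \<in> idx N \<and> p \<in> cdom N i \<and> k < mdim N
     then \<Sum>l<mdim N.
        comp (X p) i l * partial l (\<lambda>x. comp (Y (chart_inv N i x)) i k) (chart N i p) -
        comp (Y p) i l * partial l (\<lambda>x. comp (X (chart_inv N i x)) i k) (chart N i p)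
     else 0)"


section \<open>Iterated tangent bundles\<close>

definition base_manifold :: "('i, 'a) atlas \<Rightarrow> ('i, 'a) tmanifold" where
  "base_manifold M = \<lparr>mdim = mdim M, idx = idx M,
     cdom = (\<lambda>i. Base ` cdom M i), chart = (\<lambda>i p. chart M i (the_base p))\<rparr>"

fun iter_tangent :: "('i, 'a) atlas \<Rightarrow> nat \<Rightarrow> ('i, 'a) tmanifold" where
  "iter_tangent M 0 = base_manifold M"
| "iter_tangent M (Suc r) = tangent_bundle (iter_tangent M r)"

text \<open>The slashed bundle \<open>T\<^sup>rM \<setminus> {0}\<close>, meaningful for \<open>r \<ge> 1\<close>. The (\<open>r-1\<close>)-fold iterate of
  \<open>foot\<close> is \<open>\<pi>\<^sub>0 \<circ> \<dots> \<circ> \<pi>\<^bsub>r-2\<^esub>\<close>.\<close>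

definition slashed_TM :: "('i, 'a) atlas \<Rightarrow> ('i, 'a) tpoint set" where
  "slashed_TM M = {\<xi> \<in> mcarrier (iter_tangent M 1). comp \<xi> \<noteq> (\<lambda>i k. 0)}"

definition slashed :: "('i, 'a) atlas \<Rightarrow> nat \<Rightarrow> ('i, 'a) tpoint set" where
  "slashed M r = (if r \<le> 1 then slashed_TM M
     else {\<xi> \<in> mcarrier (iter_tangent M r).
       tangent_map (iter_tangent M (r - 1)) (iter_tangent M 0) (foot ^^ (r - 1)) \<xi> \<in> slashed_TM M})"

text \<open>The canonical flip of \<open>TTN\<close>, i.e. the unique diffeomorphism \<open>\<kappa>\<close> with
  \<open>\<partial>\<^sub>t\<partial>\<^sub>s c = \<kappa> \<partial>\<^sub>s\<partial>\<^sub>t c\<close> for all smooth maps \<open>c: (-\<epsilon>, \<epsilon>)\<^sup>2 \<rightarrow> N\<close>. As functions are total,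
  uniqueness requires fixing the values outside \<open>TTN\<close> by extensionality.\<close>

definition canonical_flip :: "('i, 'a) tmanifold \<Rightarrow> ('i, 'a) tpoint \<Rightarrow> ('i, 'a) tpoint" where
  "canonical_flip N = (THE \<kappa>.
     \<kappa> \<in> extensional (mcarrier (tangent_bundle (tangent_bundle N))) \<and>
     diffeomorphism (tangent_bundle (tangent_bundle N)) (tangent_bundle (tangent_bundle N)) \<kappa> \<and>
     (\<forall>\<epsilon>>0. \<forall>c :: real \<Rightarrow> real \<Rightarrow> ('i, 'a) tpoint.
        smooth_map_on (euclidean 2)
          {x \<in> topspace (Euclidean_space 2). \<bar>x 0\<bar> < \<epsilon> \<and> \<bar>x 1\<bar> < \<epsilon>} N (\<lambda>x. c (x 0) (x 1)) \<longrightarrow>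
        (\<forall>t s. \<bar>t\<bar> < \<epsilon> \<and> \<bar>s\<bar> < \<epsilon> \<longrightarrow>
           velocity (tangent_bundle N) (\<lambda>t. velocity N (\<lambda>s. c t s) s) t =
           \<kappa> (velocity (tangent_bundle N) (\<lambda>s. velocity N (\<lambda>t. c t s) t) s))))"

definition kappa :: "('i, 'a) atlas \<Rightarrow> nat \<Rightarrow> ('i, 'a) tpoint \<Rightarrow> ('i, 'a) tpoint" where
  "kappa M r = (if r \<ge> 2 then canonical_flip (iter_tangent M (r - 2)) else (\<lambda>\<xi>. \<xi>))"


section \<open>Lifts from \<open>T\<^sup>rM \<setminus> {0}\<close> to \<open>T\<^bsup>r+1\<^esup>M \<setminus> {0}\<close>, and homogeneity\<close>

definition vlift_fun ::
    "('i, 'a) atlas \<Rightarrow> nat \<Rightarrow> (('i, 'a) tpoint \<Rightarrow> real) \<Rightarrow> ('i, 'a) tpoint \<Rightarrow> real" where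
  "vlift_fun M r f \<xi> = f (foot (kappa M (r + 1) \<xi>))"

definition clift_fun ::
    "('i, 'a) atlas \<Rightarrow> nat \<Rightarrow> (('i, 'a) tpoint \<Rightarrow> real) \<Rightarrow> ('i, 'a) tpoint \<Rightarrow> real" where
  "clift_fun M r f \<xi> = differential (iter_tangent M r) f (kappa M (r + 1) \<xi>)"

definition vlift_field ::
    "('i, 'a) atlas \<Rightarrow> nat \<Rightarrow> (('i, 'a) tpoint \<Rightarrow> ('i, 'a) tpoint) \<Rightarrow> ('i, 'a) tpoint \<Rightarrow> ('i, 'a) tpoint" where
  "vlift_field M r A \<xi> = (let T = iter_tangent M (r + 1); \<kappa> = kappa M (r + 1) in
     tangent_map T T \<kappa> (velocity T (\<lambda>\<sigma>. tadd (\<kappa> \<xi>) (tscale \<sigma> (A (foot (\<kappa> \<xi>))))) 0))"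

definition clift_field ::
    "('i, 'a) atlas \<Rightarrow> nat \<Rightarrow> (('i, 'a) tpoint \<Rightarrow> ('i, 'a) tpoint) \<Rightarrow> ('i, 'a) tpoint \<Rightarrow> ('i, 'a) tpoint" where
  "clift_field M r A =
     tangent_map (iter_tangent M (r + 1)) (iter_tangent M (r + 1)) (kappa M (r + 1)) \<circ>
     kappa M (r + 2) \<circ>
     tangent_map (iter_tangent M r) (iter_tangent M (r + 1)) A \<circ>
     kappa M (r + 1)"

definition liouville :: "('i, 'a) atlas \<Rightarrow> nat \<Rightarrow> ('i, 'a) tpoint \<Rightarrow> ('i, 'a) tpoint" where
  "liouville M r \<xi> = velocity (iter_tangent M r) (\<lambda>\<sigma>. tadd \<xi> (tscale \<sigma> \<xi>)) 0"

definition homogeneous_fun :: "('i, 'a) atlas \<Rightarrow> nat \<Rightarrow> nat \<Rightarrow> (('i, 'a) tpoint \<Rightarrow> real) \<Rightarrow> bool" where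
  "homogeneous_fun M r s f \<longleftrightarrow>
     (\<forall>\<xi>\<in>slashed M r. \<forall>a>0. f (tscale a \<xi>) = a ^ s * f \<xi>)"

definition homogeneous_field ::
    "('i, 'a) atlas \<Rightarrow> nat \<Rightarrow> nat \<Rightarrow> (('i, 'a) tpoint \<Rightarrow> ('i, 'a) tpoint) \<Rightarrow> bool" where
  "homogeneous_field M r s A \<longleftrightarrow>
     (\<forall>\<xi>\<in>slashed M r. lie_bracket (iter_tangent M r) (liouville M r) A \<xi> = tscale (real s - 1) (A \<xi>))"

end

theory Submission
  imports Defs
begin

text \<open>
  All the maps involved preserve the chart index, so everything can be computed in induced charts.
  Let \<open>N = T\<^sup>r\<^sup>-\<^sup>1M\<close> and write the coordinates of \<open>TTN\<close> as \<open>(x, v, w, z)\<close>. The symmetry of second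
  derivatives shows that interchanging \<open>v\<close> and \<open>w\<close> is compatible with chart changes, and this
  defines \<open>\<kappa>\<close>. If \<open>A = (A\<^sub>1, A\<^sub>2)(x, y)\<close> on \<open>TN\<close>, then at \<open>(x, v, w, z)\<close>
  \<open>A\<^sup>v = (0, A\<^sub>1, 0, A\<^sub>2)\<close> and \<open>A\<^sup>c = (A\<^sub>1, dA\<^sub>1(v, z), A\<^sub>2, dA\<^sub>2(v, z))\<close>, evaluated at \<open>(x, w)\<close>;
  similarly \<open>f\<^sup>v = f(x, w)\<close> and \<open>f\<^sup>c = df(v, z)\<close>. By Euler's theorem, \<open>A\<close> is \<open>s\<close>-homogeneous iff
  \<open>A\<^sub>1\<close> and \<open>A\<^sub>2\<close> are homogeneous functions of degrees \<open>s - 1\<close> and \<open>s\<close> in \<open>y\<close>. Differentiating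
  \<open>h(x, ay) = a\<^sup>d h(x, y)\<close> shows that the differential \<open>dh(v, z)\<close> at \<open>(x, w)\<close> is homogeneous of the same
  degree \<open>d\<close> in \<open>(w, z)\<close>, so all components of the lifts have the required degrees.
\<close>

section \<open>Calculus on open subsets of Euclidean spaces\<close>

text \<open>The dimension of T^rM grows with r, so no fixed Euclidean type can serve, and calculus
  is built from partial derivatives of functions of sequences. Two definitions shape the proof.
  \<open>canonical_flip\<close> is a definite description: nothing is known about it until one
  explicit map satisfies the description and every competitor is shown to agree with that map.
  Competitors are pinned down because each second-order tangent vector is a mixed velocity of some
  surface. Further, a tangent vector is a family of components in all charts, whereas
  \<open>tangent_map\<close> and \<open>differential\<close> compute in one arbitrarily chosen
  chart. Independence of that choice is the chain rule, packaged as functoriality of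
  \<open>tlift\<close>; once it is available, a single chart index suffices throughout.\<close>

abbreviation euc :: "nat \<Rightarrow> (nat \<Rightarrow> real) set" where
  "euc d \<equiv> topspace (Euclidean_space d)"

abbreviation eopen :: "nat \<Rightarrow> (nat \<Rightarrow> real) set \<Rightarrow> bool" where
  "eopen d \<equiv> openin (Euclidean_space d)"

lemma in_euc: "x \<in> euc d \<longleftrightarrow> (\<forall>k\<ge>d. x k = 0)"
  by (simp add: topspace_Euclidean_space)

text \<open>Links the two topologies in play: \<open>Ck_on\<close> uses \<open>continuous_on\<close>
  for the product topology of the function type, while openness is that of
  \<open>Euclidean_space d\<close>. Facts on relatively open subsets of \<open>euc d\<close> become
  applicable.\<close>

lemma eopen_iff: "eopen d U \<longleftrightarrow> openin (top_of_set (euc d)) U"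
  unfolding topspace_Euclidean_space by (simp only: Euclidean_space_def euclidean_product_topology)

lemma eopen_subset: "eopen d U \<Longrightarrow> U \<subseteq> euc d"
  by (rule openin_subset)

lemma box_eopen: "eopen d {x \<in> euc d. \<forall>k<d. \<bar>x k - a k\<bar> < \<delta>}"
proof -
  have "{x \<in> euc d. \<forall>k<d. \<bar>x k - a k\<bar> < \<delta>} = euc d \<inter> (\<Inter>k\<in>{..<d}. {x. \<bar>x k - a k\<bar> < \<delta>})"
    by auto
  moreover have "open (\<Inter>k\<in>{..<d}. {x :: nat \<Rightarrow> real. \<bar>x k - a k\<bar> < \<delta>})"
    by (intro open_INT ballI finite_lessThan open_Collect_less continuous_intros
        continuous_on_product_coordinates)
  ultimately show ?thesis
    unfolding eopen_iff by (simp only: openin_open_Int)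
qed

text \<open>A basic neighbourhood of the product topology restricts each coordinate separately.
  Those from \<open>d\<close> on vanish throughout \<open>euc d\<close>, so a minimum over finitely
  many radii suffices.\<close>

lemma eopen_box:
  assumes "eopen d U" "a \<in> U"
  obtains \<delta> where "\<delta> > 0" "\<And>x. x \<in> euc d \<Longrightarrow> (\<And>k. k < d \<Longrightarrow> \<bar>x k - a k\<bar> < \<delta>) \<Longrightarrow> x \<in> U"
proof -
  obtain T where T: "open T" "U = euc d \<inter> T"
    using assms(1) unfolding eopen_iff openin_open by blast
  have "openin (product_topology (\<lambda>i::nat. euclideanreal) UNIV) T"
    using T(1) by (simp add: euclidean_product_topology)
  then obtain X where X: "a \<in> (\<Pi>\<^sub>E i\<in>UNIV. X i)" "\<And>i. open (X i :: real set)" "(\<Pi>\<^sub>E i\<in>UNIV. X i) \<subseteq> T"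
    using product_topology_open_contains_basis[of "\<lambda>i. euclideanreal" UNIV T a] assms(2) T(2)
    by auto
  have "\<exists>e>0. \<forall>y. \<bar>y - a k\<bar> < e \<longrightarrow> y \<in> X k" for k
    using X(1) X(2)[of k] by (force simp: open_dist dist_real_def PiE_iff)
  then obtain e where e: "\<And>k. e k > 0" "\<And>k y. \<bar>y - a k\<bar> < e k \<Longrightarrow> y \<in> X k" by metis
  \<comment> \<open>The inserted \<open>1\<close> keeps the set nonempty when
    \<open>d = 0\<close>.\<close>
  define \<delta> where "\<delta> = Min (insert 1 (e ` {..<d}))"
  have "\<delta> > 0" using e(1) by (simp add: \<delta>_def)
  moreover have "x \<in> U" if x: "x \<in> euc d" "\<And>k. k < d \<Longrightarrow> \<bar>x k - a k\<bar> < \<delta>" for x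
  proof -
    have "x k \<in> X k" for k
    proof (cases "k < d")
      case True
      then have "\<delta> \<le> e k" by (simp add: \<delta>_def)
      then show ?thesis using x(2)[OF True] e(2) by fastforce
    next
      case False
      then have "x k = a k" using x(1) assms T(2) by (auto simp: in_euc)
      then show ?thesis using X(1) by (auto simp: PiE_iff)
    qed
    then have "x \<in> T" using X(3) by (auto simp: PiE_iff)
    with x(1) T(2) show ?thesis by blast
  qed
  ultimately show ?thesis by (rule that)
qed

lemma eopenI:
  assumes "U \<subseteq> euc d"
    and "\<And>a. a \<in> U \<Longrightarrow> \<exists>V. eopen d V \<and> a \<in> V \<and> V \<subseteq> U"
  shows "eopen d U"
  using assms(2) by (subst openin_subopen) blast

lemma eopen_preimage:
  assumes "eopen d U" "eopen e V"
    and "\<And>k. k < e \<Longrightarrow> continuous_on U (\<lambda>x. F x k)"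
    and "\<And>x. x \<in> U \<Longrightarrow> F x \<in> euc e"
  shows "eopen d {x \<in> U. F x \<in> V}"
proof -
  have "continuous_on U (\<lambda>x. F x k)" for k
  proof (cases "k < e")
    case False
    then have "\<And>x. x \<in> U \<Longrightarrow> F x k = 0" using assms(4) by (simp add: in_euc)
    then show ?thesis by (metis continuous_on_const continuous_on_cong)
  qed (rule assms)
  then have "continuous_on U F" by (rule continuous_on_coordinatewise_then_product)
  then have "openin (top_of_set U) (U \<inter> F -` V)"
    using assms(2,4) unfolding eopen_iff
    by (metis continuous_openin_preimage image_subset_iff_funcset image_subsetI)
  moreover have "U \<inter> F -` V = {x \<in> U. F x \<in> V}" by auto
  ultimately show ?thesis
    using assms(1) unfolding eopen_iff by (metis openin_trans)
qed

lemma eopen_continuous_box: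
  assumes "eopen d U" "continuous_on U g" "a \<in> U" "\<epsilon> > 0"
  obtains \<delta> where "\<delta> > 0"
    "\<And>x. x \<in> euc d \<Longrightarrow> (\<And>k. k < d \<Longrightarrow> \<bar>x k - a k\<bar> < \<delta>) \<Longrightarrow> x \<in> U \<and> \<bar>g x - g a\<bar> < (\<epsilon>::real)"
proof -
  have "open {y. \<bar>y - g a\<bar> < \<epsilon>}"
    by (intro open_Collect_less continuous_intros)
  then have "openin (top_of_set U) (U \<inter> g -` {y. \<bar>y - g a\<bar> < \<epsilon>})"
    using assms(2) by (rule continuous_openin_preimage_gen[rotated])
  then have "eopen d (U \<inter> g -` {y. \<bar>y - g a\<bar> < \<epsilon>})"
    using assms(1) unfolding eopen_iff by (metis openin_trans)
  then obtain \<delta> where "\<delta> > 0" "\<And>x. x \<in> euc d \<Longrightarrow> (\<And>k. k < d \<Longrightarrow> \<bar>x k - a k\<bar> < \<delta>) \<Longrightarrow> x \<in> U \<inter> g -` {y. \<bar>y - g a\<bar> < \<epsilon>}"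
    by (rule eopen_box[of d _ a]) (use assms(3,4) in auto)
  with that show ?thesis by blast
qed

lemma euc_upd: "x \<in> euc d \<Longrightarrow> l < d \<Longrightarrow> x(l := t) \<in> euc d"
  by (auto simp: in_euc)

text \<open>\<open>partial\<close> depends only on the germ of a one-variable slice. Agreement on an
  open set becomes agreement of slices near the base point, which is what the congruence rules
  need.\<close>

lemma eopen_eventually_upd:
  assumes "eopen d U" "x \<in> U" "l < d"
  shows "\<forall>\<^sub>F t in nhds (x l). x(l := t) \<in> U"
proof -
  obtain \<delta> where \<delta>: "\<delta> > 0" "\<And>y. y \<in> euc d \<Longrightarrow> (\<And>k. k < d \<Longrightarrow> \<bar>y k - x k\<bar> < \<delta>) \<Longrightarrow> y \<in> U"
    using eopen_box[OF assms(1,2)] by metis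
  have x: "x \<in> euc d" using assms eopen_subset by blast
  have "x(l := t) \<in> U" if "dist t (x l) < \<delta>" for t
    using that \<delta>(1) by (intro \<delta>(2) euc_upd x assms) (auto simp: dist_real_def)
  with \<delta>(1) show ?thesis unfolding eventually_nhds_metric by blast
qed

lemma Ck_on_continuous: "Ck_on d m U g \<Longrightarrow> continuous_on U g"
  by (cases m) auto

lemma partial_cong:
  assumes "eopen d U" "x \<in> U" "l < d" "\<And>y. y \<in> U \<Longrightarrow> g y = h y"
  shows "partial l g x = partial l h x"
  unfolding partial_def
  by (rule deriv_cong_ev)
    (auto intro: eventually_mono[OF eopen_eventually_upd[OF assms(1-3)]] simp: assms(4))

lemma upd_differentiable_cong:
  assumes "eopen d U" "x \<in> U" "l < d" "\<And>y. y \<in> U \<Longrightarrow> g y = h y"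
    "(\<lambda>t. g (x(l := t))) field_differentiable at (x l)"
  shows "(\<lambda>t. h (x(l := t))) field_differentiable at (x l)"
proof -
  have "\<forall>\<^sub>F t in nhds (x l). g (x(l := t)) = h (x(l := t))"
    by (rule eventually_mono[OF eopen_eventually_upd[OF assms(1-3)]]) (simp add: assms(4))
  then show ?thesis
    using assms(5) unfolding field_differentiable_def by (metis DERIV_cong_ev)
qed

lemma Ck_on_cong:
  assumes "eopen d U" "\<And>y. y \<in> U \<Longrightarrow> g y = h y" "Ck_on d m U g"
  shows "Ck_on d m U h"
  using assms(2,3)
proof (induction m arbitrary: g h)
  case 0
  then show ?case by (metis Ck_on.simps(1) continuous_on_cong)
next
  case (Suc m)
  have "continuous_on U h" using Suc.prems by (metis Ck_on_continuous continuous_on_cong)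
  moreover have "(\<lambda>t. h (x(l := t))) field_differentiable at (x l)" if "l < d" "x \<in> U" for l x
    using upd_differentiable_cong[OF assms(1) that(2,1), of g h] Suc.prems that by simp
  moreover have "Ck_on d m U (partial l h)" if "l < d" for l
    using Suc.IH[of "partial l g"] partial_cong[OF assms(1) _ that, of _ g h] Suc.prems that by simp
  ultimately show ?case by simp
qed

lemma Ck_on_subset:
  assumes "V \<subseteq> U" "Ck_on d m U g"
  shows "Ck_on d m V g"
  using assms(2)
proof (induction m arbitrary: g)
  case 0
  then show ?case using assms(1) by (auto intro: continuous_on_subset)
next
  case (Suc m)
  then show ?case using assms(1) by (auto intro: continuous_on_subset)
qed

lemma Ck_on_Suc_lower: "Ck_on d (Suc m) U g \<Longrightarrow> Ck_on d m U g"
proof (induction m arbitrary: g)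
  case (Suc m)
  then show ?case by (metis Ck_on.simps(2))
qed simp

lemma Ck_on_has_partial:
  assumes "Ck_on d (Suc m) U g" "x \<in> U" "l < d"
  shows "((\<lambda>t. g (x(l := t))) has_real_derivative partial l g x) (at (x l))"
  using assms by (simp add: partial_def DERIV_deriv_iff_field_differentiable)

text \<open>\<open>partial\<close> is a \<open>deriv\<close> and carries information only where the
  slice is differentiable. This rule takes a derivative formula \<open>g'\<close> instead and
  identifies it with \<open>partial\<close> on \<open>U\<close>; products and composites are handled
  by supplying \<open>g'\<close>.\<close>

lemma Ck_on_SucI:
  assumes "eopen d U" "continuous_on U g"
    and "\<And>x l. x \<in> U \<Longrightarrow> l < d \<Longrightarrow> ((\<lambda>t. g (x(l := t))) has_real_derivative g' l x) (at (x l))"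
    and "\<And>l. l < d \<Longrightarrow> Ck_on d m U (g' l)"
  shows "Ck_on d (Suc m) U g"
proof -
  have "partial l g x = g' l x" if "x \<in> U" "l < d" for x l
    unfolding partial_def by (rule DERIV_imp_deriv[OF assms(3)[OF that]])
  then have "Ck_on d m U (partial l g)" if "l < d" for l
    using Ck_on_cong[OF assms(1) _ assms(4)[OF that], of "partial l g"] that by simp
  with assms(2,3) show ?thesis by (auto simp: field_differentiable_def)
qed

section \<open>Closure properties of C^k functions\<close>

lemma Ck_on_const: "Ck_on d m U (\<lambda>x. c)"
proof (induction m arbitrary: c)
  case (Suc m)
  have "partial l (\<lambda>x::nat \<Rightarrow> real. c) = (\<lambda>x. 0)" for l by (simp add: partial_def fun_eq_iff)
  then show ?case using Suc by simp
qed simp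

lemma Ck_on_coord:
  assumes "eopen d U" shows "Ck_on d m U (\<lambda>x. x k)"
proof (cases m)
  case 0
  then show ?thesis
    using continuous_on_product_then_coordinatewise[OF continuous_on_id] by simp
next
  case (Suc n)
  show ?thesis unfolding Suc
  proof (rule Ck_on_SucI[where g' = "\<lambda>l x. if l = k then 1 else 0"])
    show "Ck_on d n U (\<lambda>x. if l = k then 1 else 0)" for l
      by (simp add: Ck_on_const)
    show "continuous_on U (\<lambda>x. x k)"
      by (rule continuous_on_product_then_coordinatewise[OF continuous_on_id])
  qed (auto intro: assms derivative_eq_intros)
qed

lemma Ck_on_add:
  assumes "eopen d U" "Ck_on d m U g" "Ck_on d m U h"
  shows "Ck_on d m U (\<lambda>x. g x + h x)"
  using assms(2,3)
proof (induction m arbitrary: g h)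
  case 0
  then show ?case by (auto intro: continuous_intros)
next
  case (Suc m)
  show ?case
  proof (rule Ck_on_SucI[where g' = "\<lambda>l x. partial l g x + partial l h x"])
    show "continuous_on U (\<lambda>x. g x + h x)"
      using Suc.prems by (auto intro: continuous_intros)
    show "Ck_on d m U (\<lambda>x. partial l g x + partial l h x)" if "l < d" for l
      using Suc that by simp
  qed (intro assms DERIV_add Ck_on_has_partial[OF Suc.prems(1)] Ck_on_has_partial[OF Suc.prems(2)]; assumption)+
qed

lemma Ck_on_mult:
  assumes "eopen d U" "Ck_on d m U g" "Ck_on d m U h"
  shows "Ck_on d m U (\<lambda>x. g x * h x)"
  using assms(2,3)
proof (induction m arbitrary: g h)
  case 0
  then show ?case by (auto intro: continuous_intros)
next
  case (Suc m)
  show ?case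
  proof (rule Ck_on_SucI[where g' = "\<lambda>l x. partial l g x * h x + partial l h x * g x"])
    show "continuous_on U (\<lambda>x. g x * h x)"
      using Suc.prems by (auto intro: continuous_intros)
    show "Ck_on d m U (\<lambda>x. partial l g x * h x + partial l h x * g x)" if "l < d" for l
      using Suc.prems that Ck_on_Suc_lower[OF Suc.prems(1)] Ck_on_Suc_lower[OF Suc.prems(2)]
      by (intro Ck_on_add assms Suc.IH) auto
    show "((\<lambda>t. g (x(l := t)) * h (x(l := t))) has_real_derivative
        partial l g x * h x + partial l h x * g x) (at (x l))" if "x \<in> U" "l < d" for x l
      using DERIV_mult[OF Ck_on_has_partial[OF Suc.prems(1) that] Ck_on_has_partial[OF Suc.prems(2) that]]
      by (simp only: fun_upd_triv)
  qed (rule assms)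
qed

lemma Ck_on_sum:
  assumes "eopen d U" "\<And>k. k < (e::nat) \<Longrightarrow> Ck_on d m U (g k)"
  shows "Ck_on d m U (\<lambda>x. \<Sum>k<e. g k x)"
  using assms(2) by (induction e) (auto intro!: Ck_on_add assms(1) simp: Ck_on_const)

section \<open>Mean values, the chain rule and composition\<close>

lemma MVT_segment:
  fixes f :: "real \<Rightarrow> real"
  assumes "\<And>x. \<bar>x - a\<bar> \<le> \<bar>b - a\<bar> \<Longrightarrow> (f has_real_derivative f' x) (at x)"
  obtains z where "\<bar>z - a\<bar> \<le> \<bar>b - a\<bar>" "f b - f a = f' z * (b - a)"
proof (cases a b rule: linorder_cases)
  case less
  then show ?thesis using MVT2[of a b f f'] assms that
    by (smt (verit) mult.commute)
next
  case greater
  then show ?thesis using MVT2[of b a f f'] assms that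
    by (smt (verit) mult.commute minus_mult_right)
qed (use that in auto)

text \<open>The increment from \<open>a\<close> to \<open>x\<close> is split into increments along the coordinate directions.\<close>

lemma mean_value_coordinates:
  assumes g: "Ck_on d (Suc m) U g"
    and box: "\<And>y. y \<in> euc d \<Longrightarrow> (\<And>k. k < d \<Longrightarrow> \<bar>y k - a k\<bar> < \<delta>) \<Longrightarrow> y \<in> U"
    and x: "x \<in> euc d" "\<And>k. k < d \<Longrightarrow> \<bar>x k - a k\<bar> < \<delta>" and a: "a \<in> euc d"
  shows "\<exists>\<zeta>. (\<forall>k<d. \<zeta> k \<in> euc d \<and> (\<forall>l<d. \<bar>\<zeta> k l - a l\<bar> \<le> \<bar>x l - a l\<bar>)) \<and>
    g x - g a = (\<Sum>k<d. partial k g (\<zeta> k) * (x k - a k))"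
proof -
  define z where "z j = (\<lambda>k. if k < j then x k else a k)" for j
  have "\<exists>\<zeta>. \<zeta> \<in> euc d \<and> (\<forall>l<d. \<bar>\<zeta> l - a l\<bar> \<le> \<bar>x l - a l\<bar>) \<and>
      g (z (Suc k)) - g (z k) = partial k g \<zeta> * (x k - a k)" if k: "k < d" for k
  proof -
    have E: "(z k)(k := t) \<in> euc d" for t
      using x(1) a k by (auto simp: in_euc z_def)
    have "((\<lambda>t. g ((z k)(k := t))) has_real_derivative partial k g ((z k)(k := t))) (at t)"
      if t: "\<bar>t - a k\<bar> \<le> \<bar>x k - a k\<bar>" for t
    proof -
      have "(z k)(k := t) \<in> U"
        using x(2) t k by (intro box E) (fastforce simp: z_def)
      from Ck_on_has_partial[OF g this k] show ?thesis by simp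
    qed
    then obtain t where t: "\<bar>t - a k\<bar> \<le> \<bar>x k - a k\<bar>"
      "g ((z k)(k := x k)) - g ((z k)(k := a k)) = partial k g ((z k)(k := t)) * (x k - a k)"
      using MVT_segment[of "a k" "x k" "\<lambda>t. g ((z k)(k := t))" "\<lambda>t. partial k g ((z k)(k := t))"]
      by blast
    have "(z k)(k := x k) = z (Suc k)" "(z k)(k := a k) = z k"
      by (auto simp: z_def fun_eq_iff)
    with t E show ?thesis
      by (intro exI[of _ "(z k)(k := t)"]) (auto simp: z_def)
  qed
  then obtain \<zeta> where \<zeta>: "\<And>k. k < d \<Longrightarrow> \<zeta> k \<in> euc d \<and> (\<forall>l<d. \<bar>\<zeta> k l - a l\<bar> \<le> \<bar>x l - a l\<bar>) \<and>
      g (z (Suc k)) - g (z k) = partial k g (\<zeta> k) * (x k - a k)" by metis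
  have "z d = x" "z 0 = a"
    using x(1) a by (auto simp: z_def in_euc fun_eq_iff)
  then have "g x - g a = (\<Sum>k<d. g (z (Suc k)) - g (z k))"
    using sum_lessThan_telescope[of "\<lambda>k. g (z k)" d] by simp
  also have "\<dots> = (\<Sum>k<d. partial k g (\<zeta> k) * (x k - a k))"
    by (rule sum.cong) (use \<zeta> in auto)
  finally show ?thesis using \<zeta> by blast
qed

text \<open>Continuity of the partial derivatives is what drives the chain rule. The increment of
  \<open>g\<close> is a sum of partials at intermediate points times coordinate increments; these
  points are squeezed towards \<open>\<gamma> t\<close>, so the difference quotient has the expected
  limit.\<close>

lemma Ck_on_chain_curve:
  assumes U: "eopen d U" and g: "Ck_on d (Suc m) U g"
    and \<gamma>: "\<gamma> t \<in> U" "\<forall>\<^sub>F u in at t. \<gamma> u \<in> euc d"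
      "\<And>k. k < d \<Longrightarrow> ((\<lambda>u. \<gamma> u k) has_real_derivative \<gamma>' k) (at t)"
  shows "((\<lambda>u. g (\<gamma> u)) has_real_derivative (\<Sum>k<d. partial k g (\<gamma> t) * \<gamma>' k)) (at t)"
proof -
  define a where "a = \<gamma> t"
  have aU: "a \<in> U" and a: "a \<in> euc d" using \<gamma>(1) U eopen_subset by (auto simp: a_def)
  have lim: "((\<lambda>u. \<gamma> u k) \<longlongrightarrow> a k) (at t)" if "k < d" for k
    using DERIV_isCont[OF \<gamma>(3)[OF that]] by (simp add: isCont_def a_def)
  have close: "\<forall>\<^sub>F u in at t. \<forall>k<d. \<bar>\<gamma> u k - a k\<bar> < \<delta>" if "\<delta> > 0" for \<delta>
  proof -
    have "\<forall>\<^sub>F u in at t. \<forall>k\<in>{..<d}. \<bar>\<gamma> u k - a k\<bar> < \<delta>"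
      using lim that by (intro eventually_ball_finite) (auto simp: tendsto_iff dist_real_def)
    then show ?thesis by (rule eventually_mono) simp
  qed
  obtain \<delta> where \<delta>: "\<delta> > 0" "\<And>x. x \<in> euc d \<Longrightarrow> (\<And>k. k < d \<Longrightarrow> \<bar>x k - a k\<bar> < \<delta>) \<Longrightarrow> x \<in> U"
    using eopen_box[OF U aU] by metis
  define P where "P u \<zeta> \<longleftrightarrow> (\<forall>k<d. \<zeta> k \<in> euc d \<and> (\<forall>l<d. \<bar>\<zeta> k l - a l\<bar> \<le> \<bar>\<gamma> u l - a l\<bar>)) \<and>
    g (\<gamma> u) - g a = (\<Sum>k<d. partial k g (\<zeta> k) * (\<gamma> u k - a k))" for u \<zeta>
  \<comment> \<open>The intermediate points are picked separately for each \<open>u\<close>; the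
    bound contained in \<open>P\<close> makes them converge whatever the choice.\<close>
  define \<zeta> where "\<zeta> u = (SOME \<zeta>. P u \<zeta>)" for u
  have P: "\<forall>\<^sub>F u in at t. P u (\<zeta> u)"
    using close[OF \<delta>(1)] \<gamma>(2)
  proof eventually_elim
    case (elim u)
    have "\<exists>\<zeta>. P u \<zeta>"
      unfolding P_def by (rule mean_value_coordinates[OF g \<delta>(2) _ _ a]) (use elim in blast)+
    then show ?case unfolding \<zeta>_def by (rule someI_ex)
  qed
  have lim': "((\<lambda>u. partial k g (\<zeta> u k)) \<longlongrightarrow> partial k g a) (at t)" if k: "k < d" for k
    unfolding tendsto_iff
  proof (intro allI impI)
    fix \<epsilon> :: real assume "\<epsilon> > 0"
    have c: "continuous_on U (partial k g)"
      using g k by (auto intro: Ck_on_continuous)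
    obtain \<eta> where \<eta>: "\<eta> > 0" "\<And>x. x \<in> euc d \<Longrightarrow> (\<And>k. k < d \<Longrightarrow> \<bar>x k - a k\<bar> < \<eta>) \<Longrightarrow>
        x \<in> U \<and> \<bar>partial k g x - partial k g a\<bar> < \<epsilon>"
      using eopen_continuous_box[OF U c aU \<open>\<epsilon> > 0\<close>] by metis
    show "\<forall>\<^sub>F u in at t. dist (partial k g (\<zeta> u k)) (partial k g a) < \<epsilon>"
      using P close[OF \<eta>(1)]
    proof eventually_elim
      case (elim u)
      then have "\<zeta> u k \<in> euc d" "\<And>l. l < d \<Longrightarrow> \<bar>\<zeta> u k l - a l\<bar> < \<eta>"
        using k by (force simp: P_def)+
      then show ?case using \<eta>(2) by (simp add: dist_real_def)
    qed
  qed
  have "((\<lambda>u. \<Sum>k<d. partial k g (\<zeta> u k) * ((\<gamma> u k - \<gamma> t k) / (u - t))) \<longlongrightarrow>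
      (\<Sum>k<d. partial k g a * \<gamma>' k)) (at t)"
    using \<gamma>(3) by (intro tendsto_sum tendsto_mult lim') (auto simp: has_field_derivative_iff)
  moreover have "\<forall>\<^sub>F u in at t. (\<Sum>k<d. partial k g (\<zeta> u k) * ((\<gamma> u k - \<gamma> t k) / (u - t)))
      = (g (\<gamma> u) - g (\<gamma> t)) / (u - t)"
    using P by eventually_elim (simp add: P_def a_def sum_divide_distrib)
  ultimately show ?thesis
    unfolding has_field_derivative_iff a_def by (rule Lim_transform_eventually)
qed

lemma Ck_on_chain_partial:
  assumes V: "eopen e V" and g: "Ck_on e (Suc m') V g" and U: "eopen d U"
    and F: "\<And>k. k < e \<Longrightarrow> Ck_on d (Suc m) U (\<lambda>x. F x k)" "\<And>x. x \<in> U \<Longrightarrow> F x \<in> V"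
    and x: "x \<in> U" "l < d"
  shows "((\<lambda>t. g (F (x(l := t)))) has_real_derivative
    (\<Sum>k<e. partial k g (F x) * partial l (\<lambda>x. F x k) x)) (at (x l))"
proof -
  have "\<forall>\<^sub>F t in at (x l). F (x(l := t)) \<in> euc e"
    using eventually_nhds_conv_at[THEN iffD1, OF eopen_eventually_upd[OF U x]]
      F(2) eopen_subset[OF V] by (auto elim!: eventually_mono)
  from Ck_on_chain_curve[OF V g, of "\<lambda>t. F (x(l := t))", OF _ this Ck_on_has_partial[OF F(1) x]]
  show ?thesis using F(2) x(1) by simp
qed

text \<open>Induction on the order with the chain rule as derivative formula:
  \<open>partial k g\<close> after \<open>F\<close> falls under the induction hypothesis, and the
  partials of \<open>F\<close> lose exactly one order.\<close>

lemma Ck_on_compose: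
  assumes V: "eopen e V" and U: "eopen d U"
    and g: "Ck_on e m V g"
    and F: "\<And>k. k < e \<Longrightarrow> Ck_on d m U (\<lambda>x. F x k)" "\<And>x. x \<in> U \<Longrightarrow> F x \<in> V"
  shows "Ck_on d m U (\<lambda>x. g (F x))"
  using g F(1)
proof (induction m arbitrary: g)
  case 0
  have "continuous_on U (\<lambda>x. F x k)" for k
  proof (cases "k < e")
    case False
    then have "\<And>x. x \<in> U \<Longrightarrow> F x k = 0" using F(2) eopen_subset[OF V] by (force simp: in_euc)
    then show ?thesis by (metis continuous_on_const continuous_on_cong)
  qed (use 0 in simp)
  then have "continuous_on U F" by (rule continuous_on_coordinatewise_then_product)
  then show ?case using 0(1) F(2) continuous_on_compose2[of V g U F] by auto
next
  case (Suc m)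
  have F': "Ck_on d m U (\<lambda>x. F x k)" if "k < e" for k
    using Suc.prems(2)[OF that] by (rule Ck_on_Suc_lower)
  show ?case
  proof (rule Ck_on_SucI[where g' = "\<lambda>l x. \<Sum>k<e. partial k g (F x) * partial l (\<lambda>x. F x k) x"])
    show "continuous_on U (\<lambda>x. g (F x))"
      by (rule Ck_on_continuous[OF Suc.IH[OF Ck_on_Suc_lower[OF Suc.prems(1)] F']])
    show "Ck_on d m U (\<lambda>x. \<Sum>k<e. partial k g (F x) * partial l (\<lambda>x. F x k) x)" if "l < d" for l
    proof (intro Ck_on_sum Ck_on_mult U)
      fix k assume "k < e"
      then have "Ck_on e m V (partial k g)" using Suc.prems(1) by simp
      then show "Ck_on d m U (\<lambda>x. partial k g (F x))" by (rule Suc.IH[OF _ F'])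
      show "Ck_on d m U (partial l (\<lambda>x. F x k))"
        using Suc.prems(2)[OF \<open>k < e\<close>] that by simp
    qed
  qed (rule U | (rule Ck_on_chain_partial[OF V Suc.prems(1) U Suc.prems(2) F(2)]; assumption))+
qed

text \<open>Both mixed partial derivatives are limits of this second difference quotient.\<close>

lemma second_difference:
  assumes U: "eopen d U" and g: "Ck_on d (Suc (Suc m)) U g" and x: "x \<in> euc d"
    and ab: "a < d" "b < d" "a \<noteq> b" and h: "0 < h" "h < \<delta>"
    and box: "\<And>y. y \<in> euc d \<Longrightarrow> (\<And>k. k < d \<Longrightarrow> \<bar>y k - x k\<bar> < \<delta>) \<Longrightarrow> y \<in> U"
  shows "\<exists>y\<in>euc d. (\<forall>k<d. \<bar>y k - x k\<bar> \<le> h) \<and>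
    g (x(a := x a + h, b := x b + h)) - g (x(a := x a + h)) - g (x(b := x b + h)) + g x
      = h * h * partial b (partial a g) y"
proof -
  have inU: "x(a := s, b := t) \<in> U" if "\<bar>s - x a\<bar> \<le> h" "\<bar>t - x b\<bar> \<le> h" for s t
    using that h by (intro box euc_upd x ab) auto
  have g1: "Ck_on d (Suc m) U (partial a g)" using g ab by simp
  have da: "((\<lambda>s. g (x(a := s, b := t))) has_real_derivative partial a g (x(a := s, b := t))) (at s)"
    if "\<bar>s - x a\<bar> \<le> h" "\<bar>t - x b\<bar> \<le> h" for s t
    using Ck_on_has_partial[OF g inU[OF that] ab(1)] ab(3) by (simp add: fun_upd_twist)
  have db: "((\<lambda>t. partial a g (x(a := s, b := t))) has_real_derivative
      partial b (partial a g) (x(a := s, b := t))) (at t)"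
    if "\<bar>s - x a\<bar> \<le> h" "\<bar>t - x b\<bar> \<le> h" for s t
    using Ck_on_has_partial[OF g1 inU[OF that] ab(2)] by simp
  \<comment> \<open>An increment in direction \<open>b\<close>, as a function of coordinate
    \<open>a\<close>. The mean value theorem in \<open>a\<close>, followed by one in
    \<open>b\<close>, turns the second difference into \<open>partial b (partial a g)\<close> at an
    intermediate point.\<close>
  define \<phi> where "\<phi> s = g (x(a := s, b := x b + h)) - g (x(a := s, b := x b))" for s
  have "(\<phi> has_real_derivative partial a g (x(a := s, b := x b + h)) - partial a g (x(a := s, b := x b))) (at s)"
    if "\<bar>s - x a\<bar> \<le> \<bar>(x a + h) - x a\<bar>" for s
    unfolding \<phi>_def using that h by (intro derivative_intros da) auto
  from MVT_segment[OF this] obtain s where s: "\<bar>s - x a\<bar> \<le> h" "\<phi> (x a + h) - \<phi> (x a) =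
      (partial a g (x(a := s, b := x b + h)) - partial a g (x(a := s, b := x b))) * h"
    using h by (metis add_diff_cancel_left' abs_of_pos)
  have "((\<lambda>t. partial a g (x(a := s, b := t))) has_real_derivative
      partial b (partial a g) (x(a := s, b := t))) (at t)" if "\<bar>t - x b\<bar> \<le> \<bar>(x b + h) - x b\<bar>" for t
    using that h s(1) by (intro db) auto
  from MVT_segment[OF this] obtain t where t: "\<bar>t - x b\<bar> \<le> h"
    "partial a g (x(a := s, b := x b + h)) - partial a g (x(a := s, b := x b)) =
      partial b (partial a g) (x(a := s, b := t)) * h"
    using h by (metis add_diff_cancel_left' abs_of_pos)
  have "\<phi> (x a + h) - \<phi> (x a) = g (x(a := x a + h, b := x b + h)) - g (x(a := x a + h)) - g (x(b := x b + h)) + g x"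
    using ab(3) by (simp add: \<phi>_def fun_upd_twist fun_upd_idem)
  then show ?thesis
    using s t h by (intro bexI[of _ "x(a := s, b := t)"] euc_upd x ab) (auto simp: algebra_simps)
qed

text \<open>The second difference is symmetric in \<open>a\<close> and \<open>b\<close>. Reading it
  in both orders with the same step makes the two mixed partials agree at two points near
  \<open>x\<close>; continuity then brings both points to \<open>x\<close>.\<close>

lemma Ck_on_partial_commute:
  assumes U: "eopen d U" and g: "Ck_on d (Suc (Suc m)) U g" and x: "x \<in> U"
    and ab: "a < d" "b < d"
  shows "partial a (partial b g) x = partial b (partial a g) x"
proof (cases "a = b")
  case False
  have "\<bar>partial a (partial b g) x - partial b (partial a g) x\<bar> \<le> \<epsilon>" if "\<epsilon> > 0" for \<epsilon>
  proof -
    have e: "\<epsilon> / 2 > 0" using that by simp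
    have c: "continuous_on U (partial b (partial a g))" "continuous_on U (partial a (partial b g))"
      using g ab by (auto intro: Ck_on_continuous)
    obtain \<delta> where \<delta>: "\<delta> > 0" "\<And>y. y \<in> euc d \<Longrightarrow> (\<And>k. k < d \<Longrightarrow> \<bar>y k - x k\<bar> < \<delta>) \<Longrightarrow>
        y \<in> U \<and> \<bar>partial b (partial a g) y - partial b (partial a g) x\<bar> < \<epsilon> / 2"
      using eopen_continuous_box[OF U c(1) x e] by metis
    obtain \<eta> where \<eta>: "\<eta> > 0" "\<And>y. y \<in> euc d \<Longrightarrow> (\<And>k. k < d \<Longrightarrow> \<bar>y k - x k\<bar> < \<eta>) \<Longrightarrow>
        y \<in> U \<and> \<bar>partial a (partial b g) y - partial a (partial b g) x\<bar> < \<epsilon> / 2"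
      using eopen_continuous_box[OF U c(2) x e] by metis
    \<comment> \<open>Half the minimum is strictly below both radii, so each intermediate point
      stays inside its box.\<close>
    define h where "h = min \<delta> \<eta> / 2"
    have h: "0 < h" "h < \<delta>" "h < \<eta>" using \<delta> \<eta> by (auto simp: h_def)
    have xE: "x \<in> euc d" using x U eopen_subset by blast
    obtain y where y: "y\<in>euc d" "\<forall>k<d. \<bar>y k - x k\<bar> \<le> h"
      "g (x(a := x a + h, b := x b + h)) - g (x(a := x a + h)) - g (x(b := x b + h)) + g x
        = h * h * partial b (partial a g) y"
      using second_difference[OF U g xE ab False h(1,2)] \<delta>(2) by metis
    obtain z where z: "z\<in>euc d" "\<forall>k<d. \<bar>z k - x k\<bar> \<le> h"
      "g (x(b := x b + h, a := x a + h)) - g (x(b := x b + h)) - g (x(a := x a + h)) + g x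
        = h * h * partial a (partial b g) z"
      using second_difference[OF U g xE ab(2,1) _ h(1,3)] \<eta>(2) False by metis
    have "h * h * partial a (partial b g) z = h * h * partial b (partial a g) y"
      using y(3) z(3) unfolding fun_upd_twist[OF False, of x "x a + h" "x b + h"] by linarith
    then have "partial a (partial b g) z = partial b (partial a g) y" using h by simp
    moreover have "\<bar>partial b (partial a g) y - partial b (partial a g) x\<bar> < \<epsilon> / 2"
      using \<delta>(2)[OF y(1)] y(2) h by fastforce
    moreover have "\<bar>partial a (partial b g) z - partial a (partial b g) x\<bar> < \<epsilon> / 2"
      using \<eta>(2)[OF z(1)] z(2) h by fastforce
    ultimately show ?thesis by linarith
  qed
  then show ?thesis by (metis abs_le_zero_iff dense_ge eq_iff_diff_eq_0)
qed simp

section \<open>Smooth functions\<close>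

lemma Cinf_on_open: "Cinf_on d U g \<Longrightarrow> eopen d U"
  by (simp add: Cinf_on_def)

lemma Cinf_on_Ck: "Cinf_on d U g \<Longrightarrow> Ck_on d m U g"
  by (simp add: Cinf_on_def)

lemma Cinf_on_cong: "Cinf_on d U g \<Longrightarrow> (\<And>y. y \<in> U \<Longrightarrow> g y = h y) \<Longrightarrow> Cinf_on d U h"
  unfolding Cinf_on_def by (blast intro: Ck_on_cong)

lemma Cinf_on_subset: "Cinf_on d U g \<Longrightarrow> V \<subseteq> U \<Longrightarrow> eopen d V \<Longrightarrow> Cinf_on d V g"
  unfolding Cinf_on_def by (blast intro: Ck_on_subset)

lemma Cinf_on_continuous: "Cinf_on d U g \<Longrightarrow> continuous_on U g"
  unfolding Cinf_on_def by (blast intro: Ck_on_continuous)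

lemma Cinf_on_const: "eopen d U \<Longrightarrow> Cinf_on d U (\<lambda>x. c)"
  by (simp add: Cinf_on_def Ck_on_const)

lemma Cinf_on_coord: "eopen d U \<Longrightarrow> Cinf_on d U (\<lambda>x. x k)"
  by (simp add: Cinf_on_def Ck_on_coord)

lemma Cinf_on_add: "Cinf_on d U g \<Longrightarrow> Cinf_on d U h \<Longrightarrow> Cinf_on d U (\<lambda>x. g x + h x)"
  by (simp add: Cinf_on_def Ck_on_add)

lemma Cinf_on_mult: "Cinf_on d U g \<Longrightarrow> Cinf_on d U h \<Longrightarrow> Cinf_on d U (\<lambda>x. g x * h x)"
  by (simp add: Cinf_on_def Ck_on_mult)

lemma Cinf_on_sum: "eopen d U \<Longrightarrow> (\<And>k. k < (e::nat) \<Longrightarrow> Cinf_on d U (g k)) \<Longrightarrow> Cinf_on d U (\<lambda>x. \<Sum>k<e. g k x)"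
  by (simp add: Cinf_on_def Ck_on_sum)

lemma Cinf_on_partial: "Cinf_on d U g \<Longrightarrow> l < d \<Longrightarrow> Cinf_on d U (partial l g)"
  unfolding Cinf_on_def by (metis Ck_on.simps(2))

lemma Cinf_on_compose:
  assumes "Cinf_on e V g" "eopen d U"
    and "\<And>k. k < e \<Longrightarrow> Cinf_on d U (\<lambda>x. F x k)" "\<And>x. x \<in> U \<Longrightarrow> F x \<in> V"
  shows "Cinf_on d U (\<lambda>x. g (F x))"
  using assms unfolding Cinf_on_def by (blast intro: Ck_on_compose)

lemma Cinf_on_has_partial:
  assumes "Cinf_on d U g" "x \<in> U" "l < d"
  shows "((\<lambda>t. g (x(l := t))) has_real_derivative partial l g x) (at (x l))"
  using Ck_on_has_partial[OF Cinf_on_Ck[OF assms(1)] assms(2,3)] .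

lemma Cinf_on_chain_curve:
  assumes "Cinf_on d U g" "\<gamma> t \<in> U" "\<forall>\<^sub>F u in at t. \<gamma> u \<in> euc d"
    "\<And>k. k < d \<Longrightarrow> ((\<lambda>u. \<gamma> u k) has_real_derivative \<gamma>' k) (at t)"
  shows "((\<lambda>u. g (\<gamma> u)) has_real_derivative (\<Sum>k<d. partial k g (\<gamma> t) * \<gamma>' k)) (at t)"
  using Ck_on_chain_curve[OF Cinf_on_open[OF assms(1)] Cinf_on_Ck[OF assms(1)] assms(2-4)] .

lemma partial_compose:
  assumes "Cinf_on e V g" "\<And>k. k < e \<Longrightarrow> Cinf_on d U (\<lambda>x. F x k)" "\<And>x. x \<in> U \<Longrightarrow> F x \<in> V"
    "eopen d U" "x \<in> U" "l < d"
  shows "partial l (\<lambda>x. g (F x)) x = (\<Sum>k<e. partial k g (F x) * partial l (\<lambda>x. F x k) x)"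
  unfolding partial_def[of l "\<lambda>x. g (F x)"]
  by (rule DERIV_imp_deriv, rule Ck_on_chain_partial[OF Cinf_on_open[OF assms(1)] Cinf_on_Ck[OF assms(1)] assms(4)
        Cinf_on_Ck[OF assms(2)] assms(3,5,6)])

lemma partial_commute:
  assumes "Cinf_on d U g" "x \<in> U" "a < d" "b < d"
  shows "partial a (partial b g) x = partial b (partial a g) x"
  using Ck_on_partial_commute[OF Cinf_on_open[OF assms(1)] Cinf_on_Ck[OF assms(1)] assms(2-4)] .

lemma partial_eqI:
  "((\<lambda>t. g (x(l := t))) has_real_derivative D) (at (x l)) \<Longrightarrow> partial l g x = D"
  unfolding partial_def by (rule DERIV_imp_deriv)

lemma partial_const [simp]: "partial l (\<lambda>x. c) x = 0"
  by (simp add: partial_def)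

lemma partial_coord: "partial l (\<lambda>x. x k) x = (if k = l then 1 else 0)"
  by (rule partial_eqI) (auto intro: derivative_eq_intros)

text \<open>The differential of \<open>g\<close> at \<open>x\<close> applied to \<open>y\<close>.
  The sums in \<open>tangent_space\<close>, \<open>tangent_map\<close> and
  \<open>differential\<close> all have this form, so one chain rule serves all three.\<close>

definition dirder :: "nat \<Rightarrow> ((nat \<Rightarrow> real) \<Rightarrow> real) \<Rightarrow> (nat \<Rightarrow> real) \<Rightarrow> (nat \<Rightarrow> real) \<Rightarrow> real" where
  "dirder d g x y = (\<Sum>l<d. partial l g x * y l)"

lemma dirder_cong:
  assumes "eopen d U" "x \<in> U" "\<And>y. y \<in> U \<Longrightarrow> g y = h y" "\<And>l. l < d \<Longrightarrow> y l = z l"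
  shows "dirder d g x y = dirder d h x z"
  unfolding dirder_def using partial_cong[OF assms(1,2) _ assms(3)] assms(4)
  by (intro sum.cong) auto

lemma dirder_compose:
  assumes "Cinf_on e V g" "\<And>k. k < e \<Longrightarrow> Cinf_on d U (\<lambda>x. F x k)" "\<And>x. x \<in> U \<Longrightarrow> F x \<in> V"
    "eopen d U" "x \<in> U"
  shows "dirder d (\<lambda>x. g (F x)) x y = dirder e g (F x) (\<lambda>k. dirder d (\<lambda>x. F x k) x y)"
proof -
  have "dirder d (\<lambda>x. g (F x)) x y = (\<Sum>l<d. \<Sum>k<e. partial k g (F x) * (partial l (\<lambda>x. F x k) x * y l))"
    unfolding dirder_def
    by (intro sum.cong refl) (simp add: partial_compose[OF assms] sum_distrib_right mult.assoc)
  also have "\<dots> = (\<Sum>k<e. \<Sum>l<d. partial k g (F x) * (partial l (\<lambda>x. F x k) x * y l))"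
    by (rule sum.swap)
  finally show ?thesis by (simp add: dirder_def sum_distrib_left)
qed

lemma dirder_coord: "dirder d (\<lambda>x. x k) x y = (if k < d then y k else 0)"
proof -
  have "dirder d (\<lambda>x. x k) x y = (\<Sum>l<d. if k = l then y l else 0)"
    unfolding dirder_def by (intro sum.cong) (auto simp: partial_coord)
  then show ?thesis by simp
qed

lemma dirder_const [simp]: "dirder d (\<lambda>x. c) x y = 0"
  by (simp add: dirder_def)

text \<open>Base and fibre blocks of tangent coordinates, with \<open>join\<close> as their inverse.
  All three are padded with zeros, so that values lie in the Euclidean space of the right dimension
  and equations hold between whole sequences.\<close>

definition lo :: "nat \<Rightarrow> (nat \<Rightarrow> real) \<Rightarrow> nat \<Rightarrow> real" where
  "lo n X = (\<lambda>k. if k < n then X k else 0)"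

definition hi :: "nat \<Rightarrow> (nat \<Rightarrow> real) \<Rightarrow> nat \<Rightarrow> real" where
  "hi n X = (\<lambda>k. if k < n then X (n + k) else 0)"

definition join :: "nat \<Rightarrow> (nat \<Rightarrow> real) \<Rightarrow> (nat \<Rightarrow> real) \<Rightarrow> nat \<Rightarrow> real" where
  "join n x y = (\<lambda>k. if k < n then x k else if k < 2 * n then y (k - n) else 0)"

text \<open>The tangent map of a map \<open>G\<close> between open subsets of Euclidean spaces.\<close>

definition tlift :: "nat \<Rightarrow> nat \<Rightarrow> ((nat \<Rightarrow> real) \<Rightarrow> nat \<Rightarrow> real) \<Rightarrow> (nat \<Rightarrow> real) \<Rightarrow> nat \<Rightarrow> real" where
  "tlift n n' G X = join n' (G (lo n X)) (\<lambda>k. dirder n (\<lambda>x. G x k) (lo n X) (hi n X))"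

lemma lo_euc [simp]: "lo n X \<in> euc n"
  by (simp add: in_euc lo_def)

lemma hi_euc [simp]: "hi n X \<in> euc n"
  by (simp add: in_euc hi_def)

lemma join_euc [simp]: "join n x y \<in> euc (2 * n)"
  by (simp add: in_euc join_def)

lemma join_lo_hi: "X \<in> euc (2 * n) \<Longrightarrow> join n (lo n X) (hi n X) = X"
  by (auto simp: join_def lo_def hi_def in_euc fun_eq_iff)

lemma lo_id: "x \<in> euc n \<Longrightarrow> lo n x = x"
  by (auto simp: lo_def in_euc fun_eq_iff)

lemma lo_join: "x \<in> euc n \<Longrightarrow> lo n (join n x y) = x"
  by (auto simp: join_def lo_def in_euc fun_eq_iff)

lemma hi_join: "hi n (join n x y) = (\<lambda>k. if k < n then y k else 0)"
  by (auto simp: join_def hi_def fun_eq_iff)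

lemma hi_join_lo: "hi n (join n x y) = lo n y"
  by (simp add: hi_join lo_def)

lemma hi_join_euc: "y \<in> euc n \<Longrightarrow> hi n (join n x y) = y"
  by (auto simp: hi_join in_euc fun_eq_iff)

lemma join_cong: "(\<And>k. k < n \<Longrightarrow> x k = x' k) \<Longrightarrow> (\<And>k. k < n \<Longrightarrow> y k = y' k) \<Longrightarrow> join n x y = join n x' y'"
  by (auto simp: join_def fun_eq_iff)

lemma tlift_euc [simp]: "tlift n n' G X \<in> euc (2 * n')"
  by (simp add: tlift_def)

lemma eopen_lo:
  assumes "eopen n W" shows "eopen (2 * n) {X \<in> euc (2 * n). lo n X \<in> W}"
proof (rule eopen_preimage[OF _ assms])
  show "eopen (2 * n) (euc (2 * n))" by (rule openin_topspace)
  show "continuous_on (euc (2 * n)) (\<lambda>X. lo n X k)" if "k < n" for k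
    using that Cinf_on_continuous[OF Cinf_on_coord[OF openin_topspace]] by (simp add: lo_def)
qed simp

lemma Cinf_on_lo:
  assumes "Cinf_on n W g" shows "Cinf_on (2 * n) {X \<in> euc (2 * n). lo n X \<in> W} (\<lambda>X. g (lo n X))"
proof (rule Cinf_on_compose[OF assms eopen_lo[OF Cinf_on_open[OF assms]]])
  show "Cinf_on (2 * n) {X \<in> euc (2 * n). lo n X \<in> W} (\<lambda>X. lo n X k)" if "k < n" for k
    using that Cinf_on_coord[OF eopen_lo[OF Cinf_on_open[OF assms]]] by (simp add: lo_def)
qed simp

lemma Cinf_on_dirder:
  assumes "Cinf_on n W g"
  shows "Cinf_on (2 * n) {X \<in> euc (2 * n). lo n X \<in> W} (\<lambda>X. dirder n g (lo n X) (hi n X))"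
  unfolding dirder_def
proof (intro Cinf_on_sum Cinf_on_mult Cinf_on_lo Cinf_on_partial assms)
  fix l assume "l < n"
  then show "Cinf_on (2 * n) {X \<in> euc (2 * n). lo n X \<in> W} (\<lambda>X. hi n X l)"
    using Cinf_on_coord[OF eopen_lo[OF Cinf_on_open[OF assms]]] by (simp add: hi_def)
qed (rule eopen_lo[OF Cinf_on_open[OF assms]])

lemma Cinf_on_tlift:
  assumes "\<And>k. k < n' \<Longrightarrow> Cinf_on n W (\<lambda>x. G x k)" "k < 2 * n'"
  shows "Cinf_on (2 * n) {X \<in> euc (2 * n). lo n X \<in> W} (\<lambda>X. tlift n n' G X k)"
proof (cases "k < n'")
  case True
  then show ?thesis using Cinf_on_lo[OF assms(1)] by (simp add: tlift_def join_def)
next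
  case False
  then show ?thesis using Cinf_on_dirder[OF assms(1), of "k - n'"] assms(2)
    by (simp add: tlift_def join_def)
qed

lemma tlift_cong:
  assumes "eopen n W" "lo n X \<in> W" "\<And>x. x \<in> W \<Longrightarrow> G x = H x"
  shows "tlift n n' G X = tlift n n' H X"
  unfolding tlift_def using assms dirder_cong[OF assms(1,2), of "\<lambda>x. G x _" "\<lambda>x. H x _"]
  by (intro join_cong) auto

text \<open>The chain rule in bundled form: passing to tangent maps is functorial. This is what
  frees the chart formula for \<open>tangent_map\<close> from the chosen chart.\<close>

lemma tlift_compose:
  assumes "\<And>k. k < n'' \<Longrightarrow> Cinf_on n' V (\<lambda>x. G x k)" "\<And>k. k < n' \<Longrightarrow> Cinf_on n W (\<lambda>x. F x k)"
    "\<And>x. x \<in> W \<Longrightarrow> F x \<in> V" "eopen n W" "eopen n' V" "lo n X \<in> W"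
  shows "tlift n n'' (\<lambda>x. G (F x)) X = tlift n' n'' G (tlift n n' F X)"
proof -
  have "F (lo n X) \<in> euc n'" using assms(3,5,6) eopen_subset by blast
  then have l: "lo n' (tlift n n' F X) = F (lo n X)" by (simp add: tlift_def lo_join)
  have "dirder n (\<lambda>x. G (F x) k) (lo n X) (hi n X) = dirder n' (\<lambda>x. G x k) (F (lo n X)) (hi n' (tlift n n' F X))"
    if "k < n''" for k
    using dirder_compose[OF assms(1)[OF that] assms(2,3,4,6), where y = "hi n X"]
    by (simp add: dirder_def tlift_def hi_join)
  then show ?thesis by (simp add: tlift_def[of _ n''] l cong: join_cong)
qed

section \<open>Rules for directional derivatives, up to second order\<close>

lemma partial_add:
  assumes "Cinf_on d U g" "Cinf_on d U h" "x \<in> U" "l < d"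
  shows "partial l (\<lambda>x. g x + h x) x = partial l g x + partial l h x"
  by (rule partial_eqI, rule DERIV_add[OF Cinf_on_has_partial[OF assms(1,3,4)] Cinf_on_has_partial[OF assms(2-4)]])

lemma partial_mult:
  assumes "Cinf_on d U g" "Cinf_on d U h" "x \<in> U" "l < d"
  shows "partial l (\<lambda>x. g x * h x) x = partial l g x * h x + partial l h x * g x"
  using DERIV_mult[OF Cinf_on_has_partial[OF assms(1,3,4)] Cinf_on_has_partial[OF assms(2-4)]]
  by (intro partial_eqI) (simp only: fun_upd_triv)

lemma dirder_add:
  assumes "Cinf_on d U g" "Cinf_on d U h" "x \<in> U"
  shows "dirder d (\<lambda>x. g x + h x) x y = dirder d g x y + dirder d h x y"
  using partial_add[OF assms] by (simp add: dirder_def distrib_right sum.distrib)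

lemma dirder_mult:
  assumes "Cinf_on d U g" "Cinf_on d U h" "x \<in> U"
  shows "dirder d (\<lambda>x. g x * h x) x y = dirder d g x y * h x + g x * dirder d h x y"
  using partial_mult[OF assms]
  by (simp add: dirder_def distrib_left distrib_right sum.distrib sum_distrib_left sum_distrib_right mult_ac)

lemma dirder_sum:
  assumes "eopen d U" "\<And>k. k < (e::nat) \<Longrightarrow> Cinf_on d U (g k)" "x \<in> U"
  shows "dirder d (\<lambda>x. \<Sum>k<e. g k x) x y = (\<Sum>k<e. dirder d (g k) x y)"
  using assms(2)
proof (induction e)
  case (Suc e)
  have "dirder d (\<lambda>x. (\<Sum>k<e. g k x) + g e x) x y = dirder d (\<lambda>x. \<Sum>k<e. g k x) x y + dirder d (g e) x y"
    by (rule dirder_add[OF Cinf_on_sum[OF assms(1)] _ assms(3)]) (use Suc.prems in auto)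
  with Suc show ?case by simp
qed simp

lemma dirder_lo:
  assumes g: "Cinf_on n W g" and Y: "Y \<in> euc (2 * n)" "lo n Y \<in> W"
  shows "dirder (2 * n) (\<lambda>Y. g (lo n Y)) Y Z = dirder n g (lo n Y) (lo n Z)"
proof -
  let ?U = "{X \<in> euc (2 * n). lo n X \<in> W}"
  note U = eopen_lo[OF Cinf_on_open[OF g]]
  have "dirder (2 * n) (\<lambda>Y. g (lo n Y)) Y Z = dirder n g (lo n Y) (\<lambda>k. dirder (2 * n) (\<lambda>Y. lo n Y k) Y Z)"
    by (rule dirder_compose[OF g _ _ U]) (use Y Cinf_on_coord[OF U] in \<open>auto simp: lo_def\<close>)
  also have "(\<lambda>k. dirder (2 * n) (\<lambda>Y. lo n Y k) Y Z) = lo n Z"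
    by (auto simp: lo_def dirder_coord fun_eq_iff)
  finally show ?thesis .
qed

text \<open>With Y = (x, v) and Z = (w, z), the product rule applied to dg(v) yields the second
  derivative of \<open>g\<close> at x in the directions w and v, plus dg(z). The first term is where
  second-order information enters the coordinates of TTN.\<close>

lemma dirder_dirder:
  assumes g: "Cinf_on n W g" and Y: "Y \<in> euc (2 * n)" "lo n Y \<in> W"
  shows "dirder (2 * n) (\<lambda>Y. dirder n g (lo n Y) (hi n Y)) Y Z =
    (\<Sum>l<n. dirder n (partial l g) (lo n Y) (lo n Z) * hi n Y l) + dirder n g (lo n Y) (hi n Z)"
proof -
  let ?U = "{X \<in> euc (2 * n). lo n X \<in> W}"
  have U: "eopen (2 * n) ?U" by (rule eopen_lo[OF Cinf_on_open[OF g]])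
  have c1: "Cinf_on (2 * n) ?U (\<lambda>Y. partial l g (lo n Y))" if "l < n" for l
    using Cinf_on_lo[OF Cinf_on_partial[OF g that]] .
  have c2: "Cinf_on (2 * n) ?U (\<lambda>Y. hi n Y l)" if "l < n" for l
    using Cinf_on_coord[OF U] that by (simp add: hi_def)
  have d2: "dirder (2 * n) (\<lambda>Y. hi n Y l) Y Z = hi n Z l" if "l < n" for l
    using that by (simp add: hi_def dirder_coord)
  have "dirder (2 * n) (\<lambda>Y. dirder n g (lo n Y) (hi n Y)) Y Z =
      (\<Sum>l<n. dirder (2 * n) (\<lambda>Y. partial l g (lo n Y) * hi n Y l) Y Z)"
    unfolding dirder_def[of n g] by (rule dirder_sum[OF U Cinf_on_mult[OF c1 c2]]) (use Y in auto)
  also have "\<dots> = (\<Sum>l<n. dirder n (partial l g) (lo n Y) (lo n Z) * hi n Y l + partial l g (lo n Y) * hi n Z l)"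
  proof (rule sum.cong[OF refl])
    fix l assume "l \<in> {..<n}"
    then have l: "l < n" by simp
    show "dirder (2 * n) (\<lambda>Y. partial l g (lo n Y) * hi n Y l) Y Z =
        dirder n (partial l g) (lo n Y) (lo n Z) * hi n Y l + partial l g (lo n Y) * hi n Z l"
      using dirder_mult[OF c1[OF l] c2[OF l], of Y Z] dirder_lo[OF Cinf_on_partial[OF g l] Y, of Z] d2[OF l] Y
      by simp
  qed
  finally show ?thesis by (simp add: sum.distrib dirder_def[of n g])
qed

section \<open>Charts of the tangent bundle\<close>

lemma smooth_atlas_inj: "smooth_atlas N \<Longrightarrow> i \<in> idx N \<Longrightarrow> inj_on (chart N i) (cdom N i)"
  by (simp add: smooth_atlas_def)

lemma chart_inv_chart:
  "smooth_atlas N \<Longrightarrow> i \<in> idx N \<Longrightarrow> p \<in> cdom N i \<Longrightarrow> chart_inv N i (chart N i p) = p"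
  by (simp add: chart_inv_def smooth_atlas_inj)

lemma chart_eqD:
  "smooth_atlas N \<Longrightarrow> i \<in> idx N \<Longrightarrow> p \<in> cdom N i \<Longrightarrow> q \<in> cdom N i \<Longrightarrow> chart N i p = chart N i q \<Longrightarrow> p = q"
  by (metis chart_inv_chart)

lemma chart_chart_inv:
  "x \<in> chart N i ` (S \<inter> cdom N i) \<Longrightarrow> chart N i (chart_inv N i x) = x"
  unfolding chart_inv_def by (intro f_inv_into_f) auto

lemma chart_image_iff:
  assumes "smooth_atlas N" "i \<in> idx N"
  shows "x \<in> chart N i ` (S \<inter> cdom N i) \<longleftrightarrow> x \<in> chart N i ` cdom N i \<and> chart_inv N i x \<in> S"
  using chart_inv_chart[OF assms] by force

lemma chart_inv_in:
  assumes "smooth_atlas N" "i \<in> idx N" "x \<in> chart N i ` (S \<inter> cdom N i)"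
  shows "chart_inv N i x \<in> S" "chart_inv N i x \<in> cdom N i"
  using chart_inv_chart[OF assms(1,2)] assms(3) by auto

lemma eopen_chart: "smooth_atlas N \<Longrightarrow> i \<in> idx N \<Longrightarrow> eopen (mdim N) (chart N i ` cdom N i)"
  by (simp add: smooth_atlas_def)

lemma chart_euc: "smooth_atlas N \<Longrightarrow> i \<in> idx N \<Longrightarrow> p \<in> cdom N i \<Longrightarrow> chart N i p \<in> euc (mdim N)"
  by (rule subsetD[OF eopen_subset[OF eopen_chart]]) auto

lemma eopen_chart_Int:
  "smooth_atlas N \<Longrightarrow> i \<in> idx N \<Longrightarrow> j \<in> idx N \<Longrightarrow> eopen (mdim N) (chart N i ` (cdom N j \<inter> cdom N i))"
  by (subst Int_commute) (simp add: smooth_atlas_def)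

lemma transition_smooth:
  "smooth_atlas N \<Longrightarrow> i \<in> idx N \<Longrightarrow> j \<in> idx N \<Longrightarrow> k < mdim N \<Longrightarrow>
    Cinf_on (mdim N) (chart N i ` (cdom N j \<inter> cdom N i)) (\<lambda>x. chart N j (chart_inv N i x) k)"
  by (subst Int_commute) (simp add: smooth_atlas_def)

lemma image_Int_chart:
  assumes "smooth_atlas N" "i \<in> idx N"
  shows "chart N i ` (S \<inter> T \<inter> cdom N i) = chart N i ` (S \<inter> cdom N i) \<inter> chart N i ` (T \<inter> cdom N i)"
  using smooth_atlas_inj[OF assms] by (auto simp: inj_on_def)

lemma in_mcarrier: "p \<in> mcarrier N \<longleftrightarrow> (\<exists>i\<in>idx N. p \<in> cdom N i)"
  by (simp add: mcarrier_def)

lemma chart_at: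
  assumes "p \<in> mcarrier N" shows "chart_at N p \<in> idx N" "p \<in> cdom N (chart_at N p)"
  using someI_ex[of "\<lambda>i. i \<in> idx N \<and> p \<in> cdom N i"] assms unfolding chart_at_def in_mcarrier by blast+

text \<open>For \<open>p\<close> in chart \<open>i\<close>, the tangent vector with prescribed
  component \<open>y\<close> in that chart; its other components are forced by the transformation
  law. It provides the inverse of a bundle chart.\<close>

definition tvec :: "('i, 'p) atlas \<Rightarrow> 'i \<Rightarrow> 'p \<Rightarrow> (nat \<Rightarrow> real) \<Rightarrow> 'i \<Rightarrow> nat \<Rightarrow> real" where
  "tvec N i p y = (\<lambda>j k. if j \<in> idx N \<and> p \<in> cdom N j \<and> k < mdim N
     then dirder (mdim N) (\<lambda>x. chart N j (chart_inv N i x) k) (chart N i p) y else 0)"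

lemma tangent_space_law:
  assumes "v \<in> tangent_space N p" "i \<in> idx N" "j \<in> idx N" "p \<in> cdom N i" "p \<in> cdom N j" "k < mdim N"
  shows "v j k = dirder (mdim N) (\<lambda>x. chart N j (chart_inv N i x) k) (chart N i p) (v i)"
  using assms by (simp add: tangent_space_def dirder_def)

lemma tangent_spaceI:
  assumes "\<And>i. i \<in> idx N \<Longrightarrow> p \<in> cdom N i \<Longrightarrow> v i \<in> euc (mdim N)"
    "\<And>i k. \<not> (i \<in> idx N \<and> p \<in> cdom N i) \<Longrightarrow> v i k = 0"
    "\<And>i j k. i \<in> idx N \<Longrightarrow> j \<in> idx N \<Longrightarrow> p \<in> cdom N i \<Longrightarrow> p \<in> cdom N j \<Longrightarrow> k < mdim N \<Longrightarrow>
      v j k = dirder (mdim N) (\<lambda>x. chart N j (chart_inv N i x) k) (chart N i p) (v i)"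
  shows "v \<in> tangent_space N p"
  unfolding tangent_space_def dirder_def[symmetric] using assms by blast

lemma tangent_space_outside:
  "v \<in> tangent_space N p \<Longrightarrow> \<not> (i \<in> idx N \<and> p \<in> cdom N i) \<Longrightarrow> v i k = 0"
  unfolding tangent_space_def by simp

lemma tangent_space_euc:
  "v \<in> tangent_space N p \<Longrightarrow> i \<in> idx N \<Longrightarrow> p \<in> cdom N i \<Longrightarrow> v i \<in> euc (mdim N)"
  by (simp add: tangent_space_def)

lemma tangent_space_tvec:
  assumes "v \<in> tangent_space N p" "i \<in> idx N" "p \<in> cdom N i"
  shows "v = tvec N i p (v i)"
proof (intro ext)
  fix j k
  show "v j k = tvec N i p (v i) j k"
    using assms(2,3) tangent_space_law[OF assms(1,2) _ assms(3), of j k] tangent_space_euc[OF assms(1), of j]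
      tangent_space_outside[OF assms(1), of j k]
    unfolding tvec_def in_euc by (metis linorder_not_le)
qed

text \<open>The transition from a chart to itself is the identity on the chart's image, and so is
  its differential. Together with \<open>tangent_space_tvec\<close>, this makes the component in
  chart \<open>i\<close> a bijection from the fibre onto Euclidean space.\<close>

lemma tvec_self:
  assumes "smooth_atlas N" "i \<in> idx N" "p \<in> cdom N i" "y \<in> euc (mdim N)"
  shows "tvec N i p y i = y"
proof
  fix k
  have "dirder (mdim N) (\<lambda>x. chart N i (chart_inv N i x) k) (chart N i p) y
      = dirder (mdim N) (\<lambda>x. x k) (chart N i p) y"
    using assms chart_chart_inv[of _ N i UNIV]
    by (intro dirder_cong[OF eopen_chart[OF assms(1,2)]]) auto
  then show "tvec N i p y i k = y k"
    using assms by (auto simp: tvec_def dirder_coord in_euc)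
qed

text \<open>The chain rule on the triple overlap, where the direct transition from \<open>i\<close>
  to \<open>k\<close> factors through \<open>j\<close>. This compatibility puts \<open>tvec\<close>
  into the tangent space.\<close>

lemma transition_cocycle:
  assumes "smooth_atlas N" "i \<in> idx N" "j \<in> idx N" "k \<in> idx N" "p \<in> cdom N i" "p \<in> cdom N j" "p \<in> cdom N k" "m < mdim N"
  shows "dirder (mdim N) (\<lambda>x. chart N k (chart_inv N i x) m) (chart N i p) y =
    dirder (mdim N) (\<lambda>x. chart N k (chart_inv N j x) m) (chart N j p)
      (\<lambda>l. dirder (mdim N) (\<lambda>x. chart N j (chart_inv N i x) l) (chart N i p) y)"
proof -
  let ?U = "chart N i ` (cdom N j \<inter> cdom N k \<inter> cdom N i)"
  have U: "eopen (mdim N) ?U"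
    unfolding image_Int_chart[OF assms(1,2)] using assms by (intro openin_Int eopen_chart_Int) auto
  have x: "chart N i p \<in> ?U" using assms by auto
  have "dirder (mdim N) (\<lambda>x. chart N k (chart_inv N i x) m) (chart N i p) y =
      dirder (mdim N) (\<lambda>x. chart N k (chart_inv N j (chart N j (chart_inv N i x))) m) (chart N i p) y"
    by (rule dirder_cong[OF U x])
      (use assms chart_inv_in[OF assms(1,2)] in \<open>auto simp: chart_inv_chart\<close>)
  also have "\<dots> = dirder (mdim N) (\<lambda>x. chart N k (chart_inv N j x) m) (chart N j (chart_inv N i (chart N i p)))
      (\<lambda>l. dirder (mdim N) (\<lambda>x. chart N j (chart_inv N i x) l) (chart N i p) y)"
  proof (rule dirder_compose[OF transition_smooth[OF assms(1,3,4,8)] _ _ U x, where F = "\<lambda>x. chart N j (chart_inv N i x)"])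
    show "Cinf_on (mdim N) ?U (\<lambda>x. chart N j (chart_inv N i x) l)" if "l < mdim N" for l
      by (rule Cinf_on_subset[OF transition_smooth[OF assms(1-3) that] _ U]) auto
    show "chart N j (chart_inv N i x) \<in> chart N j ` (cdom N k \<inter> cdom N j)" if "x \<in> ?U" for x
      using chart_inv_in[OF assms(1,2) that] by auto
  qed
  finally show ?thesis using assms by (simp add: chart_inv_chart)
qed

lemma tvec_tangent_space:
  assumes "smooth_atlas N" "i \<in> idx N" "p \<in> cdom N i"
  shows "tvec N i p y \<in> tangent_space N p"
proof -
  have *: "tvec N i p y k m = dirder (mdim N) (\<lambda>x. chart N k (chart_inv N j x) m) (chart N j p) (tvec N i p y j)"
    if "j \<in> idx N" "k \<in> idx N" "p \<in> cdom N j" "p \<in> cdom N k" "m < mdim N" for j k m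
    using transition_cocycle[OF assms(1,2) that(1,2) assms(3) that(3-5), of y] that
    by (simp add: tvec_def dirder_def)
  show ?thesis
    by (rule tangent_spaceI[OF _ _ *]) (auto simp: tvec_def in_euc)
qed

lemma tangent_space_linear:
  assumes "v \<in> tangent_space N p" "w \<in> tangent_space N p"
  shows "(\<lambda>i k. a * v i k + b * w i k) \<in> tangent_space N p"
proof (rule tangent_spaceI)
  fix i j k
  assume ij: "i \<in> idx N" "j \<in> idx N" "p \<in> cdom N i" "p \<in> cdom N j" and k: "k < mdim N"
  show "a * v j k + b * w j k = dirder (mdim N) (\<lambda>x. chart N j (chart_inv N i x) k) (chart N i p) (\<lambda>k. a * v i k + b * w i k)"
    unfolding tangent_space_law[OF assms(1) ij k] tangent_space_law[OF assms(2) ij k]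
    by (simp add: dirder_def sum.distrib sum_distrib_left algebra_simps)
next
  show "(\<lambda>k. a * v i k + b * w i k) \<in> euc (mdim N)" if "i \<in> idx N" "p \<in> cdom N i" for i
    using tangent_space_euc[OF assms(1) that] tangent_space_euc[OF assms(2) that] by (simp add: in_euc)
qed (simp add: tangent_space_outside[OF assms(1)] tangent_space_outside[OF assms(2)])

section \<open>The atlas of the tangent bundle\<close>

abbreviation (input) TB :: "('i, 'a) tmanifold \<Rightarrow> ('i, 'a) tmanifold" where
  "TB \<equiv> tangent_bundle"

lemma mdim_TB [simp]: "mdim (TB N) = 2 * mdim N"
  and idx_TB [simp]: "idx (TB N) = idx N"
  by (simp_all add: tangent_bundle_def)

lemma cdom_TB:
  "\<xi> \<in> cdom (TB N) i \<longleftrightarrow> foot \<xi> \<in> cdom N i \<and> comp \<xi> \<in> tangent_space N (foot \<xi>) \<and> \<xi> = Tan (foot \<xi>) (comp \<xi>)"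
  by (auto simp: tangent_bundle_def)

lemma mcarrier_TB:
  "\<xi> \<in> mcarrier (TB N) \<longleftrightarrow> foot \<xi> \<in> mcarrier N \<and> comp \<xi> \<in> tangent_space N (foot \<xi>) \<and> \<xi> = Tan (foot \<xi>) (comp \<xi>)"
  by (auto simp: in_mcarrier cdom_TB)

lemma chart_TB:
  assumes "smooth_atlas N" "i \<in> idx N" "\<xi> \<in> cdom (TB N) i"
  shows "chart (TB N) i \<xi> = join (mdim N) (chart N i (foot \<xi>)) (comp \<xi> i)"
  using assms tangent_space_euc[of "comp \<xi>" N "foot \<xi>" i]
  by (auto simp: tangent_bundle_def join_def fun_eq_iff in_euc)

lemma chart_TB_lo_hi:
  assumes "smooth_atlas N" "i \<in> idx N" "\<xi> \<in> cdom (TB N) i"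
  shows "chart (TB N) i \<xi> \<in> euc (2 * mdim N)"
    "lo (mdim N) (chart (TB N) i \<xi>) = chart N i (foot \<xi>)"
    "hi (mdim N) (chart (TB N) i \<xi>) = comp \<xi> i"
  using assms chart_euc[of N i "foot \<xi>"] tangent_space_euc[of "comp \<xi>" N "foot \<xi>" i]
  by (simp_all add: chart_TB lo_join hi_join_euc cdom_TB)

lemma TB_chart_eqD:
  assumes "smooth_atlas N" "i \<in> idx N" "\<xi> \<in> cdom (TB N) i" "\<eta> \<in> cdom (TB N) i"
    "chart (TB N) i \<xi> = chart (TB N) i \<eta>"
  shows "\<xi> = \<eta>"
proof -
  have "chart N i (foot \<xi>) = chart N i (foot \<eta>)" and c: "comp \<xi> i = comp \<eta> i"
    using chart_TB_lo_hi[OF assms(1-3)] chart_TB_lo_hi[OF assms(1,2,4)] assms(5)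
    by simp_all
  then have f: "foot \<xi> = foot \<eta>"
    using assms chart_eqD by (metis cdom_TB)
  have "comp \<xi> = comp \<eta>"
    using tangent_space_tvec[of "comp \<xi>" N "foot \<xi>" i] tangent_space_tvec[of "comp \<eta>" N "foot \<eta>" i] c f assms
    by (metis cdom_TB)
  with f show ?thesis using assms(3,4) by (metis cdom_TB)
qed

lemma TB_chart_surj:
  assumes "smooth_atlas N" "i \<in> idx N" "X \<in> euc (2 * mdim N)" "lo (mdim N) X = chart N i p" "p \<in> cdom N i"
  shows "Tan p (tvec N i p (hi (mdim N) X)) \<in> cdom (TB N) i"
    "chart (TB N) i (Tan p (tvec N i p (hi (mdim N) X))) = X"
proof -
  show *: "Tan p (tvec N i p (hi (mdim N) X)) \<in> cdom (TB N) i"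
    using assms tvec_tangent_space by (simp add: cdom_TB)
  show "chart (TB N) i (Tan p (tvec N i p (hi (mdim N) X))) = X"
    using chart_TB[OF assms(1,2) *] assms tvec_self[OF assms(1,2,5), of "hi (mdim N) X"]
    by (metis hi_euc join_lo_hi tpoint.sel(2,3))
qed

text \<open>A condition on the foot leaves the fibre coordinates unrestricted, so its image is a
  cylinder. Openness upstairs thereby reduces, via \<open>eopen_lo\<close>, to openness in the base
  chart.\<close>

lemma TB_chart_image:
  assumes "smooth_atlas N" "i \<in> idx N"
  shows "chart (TB N) i ` ({\<xi>. foot \<xi> \<in> S} \<inter> cdom (TB N) i) =
    {X \<in> euc (2 * mdim N). lo (mdim N) X \<in> chart N i ` (S \<inter> cdom N i)}" (is "?L = ?R")
proof
  show "?L \<subseteq> ?R"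
    using chart_TB_lo_hi[OF assms] by (auto simp: cdom_TB)
  show "?R \<subseteq> ?L"
  proof
    fix X assume "X \<in> ?R"
    then obtain p where p: "X \<in> euc (2 * mdim N)" "lo (mdim N) X = chart N i p" "p \<in> S" "p \<in> cdom N i"
      by auto
    then show "X \<in> ?L"
      by (intro image_eqI[where x = "Tan p (tvec N i p (hi (mdim N) X))"])
        (use TB_chart_surj[OF assms p(1,2,4)] in auto)
  qed
qed

lemma TB_chart_image_UNIV:
  assumes "smooth_atlas N" "i \<in> idx N"
  shows "chart (TB N) i ` cdom (TB N) i =
    {X \<in> euc (2 * mdim N). lo (mdim N) X \<in> chart N i ` cdom N i}"
  using TB_chart_image[OF assms, of UNIV] by simp

lemma TB_inj_on:
  "smooth_atlas N \<Longrightarrow> i \<in> idx N \<Longrightarrow> inj_on (chart (TB N) i) (cdom (TB N) i)"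
  by (rule inj_onI) (rule TB_chart_eqD)

text \<open>The transformation law of tangent vectors read in block coordinates. Smoothness of the
  bundle transitions is then an instance of \<open>Cinf_on_tlift\<close>.\<close>

lemma TB_transition:
  assumes "smooth_atlas N" "i \<in> idx N" "j \<in> idx N" "\<xi> \<in> cdom (TB N) i" "\<xi> \<in> cdom (TB N) j"
  shows "chart (TB N) j \<xi> =
    tlift (mdim N) (mdim N) (\<lambda>x. chart N j (chart_inv N i x)) (chart (TB N) i \<xi>)"
proof -
  have "comp \<xi> j k = dirder (mdim N) (\<lambda>x. chart N j (chart_inv N i x) k) (chart N i (foot \<xi>)) (comp \<xi> i)"
    if "k < mdim N" for k
    using assms that by (intro tangent_space_law) (auto simp: cdom_TB)
  moreover have "chart N j (chart_inv N i (chart N i (foot \<xi>))) = chart N j (foot \<xi>)"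
    using assms by (simp add: cdom_TB chart_inv_chart)
  ultimately show ?thesis
    using assms
    by (simp add: chart_TB_lo_hi tlift_def chart_TB[of N j] cong: join_cong)
qed

lemma cdom_TB_Int:
  "cdom (TB N) j \<inter> cdom (TB N) i = {\<xi>. foot \<xi> \<in> cdom N j} \<inter> cdom (TB N) i"
  by (auto simp: cdom_TB)

lemma smooth_atlas_TB:
  assumes "smooth_atlas N" shows "smooth_atlas (TB N)"
proof -
  let ?T = "TB N"
  have op: "eopen (2 * mdim N) (chart ?T i ` (cdom ?T j \<inter> cdom ?T i))" if "i \<in> idx N" "j \<in> idx N" for i j
    unfolding cdom_TB_Int TB_chart_image[OF assms that(1)]
    by (rule eopen_lo[OF eopen_chart_Int[OF assms that]])
  have "Cinf_on (2 * mdim N) (chart ?T i ` (cdom ?T j \<inter> cdom ?T i)) (\<lambda>x. chart ?T j (chart_inv ?T i x) k)"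
    if ij: "i \<in> idx N" "j \<in> idx N" and k: "k < 2 * mdim N" for i j k
  proof (rule Cinf_on_cong)
    show "Cinf_on (2 * mdim N) (chart ?T i ` (cdom ?T j \<inter> cdom ?T i))
        (\<lambda>X. tlift (mdim N) (mdim N) (\<lambda>x. chart N j (chart_inv N i x)) X k)"
      unfolding cdom_TB_Int TB_chart_image[OF assms that(1)]
      by (rule Cinf_on_tlift[OF transition_smooth[OF assms ij] k])
    fix X assume "X \<in> chart ?T i ` (cdom ?T j \<inter> cdom ?T i)"
    then obtain \<xi> where \<xi>: "\<xi> \<in> cdom ?T i" "\<xi> \<in> cdom ?T j" "X = chart ?T i \<xi>" by auto
    then have "chart_inv ?T i X = \<xi>"
      by (simp add: chart_inv_def TB_inj_on[OF assms ij(1)])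
    then show "tlift (mdim N) (mdim N) (\<lambda>x. chart N j (chart_inv N i x)) X k = chart ?T j (chart_inv ?T i X) k"
      using TB_transition[OF assms ij \<xi>(1,2)] \<xi> by simp
  qed
  then show ?thesis
    unfolding smooth_atlas_def using op TB_inj_on[OF assms]
    by (metis Int_absorb Int_commute idx_TB mdim_TB)
qed

text \<open>\<open>velocity\<close> takes a \<open>deriv\<close> in every chart around the point.
  Derivatives known in one chart propagate to the others by the chain rule for the transition, so
  the result is a \<open>tvec\<close> and one chart identifies it.\<close>

lemma velocity_chart:
  assumes N: "smooth_atlas N" and i: "i \<in> idx N" and ev: "\<forall>\<^sub>F u in nhds t. \<gamma> u \<in> cdom N i"
    and d: "\<And>k. k < mdim N \<Longrightarrow> ((\<lambda>u. chart N i (\<gamma> u) k) has_real_derivative d k) (at t)"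
  shows "velocity N \<gamma> t \<in> cdom (TB N) i"
    "chart (TB N) i (velocity N \<gamma> t) = join (mdim N) (chart N i (\<gamma> t)) d"
proof -
  have p: "\<gamma> t \<in> cdom N i" using ev by (rule eventually_nhds_x_imp_x)
  have "((\<lambda>u. chart N j (\<gamma> u) k) has_real_derivative
      dirder (mdim N) (\<lambda>x. chart N j (chart_inv N i x) k) (chart N i (\<gamma> t)) d) (at t)"
    if j: "j \<in> idx N" "\<gamma> t \<in> cdom N j" and k: "k < mdim N" for j k
  proof -
    have "((\<lambda>u. chart N j (chart_inv N i (chart N i (\<gamma> u))) k) has_real_derivative
      dirder (mdim N) (\<lambda>x. chart N j (chart_inv N i x) k) (chart N i (\<gamma> t)) d) (at t)"
      unfolding dirder_def
    proof (rule Cinf_on_chain_curve[OF transition_smooth[OF N i j(1) k] _ _ d])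
      show "\<forall>\<^sub>F u in at t. chart N i (\<gamma> u) \<in> euc (mdim N)"
        using eventually_nhds_conv_at[THEN iffD1, OF ev] chart_euc[OF N i] by (auto elim!: eventually_mono)
    qed (use p j in auto)
    moreover have "\<forall>\<^sub>F u in nhds t. chart N j (chart_inv N i (chart N i (\<gamma> u))) k = chart N j (\<gamma> u) k"
      using ev by eventually_elim (simp add: chart_inv_chart[OF N i])
    ultimately show ?thesis by (simp only: DERIV_cong_ev[OF refl _ refl])
  qed
  then have "velocity N \<gamma> t = Tan (\<gamma> t) (tvec N i (\<gamma> t) d)"
    by (auto simp: velocity_def tvec_def fun_eq_iff intro!: DERIV_imp_deriv)
  \<comment> \<open>\<open>d\<close> is arbitrary from \<open>mdim N\<close> on. Truncation leaves
    \<open>tvec\<close> unchanged and gives the form that \<open>TB_chart_surj\<close>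
    expects.\<close>
  moreover have "tvec N i (\<gamma> t) d = tvec N i (\<gamma> t) (lo (mdim N) d)"
    by (auto simp: tvec_def lo_def fun_eq_iff dirder_def intro!: sum.cong)
  moreover have "lo (mdim N) (join (mdim N) (chart N i (\<gamma> t)) d) = chart N i (\<gamma> t)"
    using chart_euc[OF N i p] by (rule lo_join)
  moreover have "hi (mdim N) (join (mdim N) (chart N i (\<gamma> t)) d) = lo (mdim N) d"
    by (simp add: hi_join lo_def)
  ultimately show "velocity N \<gamma> t \<in> cdom (TB N) i"
    "chart (TB N) i (velocity N \<gamma> t) = join (mdim N) (chart N i (\<gamma> t)) d"
    using TB_chart_surj[OF N i join_euc, of "chart N i (\<gamma> t)" d "\<gamma> t"] p by simp_all
qed

lemma foot_velocity [simp]: "foot (velocity N \<gamma> t) = \<gamma> t"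
  by (simp add: velocity_def)

section \<open>Tangent maps and differentials in charts\<close>

definition rep :: "('i, 'p) atlas \<Rightarrow> ('i, 'q) atlas \<Rightarrow> ('p \<Rightarrow> 'q) \<Rightarrow> 'i \<Rightarrow> (nat \<Rightarrow> real) \<Rightarrow> nat \<Rightarrow> real" where
  "rep N N' F i x = chart N' i (F (chart_inv N i x))"

text \<open>Every map below, from the lifts to the canonical flip, relates charts with the same index, so
  that one local representative per chart index describes it.\<close>

definition cw_smooth :: "('i, 'p) atlas \<Rightarrow> 'p set \<Rightarrow> ('i, 'q) atlas \<Rightarrow> ('p \<Rightarrow> 'q) \<Rightarrow> bool" where
  "cw_smooth N U N' F \<longleftrightarrow> idx N' = idx N \<and> U \<subseteq> mcarrier N \<and>
     (\<forall>i\<in>idx N. eopen (mdim N) (chart N i ` (U \<inter> cdom N i)) \<and> (\<forall>p\<in>U \<inter> cdom N i. F p \<in> cdom N' i) \<and>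
        (\<forall>k<mdim N'. Cinf_on (mdim N) (chart N i ` (U \<inter> cdom N i)) (\<lambda>x. rep N N' F i x k)))"

lemma cw_smoothD:
  assumes "cw_smooth N U N' F"
  shows "idx N' = idx N" "U \<subseteq> mcarrier N"
    "i \<in> idx N \<Longrightarrow> eopen (mdim N) (chart N i ` (U \<inter> cdom N i))"
    "i \<in> idx N \<Longrightarrow> p \<in> U \<Longrightarrow> p \<in> cdom N i \<Longrightarrow> F p \<in> cdom N' i"
    "i \<in> idx N \<Longrightarrow> k < mdim N' \<Longrightarrow> Cinf_on (mdim N) (chart N i ` (U \<inter> cdom N i)) (\<lambda>x. rep N N' F i x k)"
  using assms by (simp_all add: cw_smooth_def)

lemma cw_smoothI:
  assumes "idx N' = idx N" "U \<subseteq> mcarrier N"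
    "\<And>i. i \<in> idx N \<Longrightarrow> eopen (mdim N) (chart N i ` (U \<inter> cdom N i))"
    "\<And>i p. i \<in> idx N \<Longrightarrow> p \<in> U \<Longrightarrow> p \<in> cdom N i \<Longrightarrow> F p \<in> cdom N' i"
    "\<And>i k. i \<in> idx N \<Longrightarrow> k < mdim N' \<Longrightarrow> Cinf_on (mdim N) (chart N i ` (U \<inter> cdom N i)) (\<lambda>x. rep N N' F i x k)"
  shows "cw_smooth N U N' F"
  using assms by (simp add: cw_smooth_def)

lemma cw_smooth_mcarrier: "cw_smooth N U N' F \<Longrightarrow> p \<in> U \<Longrightarrow> F p \<in> mcarrier N'"
  using cw_smoothD(2)[of N U N' F] cw_smoothD(4)[of N U N' F _ p] cw_smoothD(1)[of N U N' F]
  by (metis in_mcarrier subsetD)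

lemma rep_chart:
  "smooth_atlas N \<Longrightarrow> i \<in> idx N \<Longrightarrow> p \<in> cdom N i \<Longrightarrow> rep N N' F i (chart N i p) = chart N' i (F p)"
  by (simp add: rep_def chart_inv_chart)

lemma rep_in:
  assumes "smooth_atlas N" "cw_smooth N U N' F" "i \<in> idx N" "x \<in> chart N i ` (U \<inter> cdom N i)"
    "\<And>p. p \<in> U \<Longrightarrow> p \<in> cdom N i \<Longrightarrow> F p \<in> S"
  shows "rep N N' F i x \<in> chart N' i ` (S \<inter> cdom N' i)"
proof -
  obtain p where "p \<in> U" "p \<in> cdom N i" "x = chart N i p" using assms(4) by auto
  then show ?thesis using assms cw_smoothD(4)[OF assms(2,3)] by (simp add: rep_chart)
qed

lemma cw_smooth_cong:
  assumes "smooth_atlas N" "cw_smooth N U N' F" "\<And>p. p \<in> U \<Longrightarrow> F p = G p"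
  shows "cw_smooth N U N' G"
proof (rule cw_smoothI)
  fix i k assume i: "i \<in> idx N" and k: "k < mdim N'"
  show "Cinf_on (mdim N) (chart N i ` (U \<inter> cdom N i)) (\<lambda>x. rep N N' G i x k)"
    by (rule Cinf_on_cong[OF cw_smoothD(5)[OF assms(2) i k]])
      (auto simp: rep_chart[OF assms(1) i] assms(3))
qed (use cw_smoothD[OF assms(2)] assms(3) in auto)

lemma cw_smooth_compose:
  assumes N: "smooth_atlas N" and N': "smooth_atlas N'"
    and F: "cw_smooth N U N' F" and G: "cw_smooth N' U' N'' G" and FU: "\<And>p. p \<in> U \<Longrightarrow> F p \<in> U'"
  shows "cw_smooth N U N'' (\<lambda>p. G (F p))"
proof (rule cw_smoothI)
  note idx = cw_smoothD(1)[OF F] cw_smoothD(1)[OF G]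
  show "idx N'' = idx N" "U \<subseteq> mcarrier N" using idx cw_smoothD(2)[OF F] by simp_all
  fix i assume i: "i \<in> idx N"
  then have i': "i \<in> idx N'" using idx by simp
  show op: "eopen (mdim N) (chart N i ` (U \<inter> cdom N i))" using cw_smoothD(3)[OF F i] .
  show "G (F p) \<in> cdom N'' i" if "p \<in> U" "p \<in> cdom N i" for p
    using cw_smoothD(4)[OF F i that] cw_smoothD(4)[OF G i' FU[OF that(1)]] by blast
  fix k assume k: "k < mdim N''"
  have "Cinf_on (mdim N) (chart N i ` (U \<inter> cdom N i)) (\<lambda>x. rep N' N'' G i (rep N N' F i x) k)"
    by (rule Cinf_on_compose[OF cw_smoothD(5)[OF G i' k] op cw_smoothD(5)[OF F i] rep_in[OF N F i _ FU]])
  then show "Cinf_on (mdim N) (chart N i ` (U \<inter> cdom N i)) (\<lambda>x. rep N N'' (\<lambda>p. G (F p)) i x k)"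
    by (rule Cinf_on_cong)
      (use cw_smoothD(4)[OF F i] in \<open>auto simp: rep_chart[OF N i] rep_chart[OF N' i']\<close>)
qed

lemma cw_smooth_subset:
  assumes "cw_smooth N U N' F" "V \<subseteq> U" "\<And>i. i \<in> idx N \<Longrightarrow> eopen (mdim N) (chart N i ` (V \<inter> cdom N i))"
  shows "cw_smooth N V N' F"
proof (rule cw_smoothI)
  fix i k assume "i \<in> idx N" "k < mdim N'"
  then show "Cinf_on (mdim N) (chart N i ` (V \<inter> cdom N i)) (\<lambda>x. rep N N' F i x k)"
    using assms by (intro Cinf_on_subset[OF cw_smoothD(5)[OF assms(1)]]) auto
qed (use assms cw_smoothD[OF assms(1)] in auto)

text \<open>\<open>smooth_map_on\<close> asks about every pair of charts, \<open>cw_smooth\<close>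
  only about equal indices. The representative for the pair (i, j) is the target transition from i
  to j after \<open>rep\<close> at i; supplied here is its domain, as the preimage of the chart
  overlap.\<close>

lemma cw_smooth_transition_domain:
  assumes N: "smooth_atlas N" and N': "smooth_atlas N'" and F: "cw_smooth N U N' F"
    and ij: "i \<in> idx N" "j \<in> idx N"
  shows "eopen (mdim N) (chart N i ` ({p \<in> U. F p \<in> cdom N' j} \<inter> cdom N i))"
    and "x \<in> chart N i ` ({p \<in> U. F p \<in> cdom N' j} \<inter> cdom N i) \<Longrightarrow>
      rep N N' F i x \<in> chart N' i ` (cdom N' j \<inter> cdom N' i)"
    and "x \<in> chart N i ` ({p \<in> U. F p \<in> cdom N' j} \<inter> cdom N i) \<Longrightarrow>
      chart N' j (chart_inv N' i (rep N N' F i x)) = chart N' j (F (chart_inv N i x))"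
proof -
  have ij': "i \<in> idx N'" "j \<in> idx N'" using ij cw_smoothD(1)[OF F] by simp_all
  have "chart N i ` ({p \<in> U. F p \<in> cdom N' j} \<inter> cdom N i) =
      {x \<in> chart N i ` (U \<inter> cdom N i). rep N N' F i x \<in> chart N' i ` (cdom N' j \<inter> cdom N' i)}"
  proof (intro set_eqI iffI)
    fix x assume "x \<in> chart N i ` ({p \<in> U. F p \<in> cdom N' j} \<inter> cdom N i)"
    then obtain p where p: "p \<in> U" "F p \<in> cdom N' j" "p \<in> cdom N i" "x = chart N i p" by auto
    then show "x \<in> {x \<in> chart N i ` (U \<inter> cdom N i). rep N N' F i x \<in> chart N' i ` (cdom N' j \<inter> cdom N' i)}"
      using cw_smoothD(4)[OF F ij(1) p(1,3)] by (simp add: rep_chart[OF N ij(1)])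
  next
    fix x assume "x \<in> {x \<in> chart N i ` (U \<inter> cdom N i). rep N N' F i x \<in> chart N' i ` (cdom N' j \<inter> cdom N' i)}"
    then obtain p where p: "p \<in> U" "p \<in> cdom N i" "x = chart N i p"
      "chart N' i (F p) \<in> chart N' i ` (cdom N' j \<inter> cdom N' i)"
      by (auto simp: rep_chart[OF N ij(1)])
    then have "F p \<in> cdom N' j"
      using chart_inv_in(1)[OF N' ij'(1) p(4)] chart_inv_chart[OF N' ij'(1) cw_smoothD(4)[OF F ij(1) p(1,2)]]
      by simp
    then show "x \<in> chart N i ` ({p \<in> U. F p \<in> cdom N' j} \<inter> cdom N i)" using p by simp
  qed
  moreover have "eopen (mdim N) {x \<in> chart N i ` (U \<inter> cdom N i). rep N N' F i x \<in> chart N' i ` (cdom N' j \<inter> cdom N' i)}"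
  proof (rule eopen_preimage[OF cw_smoothD(3)[OF F ij(1)] eopen_chart_Int[OF N' ij']])
    show "continuous_on (chart N i ` (U \<inter> cdom N i)) (\<lambda>x. rep N N' F i x k)" if "k < mdim N'" for k
      using cw_smoothD(5)[OF F ij(1) that] by (rule Cinf_on_continuous)
    show "rep N N' F i x \<in> euc (mdim N')" if "x \<in> chart N i ` (U \<inter> cdom N i)" for x
      using chart_euc[OF N' ij'(1)] cw_smoothD(4)[OF F ij(1)] chart_inv_in[OF N ij(1) that] by (simp add: rep_def)
  qed
  ultimately show "eopen (mdim N) (chart N i ` ({p \<in> U. F p \<in> cdom N' j} \<inter> cdom N i))"
    and "x \<in> chart N i ` ({p \<in> U. F p \<in> cdom N' j} \<inter> cdom N i) \<Longrightarrow>
      rep N N' F i x \<in> chart N' i ` (cdom N' j \<inter> cdom N' i)"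
    by auto
  show "chart N' j (chart_inv N' i (rep N N' F i x)) = chart N' j (F (chart_inv N i x))"
    if "x \<in> chart N i ` ({p \<in> U. F p \<in> cdom N' j} \<inter> cdom N i)"
    using chart_inv_chart[OF N' ij'(1)] cw_smoothD(4)[OF F ij(1)] chart_inv_in[OF N ij(1) that]
    by (simp add: rep_def)
qed

lemma cw_smooth_smooth_map:
  assumes N: "smooth_atlas N" and N': "smooth_atlas N'" and F: "cw_smooth N U N' F"
  shows "smooth_map_on N U N' F"
  unfolding smooth_map_on_def Let_def
proof (intro conjI ballI allI impI)
  show "U \<subseteq> mcarrier N" "F ` U \<subseteq> mcarrier N'"
    using cw_smoothD(2)[OF F] cw_smooth_mcarrier[OF F] by auto
  fix i j assume i: "i \<in> idx N" and j': "j \<in> idx N'"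
  then have j: "j \<in> idx N" and i': "i \<in> idx N'" using cw_smoothD(1)[OF F] by simp_all
  have eq: "{p \<in> U \<inter> cdom N i. F p \<in> cdom N' j} = {p \<in> U. F p \<in> cdom N' j} \<inter> cdom N i" by auto
  note dom = cw_smooth_transition_domain[OF N N' F i j]
  show "eopen (mdim N) (chart N i ` {p \<in> U \<inter> cdom N i. F p \<in> cdom N' j})"
    unfolding eq by (rule dom(1))
  fix k assume k: "k < mdim N'"
  have "Cinf_on (mdim N) (chart N i ` ({p \<in> U. F p \<in> cdom N' j} \<inter> cdom N i))
      (\<lambda>x. chart N' j (chart_inv N' i (rep N N' F i x)) k)"
  proof (rule Cinf_on_compose[OF transition_smooth[OF N' i' j' k] dom(1) _ dom(2)])
    show "Cinf_on (mdim N) (chart N i ` ({p \<in> U. F p \<in> cdom N' j} \<inter> cdom N i)) (\<lambda>x. rep N N' F i x k)"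
      if "k < mdim N'" for k
      by (rule Cinf_on_subset[OF cw_smoothD(5)[OF F i that] _ dom(1)]) auto
  qed
  then show "Cinf_on (mdim N) (chart N i ` {p \<in> U \<inter> cdom N i. F p \<in> cdom N' j})
      (\<lambda>x. chart N' j (F (chart_inv N i x)) k)"
    unfolding eq by (rule Cinf_on_cong) (simp add: dom(3))
qed

text \<open>The definition works in an arbitrary chart \<open>a\<close>. For \<open>a\<close> the
  formula follows from the chain rule; it carries over to \<open>i\<close> because the target
  transition after the representative at \<open>a\<close> equals the representative at
  \<open>i\<close> after the source transition, and \<open>tlift\<close> respects
  composition.\<close>

lemma tangent_map_chart:
  assumes N: "smooth_atlas N" and N': "smooth_atlas N'" and F: "cw_smooth N U N' F"
    and i: "i \<in> idx N" and \<xi>: "\<xi> \<in> cdom (TB N) i" "foot \<xi> \<in> U"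
  shows "tangent_map N N' F \<xi> \<in> cdom (TB N') i"
    "chart (TB N') i (tangent_map N N' F \<xi>) =
      tlift (mdim N) (mdim N') (rep N N' F i) (chart (TB N) i \<xi>)"
proof -
  define p where "p = foot \<xi>"
  define a where "a = chart_at N p"
  have pU: "p \<in> U" and pi: "p \<in> cdom N i" using \<xi> by (simp_all add: p_def cdom_TB)
  have a: "a \<in> idx N" "p \<in> cdom N a"
    unfolding a_def using chart_at[of p N] cw_smoothD(2)[OF F] pU by auto
  have idx: "idx N' = idx N" by (rule cw_smoothD(1)[OF F])
  have \<xi>a: "\<xi> \<in> cdom (TB N) a" using \<xi> a by (simp add: cdom_TB p_def)
  have Fp: "F p \<in> cdom N' a" "F p \<in> cdom N' i"
    using cw_smoothD(4)[OF F _ pU] a pi i by auto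
  \<comment> \<open>The component of the image vector in chart \<open>a\<close>. The components
    which the definition assigns to the other charts are its transforms, hence a
    \<open>tvec\<close>.\<close>
  define y where "y = (\<lambda>m. dirder (mdim N) (\<lambda>x. rep N N' F a x m) (chart N a p) (comp \<xi> a))"
  have y: "tvec N' a (F p) y = tvec N' a (F p) (lo (mdim N') y)"
    by (auto simp: tvec_def lo_def fun_eq_iff dirder_def intro!: sum.cong)
  have tm: "tangent_map N N' F \<xi> = Tan (F p) (tvec N' a (F p) y)"
  proof -
    have "dirder (mdim N) (\<lambda>x. chart N' j (F (chart_inv N a x)) k) (chart N a p) (comp \<xi> a)
        = dirder (mdim N') (\<lambda>x. chart N' j (chart_inv N' a x) k) (chart N' a (F p)) y"
      if j: "j \<in> idx N'" "F p \<in> cdom N' j" and k: "k < mdim N'" for j k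
    proof -
      have j': "j \<in> idx N" and a': "a \<in> idx N'" using j a idx by simp_all
      let ?W = "chart N a ` ({p \<in> U. F p \<in> cdom N' j} \<inter> cdom N a)"
      note dom = cw_smooth_transition_domain[OF N N' F a(1) j']
      have x: "chart N a p \<in> ?W" using pU a j by auto
      have "dirder (mdim N) (\<lambda>x. chart N' j (F (chart_inv N a x)) k) (chart N a p) (comp \<xi> a)
        = dirder (mdim N) (\<lambda>x. chart N' j (chart_inv N' a (rep N N' F a x)) k) (chart N a p) (comp \<xi> a)"
        by (rule dirder_cong[OF dom(1) x]) (simp_all add: dom(3))
      also have "\<dots> = dirder (mdim N') (\<lambda>x. chart N' j (chart_inv N' a x) k) (rep N N' F a (chart N a p)) y"
        unfolding y_def
      proof (rule dirder_compose[OF transition_smooth[OF N' a' j(1) k] _ dom(2) dom(1) x])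
        show "Cinf_on (mdim N) ?W (\<lambda>x. rep N N' F a x k)" if "k < mdim N'" for k
          by (rule Cinf_on_subset[OF cw_smoothD(5)[OF F a(1) that] _ dom(1)]) auto
      qed
      finally show ?thesis by (simp add: rep_chart[OF N a])
    qed
    then show ?thesis
      by (simp add: tangent_map_def Let_def p_def[symmetric] a_def[symmetric] dirder_def[symmetric]
          tvec_def fun_eq_iff)
  qed
  have lo: "lo (mdim N') (tlift (mdim N) (mdim N') (rep N N' F a) (chart (TB N) a \<xi>)) = chart N' a (F p)"
    using chart_euc[OF N' _ Fp(1)] a idx
    by (simp add: tlift_def lo_join chart_TB_lo_hi[OF N a(1) \<xi>a] p_def[symmetric] rep_chart[OF N a])
  have hi: "hi (mdim N') (tlift (mdim N) (mdim N') (rep N N' F a) (chart (TB N) a \<xi>)) = lo (mdim N') y"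
    by (simp add: tlift_def hi_join_lo y_def chart_TB_lo_hi[OF N a(1) \<xi>a] p_def[symmetric])
  have a': "a \<in> idx N'" and i': "i \<in> idx N'" using a i idx by auto
  have Ta: "tangent_map N N' F \<xi> \<in> cdom (TB N') a"
    and ca: "chart (TB N') a (tangent_map N N' F \<xi>) =
      tlift (mdim N) (mdim N') (rep N N' F a) (chart (TB N) a \<xi>)"
    using TB_chart_surj[OF N' a' tlift_euc lo Fp(1)] by (simp_all add: tm y hi)
  show Ti: "tangent_map N N' F \<xi> \<in> cdom (TB N') i"
    using Ta Fp by (simp add: cdom_TB tm)
  let ?V = "chart N a ` (U \<inter> cdom N i \<inter> cdom N a)"
  let ?X = "chart (TB N) a \<xi>"
  have V: "eopen (mdim N) ?V"
    unfolding image_Int_chart[OF N a(1)] by (intro openin_Int cw_smoothD(3)[OF F] eopen_chart_Int[OF N] a i)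
  have X: "lo (mdim N) ?X \<in> ?V"
    using chart_TB_lo_hi(2)[OF N a(1) \<xi>a] pU pi a by (auto simp: p_def)
  have "chart (TB N') i (tangent_map N N' F \<xi>) =
      tlift (mdim N') (mdim N') (\<lambda>x. chart N' i (chart_inv N' a x)) (tlift (mdim N) (mdim N') (rep N N' F a) ?X)"
    using TB_transition[OF N' a' i' Ta Ti] ca by simp
  also have "\<dots> = tlift (mdim N) (mdim N') (\<lambda>x. chart N' i (chart_inv N' a (rep N N' F a x))) ?X"
  proof (rule tlift_compose[symmetric, OF transition_smooth[OF N' a' i'] _ _ V eopen_chart_Int[OF N' a' i'] X])
    show "Cinf_on (mdim N) ?V (\<lambda>x. rep N N' F a x k)" if "k < mdim N'" for k
      by (rule Cinf_on_subset[OF cw_smoothD(5)[OF F a(1) that] _ V]) auto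
    show "rep N N' F a x \<in> chart N' a ` (cdom N' i \<inter> cdom N' a)" if "x \<in> ?V" for x
      using that cw_smoothD(4)[OF F] a i by (auto simp: rep_chart[OF N a(1)])
  qed
  also have "\<dots> = tlift (mdim N) (mdim N') (\<lambda>x. rep N N' F i (chart N i (chart_inv N a x))) ?X"
    using cw_smoothD(4)[OF F] a i
    by (intro tlift_cong[OF V X])
      (auto simp: rep_chart[OF N] chart_inv_chart[OF N] chart_inv_chart[OF N' a'])
  also have "\<dots> = tlift (mdim N) (mdim N') (rep N N' F i) (tlift (mdim N) (mdim N) (\<lambda>x. chart N i (chart_inv N a x)) ?X)"
  proof (rule tlift_compose[OF cw_smoothD(5)[OF F i] _ _ V cw_smoothD(3)[OF F i] X])
    show "Cinf_on (mdim N) ?V (\<lambda>x. chart N i (chart_inv N a x) k)" if "k < mdim N" for k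
      by (rule Cinf_on_subset[OF transition_smooth[OF N a(1) i that] _ V]) auto
    show "chart N i (chart_inv N a x) \<in> chart N i ` (U \<inter> cdom N i)" if "x \<in> ?V" for x
      using chart_inv_in[OF N a(1) that] by auto
  qed
  also have "tlift (mdim N) (mdim N) (\<lambda>x. chart N i (chart_inv N a x)) ?X = chart (TB N) i \<xi>"
    using TB_transition[OF N a(1) i \<xi>a \<xi>(1)] by simp
  finally show "chart (TB N') i (tangent_map N N' F \<xi>) =
      tlift (mdim N) (mdim N') (rep N N' F i) (chart (TB N) i \<xi>)" .
qed

lemma foot_tangent_map [simp]: "foot (tangent_map N N' F \<xi>) = F (foot \<xi>)"
  by (simp add: tangent_map_def Let_def)

lemma cw_smooth_tangent_map:
  assumes N: "smooth_atlas N" and N': "smooth_atlas N'" and F: "cw_smooth N U N' F"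
  shows "cw_smooth (TB N) {\<xi> \<in> mcarrier (TB N). foot \<xi> \<in> U} (TB N')
    (tangent_map N N' F)"
proof (rule cw_smoothI)
  note T = smooth_atlas_TB[OF N]
  show "idx (TB N') = idx (TB N)" using cw_smoothD(1)[OF F] by simp
  fix i assume "i \<in> idx (TB N)"
  then have i: "i \<in> idx N" "i \<in> idx (TB N)" by simp_all
  have eq: "{\<xi> \<in> mcarrier (TB N). foot \<xi> \<in> U} \<inter> cdom (TB N) i =
      {\<xi>. foot \<xi> \<in> U} \<inter> cdom (TB N) i"
    using i by (auto simp: in_mcarrier)
  have im: "chart (TB N) i ` ({\<xi> \<in> mcarrier (TB N). foot \<xi> \<in> U} \<inter> cdom (TB N) i)
     = {X \<in> euc (2 * mdim N). lo (mdim N) X \<in> chart N i ` (U \<inter> cdom N i)}"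
    unfolding eq by (rule TB_chart_image[OF N i(1)])
  show "eopen (mdim (TB N)) (chart (TB N) i `
      ({\<xi> \<in> mcarrier (TB N). foot \<xi> \<in> U} \<inter> cdom (TB N) i))"
    unfolding im mdim_TB by (rule eopen_lo[OF cw_smoothD(3)[OF F i(1)]])
  show "tangent_map N N' F \<xi> \<in> cdom (TB N') i"
    if "\<xi> \<in> {\<xi> \<in> mcarrier (TB N). foot \<xi> \<in> U}" "\<xi> \<in> cdom (TB N) i" for \<xi>
    using tangent_map_chart(1)[OF N N' F i(1) that(2)] that(1) by simp
  fix k assume k: "k < mdim (TB N')"
  have "Cinf_on (2 * mdim N) {X \<in> euc (2 * mdim N). lo (mdim N) X \<in> chart N i ` (U \<inter> cdom N i)}
      (\<lambda>X. tlift (mdim N) (mdim N') (rep N N' F i) X k)"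
    using k by (intro Cinf_on_tlift cw_smoothD(5)[OF F i(1)]) auto
  then show "Cinf_on (mdim (TB N)) (chart (TB N) i `
      ({\<xi> \<in> mcarrier (TB N). foot \<xi> \<in> U} \<inter> cdom (TB N) i))
      (\<lambda>x. rep (TB N) (TB N') (tangent_map N N' F) i x k)"
    unfolding im[symmetric] mdim_TB
    by (rule Cinf_on_cong)
      (use tangent_map_chart(2)[OF N N' F i(1)] in \<open>auto simp: rep_chart[OF T i(2)]\<close>)
qed auto

lemma cw_smooth_foot:
  assumes N: "smooth_atlas N"
  shows "cw_smooth (TB N) (mcarrier (TB N)) N foot"
    and "i \<in> idx N \<Longrightarrow> X \<in> chart (TB N) i ` cdom (TB N) i \<Longrightarrow>
      rep (TB N) N foot i X = lo (mdim N) X"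
proof -
  show r: "rep (TB N) N foot i X = lo (mdim N) X"
    if "i \<in> idx N" "X \<in> chart (TB N) i ` cdom (TB N) i" for i X
    using that chart_TB_lo_hi[OF N that(1)]
      rep_chart[OF smooth_atlas_TB[OF N], where F = foot and i = i and N' = N] by auto
  have im: "mcarrier (TB N) \<inter> cdom (TB N) i = cdom (TB N) i"
    if "i \<in> idx N" for i using that by (auto simp: in_mcarrier)
  show "cw_smooth (TB N) (mcarrier (TB N)) N foot"
  proof (rule cw_smoothI)
    fix i assume "i \<in> idx (TB N)"
    then have i: "i \<in> idx N" by simp
    show o: "eopen (mdim (TB N)) (chart (TB N) i ` (mcarrier (TB N) \<inter> cdom (TB N) i))"
      unfolding im[OF i] using i by (intro eopen_chart smooth_atlas_TB N) simp
    show "foot \<xi> \<in> cdom N i" if "\<xi> \<in> cdom (TB N) i" for \<xi>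
      using that by (simp add: cdom_TB)
    fix k assume "k < mdim N"
    then have "Cinf_on (mdim (TB N)) (chart (TB N) i ` cdom (TB N) i) (\<lambda>X. lo (mdim N) X k)"
      using Cinf_on_coord[OF o] im[OF i] by (simp add: lo_def)
    then show "Cinf_on (mdim (TB N)) (chart (TB N) i ` (mcarrier (TB N) \<inter> cdom (TB N) i))
       (\<lambda>X. rep (TB N) N foot i X k)"
      unfolding im[OF i] by (rule Cinf_on_cong) (simp add: r[OF i])
  qed simp_all
qed

text \<open>A field keeps every point below its value, so over \<open>U\<close> the value lies in
  bundle chart \<open>i\<close> exactly when the point lies in chart \<open>i\<close>. The domain
  that \<open>smooth_map_on\<close> assigns to the pair (i, i) is therefore all of \<open>U\<close>
  inside chart \<open>i\<close>.\<close>

lemma vector_field_cw_smooth: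
  assumes N: "smooth_atlas N" and A: "vector_field_on N U A"
  shows "cw_smooth N U (TB N) A"
proof -
  have s: "smooth_map_on N U (TB N) A" and f: "\<And>p. p \<in> U \<Longrightarrow> foot (A p) = p"
    using A by (auto simp: vector_field_on_def)
  have U: "U \<subseteq> mcarrier N" using s by (simp add: smooth_map_on_def)
  have in_cdom: "A p \<in> cdom (TB N) i" if "i \<in> idx N" "p \<in> U" "p \<in> cdom N i" for i p
  proof -
    have "A p \<in> mcarrier (TB N)" using s that(2) by (auto simp: smooth_map_on_def)
    then show ?thesis using f[OF that(2)] that(3) by (simp add: mcarrier_TB cdom_TB)
  qed
  have eq: "{p \<in> U \<inter> cdom N i. A p \<in> cdom (TB N) i} = U \<inter> cdom N i" if "i \<in> idx N" for i
    using in_cdom[OF that] by auto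
  show ?thesis
  proof (rule cw_smoothI)
    fix i assume i: "i \<in> idx N"
    have *: "eopen (mdim N) (chart N i ` (U \<inter> cdom N i)) \<and> (\<forall>k<mdim (TB N).
        Cinf_on (mdim N) (chart N i ` (U \<inter> cdom N i)) (\<lambda>x. chart (TB N) i (A (chart_inv N i x)) k))"
    proof -
      have "i \<in> idx (TB N)" using i by simp
      then have "let W = chart N i ` {p \<in> U \<inter> cdom N i. A p \<in> cdom (TB N) i} in eopen (mdim N) W \<and>
          (\<forall>k<mdim (TB N). Cinf_on (mdim N) W (\<lambda>x. chart (TB N) i (A (chart_inv N i x)) k))"
        using s i unfolding smooth_map_on_def by blast
      then show ?thesis unfolding eq[OF i] Let_def .
    qed
    then show "eopen (mdim N) (chart N i ` (U \<inter> cdom N i))" ..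
    show "Cinf_on (mdim N) (chart N i ` (U \<inter> cdom N i)) (\<lambda>x. rep N (TB N) A i x k)"
      if "k < mdim (TB N)" for k
      using * that by (simp add: rep_def)
  qed (use U in_cdom in auto)
qed

lemma smooth_fun_compose:
  assumes N: "smooth_atlas N" and N': "smooth_atlas N'" and F: "cw_smooth N U N' F"
    and f: "smooth_fun_on N' U' f" and FU: "\<And>p. p \<in> U \<Longrightarrow> F p \<in> U'"
  shows "smooth_fun_on N U (\<lambda>p. f (F p))"
  unfolding smooth_fun_on_def
proof (intro conjI ballI)
  show "U \<subseteq> mcarrier N" by (rule cw_smoothD(2)[OF F])
  fix i assume i: "i \<in> idx N"
  then have i': "i \<in> idx N'" using cw_smoothD(1)[OF F] by simp
  have g: "Cinf_on (mdim N') (chart N' i ` (U' \<inter> cdom N' i)) (\<lambda>x. f (chart_inv N' i x))"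
    using f i' by (simp add: smooth_fun_on_def)
  have "Cinf_on (mdim N) (chart N i ` (U \<inter> cdom N i)) (\<lambda>x. f (chart_inv N' i (rep N N' F i x)))"
    by (rule Cinf_on_compose[OF g cw_smoothD(3,5)[OF F i] rep_in[OF N F i _ FU]])
  then show "Cinf_on (mdim N) (chart N i ` (U \<inter> cdom N i)) (\<lambda>x. f (F (chart_inv N i x)))"
    by (rule Cinf_on_cong)
      (use cw_smoothD(4)[OF F i] in \<open>auto simp: rep_chart[OF N i] chart_inv_chart[OF N' i'] chart_inv_chart[OF N i]\<close>)
qed

text \<open>Independence of \<open>chart_at\<close> again: after inserting the transition from
  \<open>a\<close> to \<open>i\<close>, the chain rule moves the differentiation to chart
  \<open>i\<close>, and the transformation law turns the inner derivative into the component of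
  \<open>\<xi>\<close> there.\<close>

lemma differential_chart:
  assumes N: "smooth_atlas N" and f: "smooth_fun_on N U f"
    and i: "i \<in> idx N" and \<xi>: "\<xi> \<in> cdom (TB N) i" "foot \<xi> \<in> U"
  shows "differential N f \<xi> = dirder (mdim N) (\<lambda>x. f (chart_inv N i x)) (chart N i (foot \<xi>)) (comp \<xi> i)"
proof -
  define p where "p = foot \<xi>"
  define a where "a = chart_at N p"
  have pU: "p \<in> U" and pi: "p \<in> cdom N i" using \<xi> by (simp_all add: p_def cdom_TB)
  have a: "a \<in> idx N" "p \<in> cdom N a"
    unfolding a_def using chart_at[of p N] f pU by (auto simp: smooth_fun_on_def)
  have g: "Cinf_on (mdim N) (chart N i ` (U \<inter> cdom N i)) (\<lambda>x. f (chart_inv N i x))"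
    "Cinf_on (mdim N) (chart N a ` (U \<inter> cdom N a)) (\<lambda>x. f (chart_inv N a x))"
    using f a i by (simp_all add: smooth_fun_on_def)
  let ?V = "chart N a ` (U \<inter> cdom N i \<inter> cdom N a)"
  have V: "eopen (mdim N) ?V"
    unfolding image_Int_chart[OF N a(1)] by (intro openin_Int eopen_chart_Int[OF N] Cinf_on_open[OF g(2)] a i)
  have X: "chart N a p \<in> ?V" using pU pi a by auto
  have "differential N f \<xi> = dirder (mdim N) (\<lambda>x. f (chart_inv N a x)) (chart N a p) (comp \<xi> a)"
    by (simp add: differential_def Let_def dirder_def p_def a_def)
  also have "\<dots> = dirder (mdim N) (\<lambda>x. f (chart_inv N i (chart N i (chart_inv N a x)))) (chart N a p) (comp \<xi> a)"
    by (rule dirder_cong[OF V X]) (auto simp: chart_inv_chart[OF N] a i)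
  also have "\<dots> = dirder (mdim N) (\<lambda>x. f (chart_inv N i x)) (chart N i (chart_inv N a (chart N a p)))
      (\<lambda>k. dirder (mdim N) (\<lambda>x. chart N i (chart_inv N a x) k) (chart N a p) (comp \<xi> a))"
  proof (rule dirder_compose[OF g(1) _ _ V X, where F = "\<lambda>x. chart N i (chart_inv N a x)"])
    show "Cinf_on (mdim N) ?V (\<lambda>x. chart N i (chart_inv N a x) k)" if "k < mdim N" for k
      by (rule Cinf_on_subset[OF transition_smooth[OF N a(1) i that] _ V]) auto
    show "chart N i (chart_inv N a x) \<in> chart N i ` (U \<inter> cdom N i)" if "x \<in> ?V" for x
      using chart_inv_in[OF N a(1) that] by auto
  qed
  also have "\<dots> = dirder (mdim N) (\<lambda>x. f (chart_inv N i x)) (chart N i p) (comp \<xi> i)"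
    using \<xi> a pi i unfolding dirder_def[of _ "\<lambda>x. f (chart_inv N i x)"]
    by (intro sum.cong refl) (simp add: chart_inv_chart[OF N] cdom_TB p_def
        tangent_space_law[of "comp \<xi>" N "foot \<xi>" a i])
  finally show ?thesis by (simp add: p_def)
qed

lemma smooth_fun_differential:
  assumes N: "smooth_atlas N" and f: "smooth_fun_on N U f"
  shows "smooth_fun_on (TB N) {\<xi> \<in> mcarrier (TB N). foot \<xi> \<in> U} (differential N f)"
  unfolding smooth_fun_on_def
proof (intro conjI ballI)
  note T = smooth_atlas_TB[OF N]
  fix i assume "i \<in> idx (TB N)"
  then have i: "i \<in> idx N" "i \<in> idx (TB N)" by simp_all
  have eq: "{\<xi> \<in> mcarrier (TB N). foot \<xi> \<in> U} \<inter> cdom (TB N) i =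
      {\<xi>. foot \<xi> \<in> U} \<inter> cdom (TB N) i"
    using i by (auto simp: in_mcarrier)
  have "Cinf_on (mdim N) (chart N i ` (U \<inter> cdom N i)) (\<lambda>x. f (chart_inv N i x))"
    using f i by (simp add: smooth_fun_on_def)
  from Cinf_on_dirder[OF this]
  show "Cinf_on (mdim (TB N)) (chart (TB N) i `
      ({\<xi> \<in> mcarrier (TB N). foot \<xi> \<in> U} \<inter> cdom (TB N) i))
      (\<lambda>x. differential N f (chart_inv (TB N) i x))"
    unfolding eq TB_chart_image[OF N i(1), symmetric] mdim_TB
    by (rule Cinf_on_cong)
      (use differential_chart[OF N f i(1)] in
        \<open>auto simp: chart_inv_chart[OF T i(2)] chart_TB_lo_hi[OF N i(1)]\<close>)
qed auto

section \<open>The canonical flip in charts\<close>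

text \<open>\<open>TTN\<close> has coordinates \<open>(x, v, w, z)\<close> in four blocks of size \<open>n\<close>; the flip interchanges
  \<open>v\<close> and \<open>w\<close>.\<close>

definition bperm :: "nat \<Rightarrow> nat \<Rightarrow> nat" where
  "bperm n k = (if k < n then k else if k < 2 * n then n + k else if k < 3 * n then k - n else k)"

definition sflip :: "nat \<Rightarrow> (nat \<Rightarrow> real) \<Rightarrow> nat \<Rightarrow> real" where
  "sflip n X = (\<lambda>k. if k < 2 * (2 * n) then X (bperm n k) else 0)"

lemma sflip_euc [simp]: "sflip n X \<in> euc (2 * (2 * n))"
  by (simp add: sflip_def in_euc)

lemma sflip_euc' [simp]: "sflip n X \<in> euc (4 * n)"
  using sflip_euc[of n X] by simp

lemma lo_join_lo: "lo n (join n x y) = lo n x"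
  by (auto simp: lo_def join_def)

lemma sflip_blocks:
  "lo n (lo (2 * n) (sflip n X)) = lo n (lo (2 * n) X)"
  "hi n (lo (2 * n) (sflip n X)) = lo n (hi (2 * n) X)"
  "lo n (hi (2 * n) (sflip n X)) = hi n (lo (2 * n) X)"
  "hi n (hi (2 * n) (sflip n X)) = hi n (hi (2 * n) X)"
  by (auto simp: lo_def hi_def sflip_def bperm_def fun_eq_iff algebra_simps intro!: arg_cong[of _ _ X])

lemma blocks_eqI:
  assumes "X \<in> euc (2 * (2 * n))" "Y \<in> euc (2 * (2 * n))"
    "lo n (lo (2 * n) X) = lo n (lo (2 * n) Y)" "hi n (lo (2 * n) X) = hi n (lo (2 * n) Y)"
    "lo n (hi (2 * n) X) = lo n (hi (2 * n) Y)" "hi n (hi (2 * n) X) = hi n (hi (2 * n) Y)"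
  shows "X = Y"
proof -
  have "lo (2 * n) X = lo (2 * n) Y" "hi (2 * n) X = hi (2 * n) Y"
    using assms(3-6) by (metis join_lo_hi lo_euc) (metis assms(5,6) join_lo_hi hi_euc)
  then show ?thesis using assms(1,2) by (metis join_lo_hi)
qed

lemma sflip_sflip: "X \<in> euc (2 * (2 * n)) \<Longrightarrow> sflip n (sflip n X) = X"
  by (rule blocks_eqI[of _ n]) (simp_all only: sflip_blocks sflip_euc)

lemma lo_cong: "(\<And>k. k < n \<Longrightarrow> x k = y k) \<Longrightarrow> lo n x = lo n y"
  by (auto simp: lo_def)

lemma lo_lo_double: "lo n (lo (2 * n) x) = lo n x"
  by (auto simp: lo_def)

lemma hi_lo_double: "hi n (lo (2 * n) x) = lo n (\<lambda>k. x (n + k))"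
  by (auto simp: lo_def hi_def)

text \<open>The coordinate formula for the second tangent map: at X = (x, v, w, z) its blocks are
  \<phi>, d\<phi>(v), d\<phi>(w) and D^2\<phi>(w, v) + d\<phi>(z), all taken at x. It is split by
  blocks because the flip permutes blocks.\<close>

lemma tlift_tlift_blocks:
  assumes \<phi>: "\<And>k. k < n \<Longrightarrow> Cinf_on n W (\<lambda>x. \<phi> x k)" and x: "x = lo n (lo (2 * n) X)" "x \<in> W"
    and T: "T = tlift (2 * n) (2 * n) (tlift n n \<phi>) X"
  shows "lo n (lo (2 * n) T) = lo n (\<phi> x)"
    "hi n (lo (2 * n) T) = lo n (\<lambda>k. dirder n (\<lambda>x. \<phi> x k) x (hi n (lo (2 * n) X)))"
    "lo n (hi (2 * n) T) = lo n (\<lambda>k. dirder n (\<lambda>x. \<phi> x k) x (lo n (hi (2 * n) X)))"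
    "hi n (hi (2 * n) T) = lo n (\<lambda>k. (\<Sum>l<n. dirder n (partial l (\<lambda>x. \<phi> x k)) x (lo n (hi (2 * n) X)) * hi n (lo (2 * n) X) l)
        + dirder n (\<lambda>x. \<phi> x k) x (hi n (hi (2 * n) X)))"
proof -
  let ?Y = "lo (2 * n) X" and ?Z = "hi (2 * n) X"
  have X: "lo n ?Y \<in> W" using x by simp
  have l: "lo (2 * n) T = tlift n n \<phi> ?Y" by (simp add: T tlift_def[of "2 * n"] lo_join)
  have h: "hi (2 * n) T = lo (2 * n) (\<lambda>k. dirder (2 * n) (\<lambda>Y. tlift n n \<phi> Y k) ?Y ?Z)"
    by (simp add: T tlift_def[of "2 * n"] hi_join_lo)
  show "lo n (lo (2 * n) T) = lo n (\<phi> x)"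
    by (simp add: l tlift_def lo_join_lo x)
  show "hi n (lo (2 * n) T) = lo n (\<lambda>k. dirder n (\<lambda>x. \<phi> x k) x (hi n (lo (2 * n) X)))"
    by (simp add: l tlift_def hi_join_lo x)
  have t1: "(\<lambda>Y. tlift n n \<phi> Y k) = (\<lambda>Y. \<phi> (lo n Y) k)" if "k < n" for k
    using that by (simp add: tlift_def join_def)
  have t2: "(\<lambda>Y. tlift n n \<phi> Y (n + k)) = (\<lambda>Y. dirder n (\<lambda>x. \<phi> x k) (lo n Y) (hi n Y))" if "k < n" for k
    using that by (simp add: tlift_def join_def)
  show "lo n (hi (2 * n) T) = lo n (\<lambda>k. dirder n (\<lambda>x. \<phi> x k) x (lo n (hi (2 * n) X)))"
    unfolding h lo_lo_double
    by (rule lo_cong) (simp add: t1 dirder_lo[OF \<phi> lo_euc X] x)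
  show "hi n (hi (2 * n) T) = lo n (\<lambda>k. (\<Sum>l<n. dirder n (partial l (\<lambda>x. \<phi> x k)) x (lo n (hi (2 * n) X)) * hi n (lo (2 * n) X) l)
        + dirder n (\<lambda>x. \<phi> x k) x (hi n (hi (2 * n) X)))"
    unfolding h hi_lo_double
    by (rule lo_cong) (simp add: t2 dirder_dirder[OF \<phi> lo_euc X] x hi_lo_double)
qed

lemma sflip_tlift_tlift:
  assumes \<phi>: "\<And>k. k < n \<Longrightarrow> Cinf_on n W (\<lambda>x. \<phi> x k)" and X: "lo n (lo (2 * n) X) \<in> W"
  shows "sflip n (tlift (2 * n) (2 * n) (tlift n n \<phi>) X) = tlift (2 * n) (2 * n) (tlift n n \<phi>) (sflip n X)"
proof -
  define x where "x = lo n (lo (2 * n) X)"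
  have x: "x \<in> W" "x = lo n (lo (2 * n) (sflip n X))" using X by (simp_all add: sflip_blocks x_def)
  note B = tlift_tlift_blocks[OF \<phi> x_def x(1) refl] and B' = tlift_tlift_blocks[OF \<phi> x(2,1) refl, unfolded sflip_blocks]
  \<comment> \<open>The other three blocks match directly once v and w are exchanged; in the last
    one the second derivative must be symmetric in its two directions.\<close>
  have sym: "(\<Sum>l<n. dirder n (partial l (\<lambda>x. \<phi> x k)) x a * b l) = (\<Sum>l<n. dirder n (partial l (\<lambda>x. \<phi> x k)) x b * a l)"
    if "k < n" for a b k
  proof -
    have "(\<Sum>l<n. dirder n (partial l (\<lambda>x. \<phi> x k)) x a * b l) = (\<Sum>l<n. \<Sum>m<n. partial m (partial l (\<lambda>x. \<phi> x k)) x * a m * b l)"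
      by (simp add: dirder_def sum_distrib_right)
    also have "\<dots> = (\<Sum>l<n. \<Sum>m<n. partial l (partial m (\<lambda>x. \<phi> x k)) x * a m * b l)"
      using partial_commute[OF \<phi>[OF that] x(1)] by (intro sum.cong refl) simp
    also have "\<dots> = (\<Sum>m<n. \<Sum>l<n. partial l (partial m (\<lambda>x. \<phi> x k)) x * a m * b l)" by (rule sum.swap)
    also have "\<dots> = (\<Sum>m<n. \<Sum>l<n. partial l (partial m (\<lambda>x. \<phi> x k)) x * b l * a m)"
      by (intro sum.cong refl) simp
    finally show ?thesis by (simp add: dirder_def sum_distrib_right)
  qed
  show ?thesis
  proof (rule blocks_eqI[of _ n])
    show "hi n (hi (2 * n) (sflip n (tlift (2 * n) (2 * n) (tlift n n \<phi>) X))) =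
        hi n (hi (2 * n) (tlift (2 * n) (2 * n) (tlift n n \<phi>) (sflip n X)))"
      by (simp only: sflip_blocks B B', rule lo_cong) (simp only: sym[where a = "lo n (hi (2 * n) X)" and b = "hi n (lo (2 * n) X)"])
  qed (simp_all only: sflip_euc tlift_euc sflip_blocks B B')
qed

section \<open>The flip on the second tangent bundle\<close>

abbreviation tan2 :: "('i, 'a) tmanifold \<Rightarrow> ('i, 'a) tmanifold" where
  "tan2 N \<equiv> TB (TB N)"

lemma cdom_tan2:
  "\<xi> \<in> cdom (tan2 N) i \<longleftrightarrow> \<xi> \<in> cdom (tan2 N) j" if "foot (foot \<xi>) \<in> cdom N i" "foot (foot \<xi>) \<in> cdom N j"
  using that by (auto simp: cdom_TB)

lemma cdom_tan2_foot: "\<xi> \<in> cdom (tan2 N) i \<Longrightarrow> foot (foot \<xi>) \<in> cdom N i"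
  by (simp add: cdom_TB)

lemma tan2_chart_lo_lo:
  assumes "smooth_atlas N" "i \<in> idx N" "\<xi> \<in> cdom (tan2 N) i"
  shows "lo (mdim N) (lo (2 * mdim N) (chart (tan2 N) i \<xi>)) = chart N i (foot (foot \<xi>))"
proof -
  have "foot \<xi> \<in> cdom (TB N) i" using assms(3) by (simp add: cdom_TB)
  then show ?thesis
    using chart_TB_lo_hi(2)[OF smooth_atlas_TB[OF assms(1)], of i \<xi>] assms
      chart_TB_lo_hi(2)[OF assms(1,2), of "foot \<xi>"] by simp
qed

lemma tan2_chart_euc:
  assumes "smooth_atlas N" "i \<in> idx N" "\<xi> \<in> cdom (tan2 N) i"
  shows "chart (tan2 N) i \<xi> \<in> euc (2 * (2 * mdim N))"
  using chart_TB_lo_hi(1)[OF smooth_atlas_TB[OF assms(1)], of i \<xi>] assms by simp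

lemma tan2_chart_image:
  assumes N: "smooth_atlas N" and i: "i \<in> idx N"
  shows "chart (tan2 N) i ` cdom (tan2 N) i =
    {X \<in> euc (2 * (2 * mdim N)). lo (mdim N) (lo (2 * mdim N) X) \<in> chart N i ` cdom N i}"
  using TB_chart_image_UNIV[OF smooth_atlas_TB[OF N], of i]
    TB_chart_image_UNIV[OF N i] i by simp

lemma tan2_transition:
  assumes N: "smooth_atlas N" and ij: "i \<in> idx N" "j \<in> idx N" and \<xi>: "\<xi> \<in> cdom (tan2 N) i" "\<xi> \<in> cdom (tan2 N) j"
  shows "chart (tan2 N) j \<xi> = tlift (2 * mdim N) (2 * mdim N) (tlift (mdim N) (mdim N) (\<lambda>x. chart N j (chart_inv N i x)))
    (chart (tan2 N) i \<xi>)"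
proof -
  let ?T = "TB N"
  have T: "smooth_atlas ?T" by (rule smooth_atlas_TB[OF N])
  have ij': "i \<in> idx ?T" "j \<in> idx ?T" using ij by simp_all
  have "chart (tan2 N) j \<xi> = tlift (2 * mdim N) (2 * mdim N) (\<lambda>x. chart ?T j (chart_inv ?T i x)) (chart (tan2 N) i \<xi>)"
    using TB_transition[OF T ij' \<xi>] by simp
  also have "\<dots> = tlift (2 * mdim N) (2 * mdim N) (tlift (mdim N) (mdim N) (\<lambda>x. chart N j (chart_inv N i x))) (chart (tan2 N) i \<xi>)"
  proof (rule tlift_cong)
    show "eopen (2 * mdim N) (chart ?T i ` (cdom ?T j \<inter> cdom ?T i))"
      using eopen_chart_Int[OF T ij'] by simp
    show "lo (2 * mdim N) (chart (tan2 N) i \<xi>) \<in> chart ?T i ` (cdom ?T j \<inter> cdom ?T i)"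
      using chart_TB_lo_hi(2)[OF T ij'(1) \<xi>(1)] \<xi> by (simp add: cdom_TB)
    show "chart ?T j (chart_inv ?T i x) = tlift (mdim N) (mdim N) (\<lambda>x. chart N j (chart_inv N i x)) x"
      if "x \<in> chart ?T i ` (cdom ?T j \<inter> cdom ?T i)" for x
      using that TB_transition[OF N ij] by (auto simp: chart_inv_chart[OF T ij'(1)])
  qed
  finally show ?thesis .
qed

text \<open>The explicit candidate for the description in \<open>canonical_flip\<close>: swap blocks
  in some chart around \<open>\<xi>\<close>. That the choice by \<open>chart_at\<close> is
  immaterial is the content of \<open>cflip_chart\<close>.\<close>

definition cflip :: "('i, 'a) tmanifold \<Rightarrow> ('i, 'a) tpoint \<Rightarrow> ('i, 'a) tpoint" where
  "cflip N \<xi> = (let i = chart_at (tan2 N) \<xi> in chart_inv (tan2 N) i (sflip (mdim N) (chart (tan2 N) i \<xi>)))"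

lemma cflip_chart:
  assumes N: "smooth_atlas N" and i: "i \<in> idx N" and \<xi>: "\<xi> \<in> cdom (tan2 N) i"
  shows "cflip N \<xi> \<in> cdom (tan2 N) i" "chart (tan2 N) i (cflip N \<xi>) = sflip (mdim N) (chart (tan2 N) i \<xi>)"
    "foot (foot (cflip N \<xi>)) = foot (foot \<xi>)"
proof -
  let ?n = "mdim N"
  define a where "a = chart_at (tan2 N) \<xi>"
  have T: "smooth_atlas (tan2 N)" by (intro smooth_atlas_TB N)
  have "\<xi> \<in> mcarrier (tan2 N)" using i \<xi> by (auto simp: in_mcarrier)
  from chart_at[OF this] have a: "a \<in> idx N" "\<xi> \<in> cdom (tan2 N) a" by (simp_all add: a_def)
  \<comment> \<open>Within Euclidean space the chart image is constrained only in the block x, which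
    the swap leaves fixed.\<close>
  have "sflip ?n (chart (tan2 N) a \<xi>) \<in> chart (tan2 N) a ` cdom (tan2 N) a"
    using cdom_tan2_foot[OF a(2)] tan2_chart_lo_lo[OF N a]
    unfolding tan2_chart_image[OF N a(1)] by (simp add: sflip_blocks)
  then obtain \<eta> where \<eta>: "\<eta> \<in> cdom (tan2 N) a" "sflip ?n (chart (tan2 N) a \<xi>) = chart (tan2 N) a \<eta>"
    by blast
  then have e: "cflip N \<xi> = \<eta>"
    using chart_inv_chart[OF T, of a \<eta>] a by (simp add: cflip_def a_def[symmetric] Let_def)
  have "chart N a (foot (foot \<eta>)) = chart N a (foot (foot \<xi>))"
    using tan2_chart_lo_lo[OF N a(1) \<eta>(1)] tan2_chart_lo_lo[OF N a] by (simp add: \<eta>(2)[symmetric] sflip_blocks)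
  then have ff: "foot (foot \<eta>) = foot (foot \<xi>)"
    using chart_eqD[OF N a(1)] cdom_tan2_foot[OF a(2)] cdom_tan2_foot[OF \<eta>(1)] by blast
  have \<eta>i: "\<eta> \<in> cdom (tan2 N) i"
    using \<eta>(1) cdom_tan2[of \<eta> N a i] cdom_tan2_foot[OF \<xi>] cdom_tan2_foot[OF \<eta>(1)] ff by simp
  let ?\<phi> = "\<lambda>x. chart N i (chart_inv N a x)"
  have "chart (tan2 N) i \<eta> = tlift (2 * ?n) (2 * ?n) (tlift ?n ?n ?\<phi>) (sflip ?n (chart (tan2 N) a \<xi>))"
    using tan2_transition[OF N a(1) i \<eta>(1) \<eta>i] \<eta>(2) by simp
  also have "\<dots> = sflip ?n (tlift (2 * ?n) (2 * ?n) (tlift ?n ?n ?\<phi>) (chart (tan2 N) a \<xi>))"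
    using cdom_tan2_foot[OF \<xi>] cdom_tan2_foot[OF a(2)] tan2_chart_lo_lo[OF N a]
    by (intro sflip_tlift_tlift[symmetric, OF transition_smooth[OF N a(1) i]]) auto
  also have "\<dots> = sflip ?n (chart (tan2 N) i \<xi>)"
    using tan2_transition[OF N a(1) i a(2) \<xi>] by simp
  finally show "cflip N \<xi> \<in> cdom (tan2 N) i" "chart (tan2 N) i (cflip N \<xi>) = sflip ?n (chart (tan2 N) i \<xi>)"
    "foot (foot (cflip N \<xi>)) = foot (foot \<xi>)"
    using e \<eta>i ff by simp_all
qed

lemma cflip_cflip:
  assumes N: "smooth_atlas N" and \<xi>: "\<xi> \<in> mcarrier (tan2 N)"
  shows "cflip N (cflip N \<xi>) = \<xi>"
proof -
  obtain i where i: "i \<in> idx N" "\<xi> \<in> cdom (tan2 N) i" using \<xi> by (auto simp: in_mcarrier)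
  have T: "smooth_atlas (tan2 N)" by (intro smooth_atlas_TB N)
  have c: "cflip N \<xi> \<in> cdom (tan2 N) i" by (rule cflip_chart(1)[OF N i])
  show ?thesis
    by (rule chart_eqD[OF T _ cflip_chart(1)[OF N i(1) c] i(2)])
      (use i c sflip_sflip[OF tan2_chart_euc[OF N i]] in \<open>simp_all add: cflip_chart(2)[OF N i(1)]\<close>)
qed

lemma cflip_mcarrier: "smooth_atlas N \<Longrightarrow> \<xi> \<in> mcarrier (tan2 N) \<Longrightarrow> cflip N \<xi> \<in> mcarrier (tan2 N)"
  unfolding in_mcarrier using cflip_chart(1) by fastforce

lemma cw_smooth_cflip:
  assumes N: "smooth_atlas N"
  shows "cw_smooth (tan2 N) (mcarrier (tan2 N)) (tan2 N) (cflip N)"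
    and "i \<in> idx N \<Longrightarrow> X \<in> chart (tan2 N) i ` cdom (tan2 N) i \<Longrightarrow> rep (tan2 N) (tan2 N) (cflip N) i X = sflip (mdim N) X"
proof -
  have T: "smooth_atlas (tan2 N)" by (intro smooth_atlas_TB N)
  show r: "rep (tan2 N) (tan2 N) (cflip N) i X = sflip (mdim N) X"
    if "i \<in> idx N" "X \<in> chart (tan2 N) i ` cdom (tan2 N) i" for i X
    using that cflip_chart(2)[OF N that(1)] by (auto simp: rep_chart[OF T])
  have im: "mcarrier (tan2 N) \<inter> cdom (tan2 N) i = cdom (tan2 N) i"
    if "i \<in> idx N" for i using that by (auto simp: in_mcarrier)
  show "cw_smooth (tan2 N) (mcarrier (tan2 N)) (tan2 N) (cflip N)"
  proof (rule cw_smoothI)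
    fix i assume "i \<in> idx (tan2 N)"
    then have i: "i \<in> idx N" by simp
    show o: "eopen (mdim (tan2 N)) (chart (tan2 N) i ` (mcarrier (tan2 N) \<inter> cdom (tan2 N) i))"
      unfolding im[OF i] using i by (intro eopen_chart T) simp
    show "cflip N \<xi> \<in> cdom (tan2 N) i" if "\<xi> \<in> cdom (tan2 N) i" for \<xi>
      by (rule cflip_chart(1)[OF N i that])
    fix k assume k: "k < mdim (tan2 N)"
    then have "Cinf_on (mdim (tan2 N)) (chart (tan2 N) i ` cdom (tan2 N) i) (\<lambda>X. sflip (mdim N) X k)"
      using Cinf_on_coord[OF o] im[OF i] by (simp add: sflip_def)
    then show "Cinf_on (mdim (tan2 N)) (chart (tan2 N) i ` (mcarrier (tan2 N) \<inter> cdom (tan2 N) i))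
       (\<lambda>X. rep (tan2 N) (tan2 N) (cflip N) i X k)"
      unfolding im[OF i] by (rule Cinf_on_cong) (simp add: r[OF i])
  qed simp_all
qed

text \<open>The swap is an involution, so the flip is its own inverse and one smoothness statement
  covers both directions.\<close>

lemma diffeomorphism_cflip:
  assumes N: "smooth_atlas N"
  shows "diffeomorphism (tan2 N) (tan2 N) (restrict (cflip N) (mcarrier (tan2 N)))"
proof -
  let ?C = "mcarrier (tan2 N)" and ?r = "restrict (cflip N) (mcarrier (tan2 N))"
  have T: "smooth_atlas (tan2 N)" by (intro smooth_atlas_TB N)
  have b: "bij_betw ?r ?C ?C"
    by (rule bij_betw_byWitness[where f' = ?r]) (auto simp: cflip_cflip[OF N] cflip_mcarrier[OF N])
  have "inv_into ?C ?r \<xi> = cflip N \<xi>" if "\<xi> \<in> ?C" for \<xi>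
    using that cflip_cflip[OF N] cflip_mcarrier[OF N]
    by (intro inv_into_f_eq[OF bij_betw_imp_inj_on[OF b]]) auto
  then have "cw_smooth (tan2 N) ?C (tan2 N) (inv_into ?C ?r)" "cw_smooth (tan2 N) ?C (tan2 N) ?r"
    by (auto intro: cw_smooth_cong[OF T cw_smooth_cflip(1)[OF N]])
  then show ?thesis
    using b cw_smooth_smooth_map[OF T T] by (simp add: diffeomorphism_def)
qed

text \<open>The blocks are C, \<partial>_a C, \<partial>_b C and \<partial>_b \<partial>_a C in the
  chart, with \<open>a\<close> the inner direction. The directions stay variable so that both orders
  of differentiation are instances.\<close>

lemma mixed_velocity_chart:
  assumes N: "smooth_atlas N" and i: "i \<in> idx N" and W: "eopen d W" "x \<in> W"
    and C: "\<And>y. y \<in> W \<Longrightarrow> C y \<in> cdom N i" "\<And>k. k < mdim N \<Longrightarrow> Cinf_on d W (\<lambda>y. chart N i (C y) k)"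
    and ab: "a < d" "b < d" "a \<noteq> b"
  defines "V \<equiv> velocity (TB N) (\<lambda>v. velocity N (\<lambda>u. C (x(b := v, a := u))) (x a)) (x b)"
    and "g \<equiv> \<lambda>k y. chart N i (C y) k"
  shows "V \<in> cdom (tan2 N) i"
    "chart (tan2 N) i V = join (2 * mdim N) (join (mdim N) (chart N i (C x)) (\<lambda>k. partial a (g k) x))
       (join (mdim N) (\<lambda>k. partial b (g k) x) (\<lambda>k. partial b (partial a (g k)) x))"
proof -
  let ?n = "mdim N" and ?T = "TB N"
  have T: "smooth_atlas ?T" by (intro smooth_atlas_TB N)
  define \<gamma> where "\<gamma> v = velocity N (\<lambda>u. C (x(b := v, a := u))) (x a)" for v
  have in1: "velocity N (\<lambda>u. C (y(a := u))) (y a) \<in> cdom ?T i"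
    and chart1: "chart ?T i (velocity N (\<lambda>u. C (y(a := u))) (y a)) = join ?n (chart N i (C y)) (\<lambda>k. partial a (g k) y)"
    if y: "y \<in> W" for y
  proof -
    have ev: "\<forall>\<^sub>F u in nhds (y a). C (y(a := u)) \<in> cdom N i"
      using eopen_eventually_upd[OF W(1) y ab(1)] by eventually_elim (rule C(1))
    have d: "((\<lambda>u. chart N i (C (y(a := u))) k) has_real_derivative partial a (g k) y) (at (y a))"
      if "k < ?n" for k
      using Cinf_on_has_partial[OF C(2)[OF that] y ab(1)] by (simp add: g_def)
    from velocity_chart[where \<gamma> = "\<lambda>u. C (y(a := u))", OF N i ev d]
    show "velocity N (\<lambda>u. C (y(a := u))) (y a) \<in> cdom ?T i"
      "chart ?T i (velocity N (\<lambda>u. C (y(a := u))) (y a)) = join ?n (chart N i (C y)) (\<lambda>k. partial a (g k) y)"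
      by simp_all
  qed
  have \<gamma>eq: "\<gamma> v = velocity N (\<lambda>u. C ((x(b := v))(a := u))) ((x(b := v)) a)" for v
    using ab by (simp add: \<gamma>_def)
  have evW: "\<forall>\<^sub>F v in nhds (x b). x(b := v) \<in> W" by (rule eopen_eventually_upd[OF W ab(2)])
  then have ev: "\<forall>\<^sub>F v in nhds (x b). \<gamma> v \<in> cdom ?T i"
    unfolding \<gamma>eq by eventually_elim (rule in1)
  have i': "i \<in> idx ?T" using i by simp
  define d where "d = join ?n (\<lambda>k. partial b (g k) x) (\<lambda>k. partial b (partial a (g k)) x)"
  have "((\<lambda>v. chart ?T i (\<gamma> v) k) has_real_derivative d k) (at (x b))" if k: "k < mdim ?T" for k
  proof -
    have "((\<lambda>v. join ?n (chart N i (C (x(b := v)))) (\<lambda>k. partial a (g k) (x(b := v))) k) has_real_derivative d k) (at (x b))"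
    proof (cases "k < ?n")
      case True
      then show ?thesis
        using Cinf_on_has_partial[OF C(2)[OF True] W(2) ab(2)] by (simp add: d_def join_def g_def)
    next
      case False
      then have "k - ?n < ?n" using k by simp
      from Cinf_on_has_partial[OF Cinf_on_partial[OF C(2)[OF this] ab(1)] W(2) ab(2)] False k
      show ?thesis by (simp add: d_def join_def g_def)
    qed
    moreover have "\<forall>\<^sub>F v in nhds (x b). chart ?T i (\<gamma> v) k =
        join ?n (chart N i (C (x(b := v)))) (\<lambda>k. partial a (g k) (x(b := v))) k"
      using evW unfolding \<gamma>eq by eventually_elim (simp only: chart1)
    ultimately show ?thesis by (simp only: DERIV_cong_ev[OF refl _ refl])
  qed
  from velocity_chart[OF T i' ev this] chart1[OF W(2)] ab
  show "V \<in> cdom (tan2 N) i"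
    "chart (tan2 N) i V = join (2 * ?n) (join ?n (chart N i (C x)) (\<lambda>k. partial a (g k) x))
       (join ?n (\<lambda>k. partial b (g k) x) (\<lambda>k. partial b (partial a (g k)) x))"
    by (simp_all add: V_def \<gamma>_def[symmetric] d_def) (simp add: \<gamma>_def)
qed

lemma sflip_join:
  "sflip n (join (2 * n) (join n a b) (join n c d)) = join (2 * n) (join n a c) (join n b d)"
  by (rule blocks_eqI[of _ n]) (simp_all only: sflip_euc join_euc sflip_blocks lo_join hi_join_lo lo_id lo_join_lo)

section \<open>Surfaces in a manifold and the characterisation of the flip\<close>

definition pt2 :: "real \<Rightarrow> real \<Rightarrow> nat \<Rightarrow> real" where
  "pt2 t s = (\<lambda>k. if k = 0 then t else if k = 1 then s else 0)"

lemma pt2_simps [simp]: "pt2 t s 0 = t" "pt2 t s (Suc 0) = s" "pt2 t s \<in> euc 2"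
  "(pt2 t s)(0 := t') = pt2 t' s" "(pt2 t s)(Suc 0 := s') = pt2 t s'"
  by (auto simp: pt2_def in_euc fun_eq_iff)

text \<open>The parameter domain in the definition of \<open>canonical_flip\<close>, named so that
  it can be folded there and its openness stated once.\<close>

definition square2 :: "real \<Rightarrow> (nat \<Rightarrow> real) set" where
  "square2 \<epsilon> = {x \<in> euc 2. \<bar>x 0\<bar> < \<epsilon> \<and> \<bar>x 1\<bar> < \<epsilon>}"

lemma less_2_iff: "(\<forall>k<(2::nat). P k) \<longleftrightarrow> P 0 \<and> P 1"
  by (auto simp: numeral_2_eq_2 less_Suc_eq)

lemma eopen_square2: "eopen 2 (square2 \<epsilon>)"
  using box_eopen[of 2 "\<lambda>k. 0" \<epsilon>] by (simp add: square2_def less_2_iff)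

lemma euclidean_simps [simp]:
  "mdim (euclidean d) = d" "idx (euclidean d) = UNIV" "cdom (euclidean d) j = euc d"
  "chart (euclidean d) j = (\<lambda>x. x)" "mcarrier (euclidean d) = euc d"
  by (simp_all add: euclidean_def mcarrier_def)

lemma chart_inv_euclidean: "x \<in> euc d \<Longrightarrow> chart_inv (euclidean d) j x = x"
  using inv_into_f_f[of "\<lambda>x. x" "euc d" x] by (simp add: chart_inv_def inj_on_def)

text \<open>The two orders of differentiation give the same base block, exchanged middle blocks, and
  last blocks that agree by symmetry of second derivatives. This is the existence half of the
  description.\<close>

lemma mixed_velocity_flip:
  assumes N: "smooth_atlas N" and c: "smooth_map_on (euclidean 2) (square2 \<epsilon>) N (\<lambda>x. c (x 0) (x 1))"
    and ts: "\<bar>t\<bar> < \<epsilon>" "\<bar>s\<bar> < \<epsilon>"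
  defines "V \<equiv> velocity (TB N) (\<lambda>s. velocity N (\<lambda>t. c t s) t) s"
  shows "velocity (TB N) (\<lambda>t. velocity N (\<lambda>s. c t s) s) t = cflip N V" "V \<in> mcarrier (tan2 N)"
proof -
  define C where "C x = c (x 0) (x 1)" for x :: "nat \<Rightarrow> real"
  have x: "pt2 t s \<in> square2 \<epsilon>" using ts by (simp add: square2_def)
  have "C (pt2 t s) \<in> mcarrier N" using c x unfolding smooth_map_on_def C_def by blast
  then obtain i where i: "i \<in> idx N" "C (pt2 t s) \<in> cdom N i" by (auto simp: in_mcarrier)
  define W where "W = {x \<in> square2 \<epsilon> \<inter> euc 2. C x \<in> cdom N i}"
  have *: "eopen 2 W \<and> (\<forall>k<mdim N. Cinf_on 2 W (\<lambda>x. chart N i (C (chart_inv (euclidean 2) () x)) k))"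
    using c i(1) unfolding smooth_map_on_def Let_def W_def C_def by simp
  then have W: "eopen 2 W" ..
  have C: "Cinf_on 2 W (\<lambda>x. chart N i (C x) k)" if "k < mdim N" for k
    by (rule Cinf_on_cong[OF *[THEN conjunct2, rule_format, OF that]])
      (auto simp: W_def chart_inv_euclidean)
  have xW: "pt2 t s \<in> W" and CW: "\<And>y. y \<in> W \<Longrightarrow> C y \<in> cdom N i" using x i by (auto simp: W_def)
  \<comment> \<open>Coordinate 0 is \<open>t\<close> and coordinate 1 is \<open>s\<close>:
    \<open>m1\<close> differentiates in \<open>s\<close> first, \<open>m2\<close> in
    \<open>t\<close> first.\<close>
  note m1 = mixed_velocity_chart[OF N i(1) W xW CW C, of 1 0]
    and m2 = mixed_velocity_chart[OF N i(1) W xW CW C, of 0 1]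
  have V2: "V \<in> cdom (tan2 N) i" using m2(1) by (simp add: V_def C_def)
  then show "V \<in> mcarrier (tan2 N)" using i by (auto simp: in_mcarrier)
  have T: "smooth_atlas (tan2 N)" by (intro smooth_atlas_TB N)
  have comm: "partial 1 (partial 0 (\<lambda>y. chart N i (C y) k)) (pt2 t s) = partial 0 (partial 1 (\<lambda>y. chart N i (C y) k)) (pt2 t s)"
    if "k < mdim N" for k
    using partial_commute[OF C[OF that] xW, of 1 0] by simp
  show "velocity (TB N) (\<lambda>t. velocity N (\<lambda>s. c t s) s) t = cflip N V"
  proof (rule chart_eqD[OF T])
    show "velocity (TB N) (\<lambda>t. velocity N (\<lambda>s. c t s) s) t \<in> cdom (tan2 N) i"
      using m1(1) by (simp add: C_def)
    have "chart (tan2 N) i (velocity (TB N) (\<lambda>t. velocity N (\<lambda>s. c t s) s) t) =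
      sflip (mdim N) (chart (tan2 N) i V)"
      using m1(2) m2(2) comm by (simp add: C_def V_def sflip_join cong: join_cong)
    then show "chart (tan2 N) i (velocity (TB N) (\<lambda>t. velocity N (\<lambda>s. c t s) s) t) = chart (tan2 N) i (cflip N V)"
      using cflip_chart(2)[OF N i(1) V2] by simp
  qed (use i cflip_chart(1)[OF N i(1) V2] in simp_all)
qed

text \<open>The second-order vector with coordinates \<open>(x, v, w, z)\<close> is realised by
  \<open>c t s = x + t v + s w + t s z\<close> in a chart.\<close>

lemma mixed_velocity_surj:
  assumes N: "smooth_atlas N" and \<xi>: "\<xi> \<in> mcarrier (tan2 N)"
  obtains \<epsilon> c where "\<epsilon> > 0" "smooth_map_on (euclidean 2) (square2 \<epsilon>) N (\<lambda>x. c (x 0) (x 1))"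
    "velocity (TB N) (\<lambda>s. velocity N (\<lambda>t. c t s) 0) 0 = \<xi>"
proof -
  obtain i where i: "i \<in> idx N" "\<xi> \<in> cdom (tan2 N) i" using \<xi> by (auto simp: in_mcarrier)
  let ?n = "mdim N"
  define X where "X = chart (tan2 N) i \<xi>"
  define x v w z where "x = lo ?n (lo (2 * ?n) X)" and "v = hi ?n (lo (2 * ?n) X)"
    and "w = lo ?n (hi (2 * ?n) X)" and "z = hi ?n (hi (2 * ?n) X)"
  have X: "X = join (2 * ?n) (join ?n x v) (join ?n w z)"
    using tan2_chart_euc[OF N i] by (simp add: x_def v_def w_def z_def join_lo_hi X_def)
  define P where "P y = (\<lambda>k. x k + y 0 * v k + y 1 * w k + y 0 * y 1 * z k)" for y :: "nat \<Rightarrow> real"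
  have PE: "P y \<in> euc ?n" for y
    by (auto simp: in_euc P_def x_def v_def w_def z_def lo_def hi_def)
  have Pc: "Cinf_on 2 U (\<lambda>y. P y k)" if "eopen 2 U" for U k
    unfolding P_def using that by (intro Cinf_on_add Cinf_on_mult Cinf_on_const Cinf_on_coord)
  have euc2: "eopen 2 (euc 2)" by (rule openin_topspace)
  define V where "V = {y \<in> euc 2. P y \<in> chart N i ` cdom N i}"
  have V: "eopen 2 V"
    unfolding V_def by (rule eopen_preimage[OF euc2 eopen_chart[OF N i(1)] Cinf_on_continuous[OF Pc[OF euc2]] PE])
  have x_chart: "x = chart N i (foot (foot \<xi>))"
    using tan2_chart_lo_lo[OF N i] by (simp add: x_def X_def)
  have "P (pt2 0 0) = x" by (simp add: P_def)
  then have V0: "pt2 0 0 \<in> V" using cdom_tan2_foot[OF i(2)] x_chart by (simp add: V_def)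
  \<comment> \<open>A square around the origin inside \<open>V\<close> keeps the polynomial surface
    within the chart.\<close>
  from eopen_box[OF V this] obtain \<epsilon> where \<epsilon>: "\<epsilon> > 0"
    "\<And>y. y \<in> euc 2 \<Longrightarrow> (\<And>k. k < 2 \<Longrightarrow> \<bar>y k - pt2 0 0 k\<bar> < \<epsilon>) \<Longrightarrow> y \<in> V" by metis
  have "square2 \<epsilon> \<subseteq> V"
  proof
    fix y assume y: "y \<in> square2 \<epsilon>"
    show "y \<in> V"
    proof (rule \<epsilon>(2))
      show "\<bar>y k - pt2 0 0 k\<bar> < \<epsilon>" if "k < 2" for k
      proof -
        have "k = 0 \<or> k = 1" using that by linarith
        then show ?thesis using y by (auto simp: square2_def)
      qed
    qed (use y in \<open>simp add: square2_def\<close>)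
  qed
  define c where "c t s = chart_inv N i (P (pt2 t s))" for t s
  define C where "C y = chart_inv N i (P y)" for y
  have cC: "c (y 0) (y 1) = C y" for y by (simp add: c_def C_def P_def)
  have CV: "C y \<in> cdom N i" "chart N i (C y) = P y" if "y \<in> V" for y
    using that chart_inv_chart[OF N i(1)] by (auto simp: V_def C_def)
  have "smooth_map_on (euclidean 2) (square2 \<epsilon>) N C"
    unfolding smooth_map_on_def Let_def
  proof (intro conjI ballI allI impI)
    show "square2 \<epsilon> \<subseteq> mcarrier (euclidean 2)" by (auto simp: square2_def)
    show "C ` square2 \<epsilon> \<subseteq> mcarrier N"
      using subsetD[OF \<open>square2 \<epsilon> \<subseteq> V\<close>] CV(1) i(1) by (auto simp: in_mcarrier intro!: bexI[of _ i])
    fix u j assume j: "j \<in> idx N"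
    \<comment> \<open>For another chart \<open>j\<close> the domain is the preimage of the chart
      overlap under the polynomial map \<open>P\<close>, so openness and smoothness come from
      \<open>P\<close> and the transition.\<close>
    let ?W = "{y \<in> square2 \<epsilon>. P y \<in> chart N i ` (cdom N j \<inter> cdom N i)}"
    have eq: "chart (euclidean 2) u ` {y \<in> square2 \<epsilon> \<inter> cdom (euclidean 2) u. C y \<in> cdom N j} = ?W"
    proof -
      have "C y \<in> cdom N j \<longleftrightarrow> P y \<in> chart N i ` (cdom N j \<inter> cdom N i)" if "y \<in> square2 \<epsilon>" for y
        using that \<open>square2 \<epsilon> \<subseteq> V\<close> by (subst chart_image_iff[OF N i(1)]) (auto simp: V_def C_def)
      then show ?thesis by (auto simp: square2_def)
    qed
    have W: "eopen 2 ?W"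
      by (rule eopen_preimage[OF eopen_square2 eopen_chart_Int[OF N i(1) j] Cinf_on_continuous[OF Pc[OF eopen_square2]] PE])
    then show "eopen (mdim (euclidean 2)) (chart (euclidean 2) u ` {y \<in> square2 \<epsilon> \<inter> cdom (euclidean 2) u. C y \<in> cdom N j})"
      unfolding eq by simp
    fix k assume k: "k < mdim N"
    have "Cinf_on 2 ?W (\<lambda>y. chart N j (chart_inv N i (P y)) k)"
      by (rule Cinf_on_compose[OF transition_smooth[OF N i(1) j k] W Pc[OF W]]) auto
    then show "Cinf_on (mdim (euclidean 2)) (chart (euclidean 2) u ` {y \<in> square2 \<epsilon> \<inter> cdom (euclidean 2) u. C y \<in> cdom N j})
        (\<lambda>y. chart N j (C (chart_inv (euclidean 2) u y)) k)"
      unfolding eq euclidean_simps(1)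
      by (rule Cinf_on_cong) (auto simp: C_def chart_inv_euclidean square2_def)
  qed
  moreover have "velocity (TB N) (\<lambda>s. velocity N (\<lambda>t. c t s) 0) 0 = \<xi>"
  proof -
    have Cc: "Cinf_on 2 V (\<lambda>y. chart N i (C y) k)" for k
      by (rule Cinf_on_cong[OF Pc[OF V]]) (simp add: CV)
    have p: "partial 0 (\<lambda>y. chart N i (C y) k) y = v k + y 1 * z k"
      "partial 1 (\<lambda>y. chart N i (C y) k) y = w k + y 0 * z k" if "y \<in> V" for y k
    proof -
      have "partial a (\<lambda>y. chart N i (C y) k) y = partial a (\<lambda>y. P y k) y" if "a < 2" for a
        using \<open>y \<in> V\<close> that by (intro partial_cong[OF V]) (simp_all add: CV)
      moreover have "partial 0 (\<lambda>y. P y k) y = v k + y 1 * z k" "partial 1 (\<lambda>y. P y k) y = w k + y 0 * z k"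
        unfolding P_def by (rule partial_eqI, auto intro!: derivative_eq_intros)+
      ultimately show "partial 0 (\<lambda>y. chart N i (C y) k) y = v k + y 1 * z k"
        "partial 1 (\<lambda>y. chart N i (C y) k) y = w k + y 0 * z k" by simp_all
    qed
    have q: "partial 1 (partial 0 (\<lambda>y. chart N i (C y) k)) (pt2 0 0) = z k" for k
    proof -
      have "partial 1 (partial 0 (\<lambda>y. chart N i (C y) k)) (pt2 0 0) = partial 1 (\<lambda>y. v k + y 1 * z k) (pt2 0 0)"
        by (rule partial_cong[OF V V0]) (simp_all add: p)
      also have "\<dots> = z k" by (rule partial_eqI) (auto intro!: derivative_eq_intros)
      finally show ?thesis .
    qed
    note m = mixed_velocity_chart[OF N i(1) V V0 CV(1) Cc, of 0 1]
    have "C (pt2 t s) = c t s" for t s using cC[of "pt2 t s"] by simp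
    with m have "velocity (TB N) (\<lambda>s. velocity N (\<lambda>t. c t s) 0) 0 \<in> cdom (tan2 N) i"
      "chart (tan2 N) i (velocity (TB N) (\<lambda>s. velocity N (\<lambda>t. c t s) 0) 0) = X"
      using V0 CV(2)[OF V0] by (simp_all add: p[unfolded One_nat_def] p q[unfolded One_nat_def] X \<open>P (pt2 0 0) = x\<close>)
    then show ?thesis
      unfolding X_def by (intro chart_eqD[of "tan2 N" i, OF smooth_atlas_TB[OF smooth_atlas_TB[OF N]]] i(2)) (simp_all add: i)
  qed
  ultimately show ?thesis using that[OF \<epsilon>(1), of c] by (simp only: cC)
qed

text \<open>For uniqueness, each \<open>\<xi>\<close> in the carrier is \<partial>_s \<partial>_t c
  at the origin for some surface \<open>c\<close>, so the defining equation forces the value of any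
  competitor at \<open>\<xi>\<close>. Outside the carrier extensionality forces it.\<close>

lemma canonical_flip_eq:
  assumes N: "smooth_atlas N"
  shows "canonical_flip N = restrict (cflip N) (mcarrier (tan2 N))"
  unfolding canonical_flip_def square2_def[symmetric]
proof (rule the_equality, intro conjI allI impI)
  let ?r = "restrict (cflip N) (mcarrier (tan2 N))"
  show "?r \<in> extensional (mcarrier (tan2 N))" by simp
  show "diffeomorphism (tan2 N) (tan2 N) ?r" by (rule diffeomorphism_cflip[OF N])
  show "velocity (TB N) (\<lambda>t. velocity N (\<lambda>s. c t s) s) t =
      ?r (velocity (TB N) (\<lambda>s. velocity N (\<lambda>t. c t s) t) s)"
    if "smooth_map_on (euclidean 2) (square2 \<epsilon>) N (\<lambda>x. c (x 0) (x 1))" "\<bar>t\<bar> < \<epsilon> \<and> \<bar>s\<bar> < \<epsilon>" for \<epsilon> c t s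
    using mixed_velocity_flip[OF N that(1), of t s] that(2) by simp
next
  fix \<kappa> assume \<kappa>: "\<kappa> \<in> extensional (mcarrier (tan2 N)) \<and> diffeomorphism (tan2 N) (tan2 N) \<kappa> \<and>
    (\<forall>\<epsilon>>0. \<forall>c. smooth_map_on (euclidean 2) (square2 \<epsilon>) N (\<lambda>x. c (x 0) (x 1)) \<longrightarrow>
      (\<forall>t s. \<bar>t\<bar> < \<epsilon> \<and> \<bar>s\<bar> < \<epsilon> \<longrightarrow> velocity (TB N) (\<lambda>t. velocity N (\<lambda>s. c t s) s) t =
         \<kappa> (velocity (TB N) (\<lambda>s. velocity N (\<lambda>t. c t s) t) s)))"
  show "\<kappa> = restrict (cflip N) (mcarrier (tan2 N))"
  proof (rule extensionalityI)
    fix \<xi> assume \<xi>: "\<xi> \<in> mcarrier (tan2 N)"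
    then obtain \<epsilon> c where c: "\<epsilon> > 0" "smooth_map_on (euclidean 2) (square2 \<epsilon>) N (\<lambda>x. c (x 0) (x 1))"
      "velocity (TB N) (\<lambda>s. velocity N (\<lambda>t. c t s) 0) 0 = \<xi>"
      by (rule mixed_velocity_surj[OF N])
    have "\<kappa> \<xi> = velocity (TB N) (\<lambda>t. velocity N (\<lambda>s. c t s) 0) 0"
      using \<kappa>[THEN conjunct2, THEN conjunct2, rule_format, where c = c and t = 0 and s = 0, OF c(1,2)] c(1,3) by simp
    also have "\<dots> = cflip N \<xi>"
      using mixed_velocity_flip(1)[OF N c(2), of 0 0] c by simp
    finally show "\<kappa> \<xi> = restrict (cflip N) (mcarrier (tan2 N)) \<xi>" using \<xi> by simp
  qed (use \<kappa> in simp_all)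
qed

section \<open>Homogeneity in charts\<close>

text \<open>Fibre dilation in a bundle chart with \<open>m\<close> base coordinates. Coordinates
  beyond the total dimension are zero on the sets considered, so scaling them as well stays inside
  the Euclidean space.\<close>

definition sc :: "nat \<Rightarrow> real \<Rightarrow> (nat \<Rightarrow> real) \<Rightarrow> nat \<Rightarrow> real" where
  "sc m a X = (\<lambda>k. if k < m then X k else a * X k)"

text \<open>The exponent is real because the base components of an s-homogeneous field have degree s
  - 1, which is -1 for s = 0.\<close>

definition hom_on :: "nat \<Rightarrow> real \<Rightarrow> (nat \<Rightarrow> real) set \<Rightarrow> ((nat \<Rightarrow> real) \<Rightarrow> real) \<Rightarrow> bool" where
  "hom_on m c W h \<longleftrightarrow> (\<forall>X\<in>W. \<forall>a>0. h (sc m a X) = a powr c * h X)"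

lemma sc_euc: "X \<in> euc d \<Longrightarrow> sc m a X \<in> euc d"
  by (simp add: in_euc sc_def)

lemma sc_one [simp]: "sc m 1 X = X"
  by (simp add: sc_def fun_eq_iff)

lemma sc_join: "sc m a (join m x y) = join m x (\<lambda>k. a * y k)"
  by (auto simp: sc_def join_def)

text \<open>The dilation of TTN sends (x, v, w, z) to (x, v, a w, a z). After the swap its halves
  are (x, a w) and (v, a z), which is the tangent map of the dilation on TN. One factor thus acts on
  the evaluation point and on the direction alike, and homogeneity of the lifts rests on
  this.\<close>

lemma sflip_sc:
  "lo (2 * m) (sflip m (sc (2 * m) a X)) = sc m a (lo (2 * m) (sflip m X))"
  "hi (2 * m) (sflip m (sc (2 * m) a X)) = sc m a (hi (2 * m) (sflip m X))"
  by (auto simp: lo_def hi_def sc_def sflip_def bperm_def fun_eq_iff)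

text \<open>The coordinates below \<open>m\<close> are the base coordinates, so this is the Liouville field in a chart.\<close>

definition eul :: "nat \<Rightarrow> (nat \<Rightarrow> real) \<Rightarrow> nat \<Rightarrow> real" where
  "eul m X = (\<lambda>k. if k < m then 0 else X k)"

text \<open>Invariance of \<open>W\<close> under dilation keeps each ray inside the domain, and
  along a ray the derivative of \<open>h\<close> is expressed by the Euler operator. In one
  direction a rescaled \<open>h\<close> is constant along rays; in the other the homogeneity
  equation is differentiated at \<open>a = 1\<close>.\<close>

lemma euler_hom_on:
  assumes h: "Cinf_on d W h" and W: "\<And>X a. X \<in> W \<Longrightarrow> a > 0 \<Longrightarrow> sc m a X \<in> W"
  shows "(\<forall>X\<in>W. dirder d h X (eul m X) = c * h X) \<longleftrightarrow> hom_on m c W h"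
proof -
  have der: "((\<lambda>a. h (sc m a X)) has_real_derivative dirder d h (sc m a X) (eul m X)) (at a)"
    if "X \<in> W" "a > 0" for X a
    unfolding dirder_def
  proof (rule Cinf_on_chain_curve[where \<gamma> = "\<lambda>a. sc m a X" and t = a, OF h W[OF that]])
    have "X \<in> euc d" using that(1) eopen_subset[OF Cinf_on_open[OF h]] by blast
    then show "\<forall>\<^sub>F u in at a. sc m u X \<in> euc d" by (simp add: sc_euc)
    show "((\<lambda>u. sc m u X k) has_real_derivative eul m X k) (at a)" for k
      by (auto simp: sc_def eul_def intro!: derivative_eq_intros)
  qed
  show ?thesis
  proof
    assume e: "\<forall>X\<in>W. dirder d h X (eul m X) = c * h X"
    show "hom_on m c W h"
      unfolding hom_on_def
    proof (intro ballI allI impI)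
      fix X a assume X: "X \<in> W" and a: "(a::real) > 0"
      \<comment> \<open>Dividing out the expected power should leave a constant: the Euler relation
        makes this derivative vanish for every positive \<open>u\<close>.\<close>
      define \<psi> where "\<psi> u = u powr (- c) * h (sc m u X)" for u
      have "(\<psi> has_real_derivative 0) (at u)" if u: "u > 0" for u
      proof -
        have "eul m (sc m u X) = (\<lambda>k. u * eul m X k)" by (auto simp: eul_def sc_def)
        then have "u * dirder d h (sc m u X) (eul m X) = dirder d h (sc m u X) (eul m (sc m u X))"
          by (simp add: dirder_def sum_distrib_left mult_ac)
        also have "\<dots> = c * h (sc m u X)" using e W[OF X u] by blast
        finally have "dirder d h (sc m u X) (eul m X) = c * h (sc m u X) / u"
          using u by (simp add: field_simps)
        with der[OF X u] have "((\<lambda>a. h (sc m a X)) has_real_derivative c * h (sc m u X) / u) (at u)" by simp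
        from DERIV_mult[OF has_real_derivative_powr[OF u, of "- c"] this]
        show ?thesis
          unfolding \<psi>_def using u by (simp add: powr_diff)
      qed
      \<comment> \<open>The open interval from 0 to \<open>a + 2\<close> contains both
        \<open>a\<close> and \<open>1\<close>.\<close>
      then have "\<psi> a = \<psi> 1"
        using a by (intro DERIV_isconst3[of 0 "a + 2" a 1 \<psi>]) auto
      then show "h (sc m a X) = a powr c * h X"
        using a by (simp add: \<psi>_def powr_minus field_simps)
    qed
  next
    assume e: "hom_on m c W h"
    show "\<forall>X\<in>W. dirder d h X (eul m X) = c * h X"
    proof
      fix X assume X: "X \<in> W"
      have ev: "\<forall>\<^sub>F a in nhds (1::real). h (sc m a X) = a powr c * h X"
      proof -
        have "\<forall>\<^sub>F a in nhds (1::real). a \<in> {0<..}" by (intro eventually_nhds_in_open) auto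
        then show ?thesis by eventually_elim (use e X in \<open>auto simp: hom_on_def\<close>)
      qed
      have "((\<lambda>a. a powr c * h X) has_real_derivative c * h X) (at 1)"
        using DERIV_cmult_right[OF has_real_derivative_powr[of 1 c]] by simp
      then have "((\<lambda>a. h (sc m a X)) has_real_derivative c * h X) (at 1)"
        by (simp only: DERIV_cong_ev[OF refl ev refl])
      from DERIV_unique[OF der[OF X, of 1] this] show "dirder d h X (eul m X) = c * h X" by simp
    qed
  qed
qed

text \<open>Partials of \<open>h\<close> in base directions have degree c and those in fibre
  directions degree c - 1. The dilated direction \<open>sc m a V\<close> supplies the missing factor
  \<open>a\<close> in exactly the fibre slots.\<close>

lemma dirder_hom_on:
  assumes h: "Cinf_on d W h" and W: "\<And>X a. X \<in> W \<Longrightarrow> a > 0 \<Longrightarrow> sc m a X \<in> W"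
    and hom: "hom_on m c W h" and Z: "Z \<in> W" and a: "a > 0"
  shows "dirder d h (sc m a Z) (sc m a V) = a powr c * dirder d h Z V"
proof -
  have "partial l h (sc m a Z) * sc m a V l = a powr c * (partial l h Z * V l)" if l: "l < d" for l
  proof -
    \<comment> \<open>The factor by which the dilation stretches coordinate \<open>l\<close>;
      setting that coordinate to \<open>t\<close> before dilating is setting it to
      \<open>b * t\<close> afterwards.\<close>
    define b where "b = (if l < m then 1 else a)"
    have upd: "sc m a (Z(l := t)) = (sc m a Z)(l := b * t)" for t
      by (auto simp: sc_def b_def)
    have bZ: "b * Z l = sc m a Z l" by (simp add: b_def sc_def)
    have "((\<lambda>t. h ((sc m a Z)(l := b * t))) has_real_derivative partial l h (sc m a Z) * b) (at (Z l))"
    proof (rule DERIV_chain2[where g = "\<lambda>t. b * t"])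
      show "((\<lambda>s. h ((sc m a Z)(l := s))) has_real_derivative partial l h (sc m a Z)) (at (b * Z l))"
        unfolding bZ by (rule Cinf_on_has_partial[OF h W[OF Z a] l])
    qed (auto intro!: derivative_eq_intros)
    moreover have "((\<lambda>t. a powr c * h (Z(l := t))) has_real_derivative a powr c * partial l h Z) (at (Z l))"
      by (rule DERIV_cmult[OF Cinf_on_has_partial[OF h Z l]])
    moreover have "\<forall>\<^sub>F t in nhds (Z l). h ((sc m a Z)(l := b * t)) = a powr c * h (Z(l := t))"
      using eopen_eventually_upd[OF Cinf_on_open[OF h] Z l]
      by eventually_elim (use hom a in \<open>simp add: hom_on_def upd[symmetric]\<close>)
    ultimately have "partial l h (sc m a Z) * b = a powr c * partial l h Z"
      using DERIV_unique by (simp only: DERIV_cong_ev[OF refl _ refl])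
    moreover have "sc m a V l = b * V l" by (simp add: sc_def b_def)
    ultimately show ?thesis by (simp add: mult_ac)
  qed
  then show ?thesis by (simp add: dirder_def sum_distrib_left)
qed

section \<open>Fibre scaling and the Liouville field\<close>

lemma foot_tscale [simp]: "foot (tscale a \<xi>) = foot \<xi>"
  by (simp add: tscale_def)

lemma tscale_chart:
  assumes N: "smooth_atlas N" and i: "i \<in> idx N" and \<xi>: "\<xi> \<in> cdom (TB N) i"
  shows "tscale a \<xi> \<in> cdom (TB N) i"
    "chart (TB N) i (tscale a \<xi>) = sc (mdim N) a (chart (TB N) i \<xi>)"
proof -
  show c: "tscale a \<xi> \<in> cdom (TB N) i"
    using \<xi> tangent_space_linear[of "comp \<xi>" N "foot \<xi>" "comp \<xi>" a 0] by (auto simp: cdom_TB tscale_def)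
  show "chart (TB N) i (tscale a \<xi>) = sc (mdim N) a (chart (TB N) i \<xi>)"
    using chart_TB[OF N i c] chart_TB[OF N i \<xi>] by (simp add: sc_join) (simp add: tscale_def)
qed

lemma tadd_tscale_chart:
  assumes N: "smooth_atlas N" and i: "i \<in> idx N" and \<xi>: "\<xi> \<in> cdom (TB N) i"
    and \<eta>: "\<eta> \<in> cdom (TB N) i" "foot \<eta> = foot \<xi>"
  shows "tadd \<xi> (tscale a \<eta>) \<in> cdom (TB N) i"
    "chart (TB N) i (tadd \<xi> (tscale a \<eta>)) =
      join (mdim N) (chart N i (foot \<xi>)) (\<lambda>k. comp \<xi> i k + a * comp \<eta> i k)"
proof -
  show c: "tadd \<xi> (tscale a \<eta>) \<in> cdom (TB N) i"
    using \<xi> \<eta> tangent_space_linear[of "comp \<xi>" N "foot \<xi>" "comp \<eta>" 1 a] by (simp add: cdom_TB tadd_def tscale_def)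
  show "chart (TB N) i (tadd \<xi> (tscale a \<eta>)) =
      join (mdim N) (chart N i (foot \<xi>)) (\<lambda>k. comp \<xi> i k + a * comp \<eta> i k)"
    using chart_TB[OF N i c] by (simp add: tadd_def tscale_def)
qed

lemma tadd_tscale_zero: "\<xi> \<in> cdom (TB N) i \<Longrightarrow> tadd \<xi> (tscale 0 \<eta>) = \<xi>"
  by (simp add: cdom_TB tadd_def tscale_def)

text \<open>The curve is affine within one fibre, so only fibre coordinates move. Taking
  \<open>\<eta>\<close> equal to \<open>\<xi>\<close> computes the Liouville field; taking it to be
  a value of the field \<open>A\<close> computes the vector to which the vertical lift applies the
  tangent map of the flip.\<close>

lemma vertical_velocity_chart:
  assumes N: "smooth_atlas N" and i: "i \<in> idx N" and \<xi>: "\<xi> \<in> cdom (TB N) i"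
    and \<eta>: "\<eta> \<in> cdom (TB N) i" "foot \<eta> = foot \<xi>"
  defines "V \<equiv> velocity (TB N) (\<lambda>\<sigma>. tadd \<xi> (tscale \<sigma> \<eta>)) 0"
  shows "V \<in> cdom (tan2 N) i" "foot V = \<xi>"
    "chart (tan2 N) i V = join (2 * mdim N) (chart (TB N) i \<xi>) (join (mdim N) (\<lambda>k. 0) (comp \<eta> i))"
    "comp V i = join (mdim N) (\<lambda>k. 0) (comp \<eta> i)"
proof -
  note T = smooth_atlas_TB[OF N]
  have i': "i \<in> idx (TB N)" using i by simp
  have ev: "\<forall>\<^sub>F \<sigma> in nhds 0. tadd \<xi> (tscale \<sigma> \<eta>) \<in> cdom (TB N) i"
    using tadd_tscale_chart(1)[OF N i \<xi> \<eta>] by simp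
  have d: "((\<lambda>\<sigma>. chart (TB N) i (tadd \<xi> (tscale \<sigma> \<eta>)) k) has_real_derivative
      join (mdim N) (\<lambda>k. 0) (comp \<eta> i) k) (at 0)" for k
    unfolding tadd_tscale_chart(2)[OF N i \<xi> \<eta>]
    by (auto simp: join_def intro!: derivative_eq_intros)
  note vc = velocity_chart[OF T i' ev d, folded V_def, unfolded tadd_tscale_zero[OF \<xi>] mdim_TB]
  show V: "V \<in> cdom (tan2 N) i" using vc(1) .
  show "foot V = \<xi>" by (simp add: V_def tadd_tscale_zero[OF \<xi>])
  show c: "chart (tan2 N) i V = join (2 * mdim N) (chart (TB N) i \<xi>) (join (mdim N) (\<lambda>k. 0) (comp \<eta> i))"
    using vc(2) .
  show "comp V i = join (mdim N) (\<lambda>k. 0) (comp \<eta> i)"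
    using chart_TB_lo_hi(3)[OF T i' V] by (simp add: c hi_join_lo lo_id)
qed

lemma comp_rep:
  assumes N: "smooth_atlas N" and A: "vector_field_on N U A" and i: "i \<in> idx N" and p: "p \<in> U" "p \<in> cdom N i"
    and k: "k < mdim N"
  shows "comp (A p) i k = rep N (TB N) A i (chart N i p) (mdim N + k)"
proof -
  have "A p \<in> cdom (TB N) i"
    by (rule cw_smoothD(4)[OF vector_field_cw_smooth[OF N A] i p])
  from chart_TB_lo_hi(3)[OF N i this] k show ?thesis
    by (auto simp: rep_chart[OF N i p(2)] hi_def fun_eq_iff dest: spec[of _ k])
qed

text \<open>In bundle coordinates (x, y) the Liouville field is y^k \<partial>/\<partial>y^k, so
  component k of the bracket is L(A^k), less A^k when k is a fibre index. Hence the eigenvalue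
  equation demands degree s - 1 in base slots and s in fibre slots, and Euler's relation applies
  slot by slot. \<open>L\<close> is a variable because \<open>liouville\<close> is tied to iterated
  bundles while \<open>N\<close> is arbitrary.\<close>

lemma field_homogeneous_iff:
  fixes s :: real
  assumes N: "smooth_atlas N" and A: "vector_field_on (TB N) U A"
    and U: "\<And>\<xi> a. \<xi> \<in> U \<Longrightarrow> a > 0 \<Longrightarrow> tscale a \<xi> \<in> U"
    and L: "\<And>\<xi>. L \<xi> = velocity (TB N) (\<lambda>\<sigma>. tadd \<xi> (tscale \<sigma> \<xi>)) 0"
  shows "(\<forall>\<xi>\<in>U. lie_bracket (TB N) L A \<xi> = tscale (s - 1) (A \<xi>)) \<longleftrightarrow>
    (\<forall>i\<in>idx N. \<forall>k<2 * mdim N. hom_on (mdim N) (if k < mdim N then s - 1 else s)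
       (chart (TB N) i ` (U \<inter> cdom (TB N) i))
       (\<lambda>X. rep (TB N) (tan2 N) A i X (2 * mdim N + k)))"
proof -
  let ?T = "TB N" and ?m = "mdim N"
  let ?W = "\<lambda>i. chart ?T i ` (U \<inter> cdom ?T i)" and ?a = "\<lambda>i X k. rep ?T (tan2 N) A i X (2 * ?m + k)"
  note T = smooth_atlas_TB[OF N]
  note cw = vector_field_cw_smooth[OF T A]
  have UT: "U \<subseteq> mcarrier ?T" by (rule cw_smoothD(2)[OF cw])
  have idx: "idx ?T = idx N" by simp
  have sub: "?W i \<subseteq> euc (2 * ?m)" if "i \<in> idx N" for i
    using eopen_subset[OF cw_smoothD(3)[OF cw, unfolded idx, OF that]] by simp
  have W: "sc ?m a X \<in> ?W i" if i: "i \<in> idx N" and X: "X \<in> ?W i" "a > 0" for i X a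
  proof -
    obtain \<xi> where \<xi>: "\<xi> \<in> U" "\<xi> \<in> cdom ?T i" "X = chart ?T i \<xi>" using X(1) by auto
    show ?thesis
      using tscale_chart[OF N i \<xi>(2), of a] U[OF \<xi>(1) X(2)] by (intro image_eqI[where x = "tscale a \<xi>"]) (auto simp: \<xi>(3))
  qed
  have Ca: "Cinf_on (2 * ?m) (?W i) (\<lambda>X. ?a i X k)" if "i \<in> idx N" "k < 2 * ?m" for i k
    using cw_smoothD(5)[OF cw, of i "2 * ?m + k"] that by simp
  have compL: "comp (L \<xi>) i k = eul ?m (chart ?T i \<xi>) k" if i: "i \<in> idx N" "\<xi> \<in> cdom ?T i" and k: "k < 2 * ?m" for i \<xi> k
    using vertical_velocity_chart(4)[OF N i i(2) refl] chart_TB[OF N i] k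
    by (simp add: L eul_def join_def)
  have br: "comp (lie_bracket ?T L A \<xi>) i k =
      dirder (2 * ?m) (\<lambda>X. ?a i X k) (chart ?T i \<xi>) (eul ?m (chart ?T i \<xi>)) - (if k < ?m then 0 else ?a i (chart ?T i \<xi>) k)"
    if i: "i \<in> idx N" and \<xi>: "\<xi> \<in> U" "\<xi> \<in> cdom ?T i" and k: "k < 2 * ?m" for i \<xi> k
  proof -
    let ?X = "chart ?T i \<xi>"
    have i': "i \<in> idx ?T" using i by simp
    have X: "?X \<in> ?W i" using \<xi> by simp
    have op: "eopen (2 * ?m) (?W i)" using cw_smoothD(3)[OF cw i'] by simp
    have pA: "partial l (\<lambda>x. comp (A (chart_inv ?T i x)) i k) ?X = partial l (\<lambda>X. ?a i X k) ?X" if "l < 2 * ?m" for l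
    proof (rule partial_cong[OF op X that])
      fix Y assume "Y \<in> ?W i"
      then obtain \<eta> where "\<eta> \<in> U" "\<eta> \<in> cdom ?T i" "Y = chart ?T i \<eta>" by auto
      then show "comp (A (chart_inv ?T i Y)) i k = ?a i Y k"
        using comp_rep[OF T A i', of \<eta> k] k by (simp add: chart_inv_chart[OF T i'])
    qed
    have pL: "partial l (\<lambda>x. comp (L (chart_inv ?T i x)) i k) ?X = (if k < ?m then 0 else if k = l then 1 else 0)"
      if "l < 2 * ?m" for l
    proof -
      have "partial l (\<lambda>x. comp (L (chart_inv ?T i x)) i k) ?X = partial l (\<lambda>Y. eul ?m Y k) ?X"
      proof (rule partial_cong[OF op X that])
        fix Y assume "Y \<in> ?W i"
        then obtain \<eta> where "\<eta> \<in> U" "\<eta> \<in> cdom ?T i" "Y = chart ?T i \<eta>" by auto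
        then show "comp (L (chart_inv ?T i Y)) i k = eul ?m Y k"
          using compL[OF i _ k, of \<eta>] by (simp add: chart_inv_chart[OF T i'])
      qed
      then show ?thesis by (simp add: eul_def partial_coord)
    qed
    have "comp (lie_bracket ?T L A \<xi>) i k = (\<Sum>l<2 * ?m. comp (L \<xi>) i l * partial l (\<lambda>x. comp (A (chart_inv ?T i x)) i k) ?X -
        comp (A \<xi>) i l * partial l (\<lambda>x. comp (L (chart_inv ?T i x)) i k) ?X)"
      using i \<xi> k by (simp add: lie_bracket_def)
    also have "\<dots> = (\<Sum>l<2 * ?m. partial l (\<lambda>X. ?a i X k) ?X * eul ?m ?X l - (if k = l then (if k < ?m then 0 else ?a i ?X k) else 0))"
      using comp_rep[OF T A i' \<xi>] by (intro sum.cong refl) (simp add: compL[OF i \<xi>(2)] pA pL)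
    also have "\<dots> = dirder (2 * ?m) (\<lambda>X. ?a i X k) ?X (eul ?m ?X) - (if k < ?m then 0 else ?a i ?X k)"
      using k by (simp add: sum_subtractf dirder_def)
    finally show ?thesis .
  qed
  have pt: "lie_bracket ?T L A \<xi> = tscale (s - 1) (A \<xi>) \<longleftrightarrow>
      (\<forall>i\<in>idx N. \<xi> \<in> cdom ?T i \<longrightarrow> (\<forall>k<2 * ?m. dirder (2 * ?m) (\<lambda>X. ?a i X k) (chart ?T i \<xi>) (eul ?m (chart ?T i \<xi>)) =
         (if k < ?m then s - 1 else s) * ?a i (chart ?T i \<xi>) k))" (is "_ \<longleftrightarrow> ?R") if \<xi>: "\<xi> \<in> U" for \<xi>
  proof -
    have f: "foot (A \<xi>) = \<xi>" using A \<xi> by (simp add: vector_field_on_def)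
    have A\<xi>: "comp (A \<xi>) \<in> tangent_space ?T \<xi>"
      using cw_smooth_mcarrier[OF cw \<xi>] f by (simp add: mcarrier_TB)
    \<comment> \<open>Away from the charts around \<open>\<xi>\<close> and beyond the dimension both
      sides vanish, so equality of tangent vectors is equality of finitely many components per
      chart.\<close>
    have out: "comp (A \<xi>) i k = 0" if "\<not> (i \<in> idx N \<and> \<xi> \<in> cdom ?T i \<and> k < 2 * ?m)" for i k
      using tangent_space_outside[OF A\<xi>, of i k] tangent_space_euc[OF A\<xi>, of i] that
      unfolding in_euc idx mdim_TB by (metis linorder_not_le)
    have out': "comp (lie_bracket ?T L A \<xi>) i k = 0" if "\<not> (i \<in> idx N \<and> \<xi> \<in> cdom ?T i \<and> k < 2 * ?m)" for i k
      using that by (auto simp: lie_bracket_def)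
    have "lie_bracket ?T L A \<xi> = tscale (s - 1) (A \<xi>) \<longleftrightarrow>
        (\<forall>i k. comp (lie_bracket ?T L A \<xi>) i k = (s - 1) * comp (A \<xi>) i k)"
      by (simp add: lie_bracket_def tscale_def f fun_eq_iff)
    also have "\<dots> \<longleftrightarrow> (\<forall>i\<in>idx N. \<xi> \<in> cdom ?T i \<longrightarrow> (\<forall>k<2 * ?m. comp (lie_bracket ?T L A \<xi>) i k = (s - 1) * comp (A \<xi>) i k))"
      using out out' by (metis mult_zero_right)
    also have "\<dots> \<longleftrightarrow> ?R"
    proof (intro ball_cong refl imp_cong all_cong)
      fix i k assume i: "i \<in> idx N" and \<xi>i: "\<xi> \<in> cdom ?T i" and k: "k < 2 * ?m"
      have "comp (A \<xi>) i k = ?a i (chart ?T i \<xi>) k"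
        using comp_rep[OF T A _ \<xi> \<xi>i, of k] i k by simp
      then show "comp (lie_bracket ?T L A \<xi>) i k = (s - 1) * comp (A \<xi>) i k \<longleftrightarrow>
          dirder (2 * ?m) (\<lambda>X. ?a i X k) (chart ?T i \<xi>) (eul ?m (chart ?T i \<xi>)) =
         (if k < ?m then s - 1 else s) * ?a i (chart ?T i \<xi>) k"
        unfolding br[OF i \<xi> \<xi>i k] by (auto simp: algebra_simps)
    qed
    finally show ?thesis .
  qed
  have "(\<forall>\<xi>\<in>U. lie_bracket ?T L A \<xi> = tscale (s - 1) (A \<xi>)) \<longleftrightarrow>
    (\<forall>i\<in>idx N. \<forall>k<2 * ?m. \<forall>X\<in>?W i. dirder (2 * ?m) (\<lambda>X. ?a i X k) X (eul ?m X) = (if k < ?m then s - 1 else s) * ?a i X k)"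
    using pt by auto
  also have "\<dots> \<longleftrightarrow> (\<forall>i\<in>idx N. \<forall>k<2 * ?m. hom_on ?m (if k < ?m then s - 1 else s) (?W i) (\<lambda>X. ?a i X k))"
    by (intro ball_cong refl all_cong euler_hom_on Ca W) auto
  finally show ?thesis .
qed

section \<open>Iterated tangent bundles and their slashed subsets\<close>

lemma base_manifold_simps [simp]:
  "mdim (base_manifold M) = mdim M" "idx (base_manifold M) = idx M" "cdom (base_manifold M) i = Base ` cdom M i"
  by (simp_all add: base_manifold_def)

lemma smooth_atlas_base:
  assumes M: "smooth_atlas M" shows "smooth_atlas (base_manifold M)"
proof -
  let ?B = "base_manifold M"
  have im: "chart ?B i ` (Base ` S) = chart M i ` S" for i S
    by (force simp: base_manifold_def)
  have inj: "inj_on (chart ?B i) (Base ` cdom M i)" if "i \<in> idx M" for i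
    using smooth_atlas_inj[OF M that] by (auto simp: base_manifold_def inj_on_def)
  have int: "Base ` cdom M i \<inter> Base ` cdom M j = Base ` (cdom M i \<inter> cdom M j)" for i j
    by auto
  have inv: "chart ?B j (chart_inv ?B i x) = chart M j (chart_inv M i x)"
    if i: "i \<in> idx M" and x: "x \<in> chart M i ` (cdom M i \<inter> cdom M j)" for i j x
  proof -
    obtain p where p: "p \<in> cdom M i" "x = chart M i p" using x by auto
    have "chart_inv ?B i x = Base p"
      using inv_into_f_f[OF inj[OF i], of "Base p"] p by (simp add: chart_inv_def base_manifold_def)
    then show ?thesis using p chart_inv_chart[OF M i p(1)] by (simp add: base_manifold_def)
  qed
  show ?thesis
    unfolding smooth_atlas_def base_manifold_simps int im
  proof (intro conjI ballI allI impI)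
    fix i j k assume i: "i \<in> idx M" and j: "j \<in> idx M" and k: "k < mdim M"
    have "Cinf_on (mdim M) (chart M i ` (cdom M i \<inter> cdom M j)) (\<lambda>x. chart M j (chart_inv M i x) k)"
      using M i j k by (simp add: smooth_atlas_def)
    then show "Cinf_on (mdim M) (chart M i ` (cdom M i \<inter> cdom M j)) (\<lambda>x. chart ?B j (chart_inv ?B i x) k)"
      by (rule Cinf_on_cong) (simp add: inv[OF i])
  qed (use M inj in \<open>auto simp: smooth_atlas_def\<close>)
qed

lemma smooth_atlas_iter_tangent: "smooth_atlas M \<Longrightarrow> smooth_atlas (iter_tangent M r)"
  by (induction r) (simp_all add: smooth_atlas_base smooth_atlas_TB)

lemma idx_iter_tangent [simp]: "idx (iter_tangent M r) = idx M"
  by (induction r) simp_all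

lemma mdim_iter_tangent_ge: "mdim M \<le> mdim (iter_tangent M r)"
  by (induction r) simp_all

text \<open>Each projection keeps the base block, so in charts of equal index the iterate keeps the
  leading \<open>mdim M\<close> coordinates. This is what allows its tangent map to be computed in
  \<open>slashed_iff\<close>.\<close>

lemma iter_foot:
  assumes M: "smooth_atlas M"
  shows "cw_smooth (iter_tangent M q) (mcarrier (iter_tangent M q)) (base_manifold M) (foot ^^ q) \<and>
    (\<forall>i\<in>idx M. \<forall>\<xi>\<in>cdom (iter_tangent M q) i. chart (base_manifold M) i ((foot ^^ q) \<xi>) = lo (mdim M) (chart (iter_tangent M q) i \<xi>))"
proof (induction q)
  case 0
  note B = smooth_atlas_base[OF M]
  have im: "mcarrier (base_manifold M) \<inter> Base ` cdom M i = Base ` cdom M i" if "i \<in> idx M" for i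
    using that by (auto simp: in_mcarrier intro!: bexI[of _ i])
  have op: "eopen (mdim M) (chart (base_manifold M) i ` (Base ` cdom M i))" if "i \<in> idx M" for i
    using eopen_chart[OF B, of i] that by simp
  have "cw_smooth (base_manifold M) (mcarrier (base_manifold M)) (base_manifold M) (\<lambda>p. p)"
  proof (rule cw_smoothI)
    fix i k assume "i \<in> idx (base_manifold M)"
    then have i: "i \<in> idx M" by simp
    show "eopen (mdim (base_manifold M)) (chart (base_manifold M) i ` (mcarrier (base_manifold M) \<inter> cdom (base_manifold M) i))"
      using op[OF i] im[OF i] by simp
    show "Cinf_on (mdim (base_manifold M)) (chart (base_manifold M) i ` (mcarrier (base_manifold M) \<inter> cdom (base_manifold M) i))
       (\<lambda>x. rep (base_manifold M) (base_manifold M) (\<lambda>p. p) i x k)"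
      unfolding base_manifold_simps im[OF i]
      by (rule Cinf_on_cong[OF Cinf_on_coord[OF op[OF i], of k]]) (use i in \<open>auto simp: rep_chart[OF B]\<close>)
  qed simp_all
  moreover have "chart (base_manifold M) i \<xi> = lo (mdim M) (chart (base_manifold M) i \<xi>)"
    if "i \<in> idx M" "\<xi> \<in> cdom (base_manifold M) i" for i \<xi>
    using chart_euc[OF B _ that(2)] that(1) lo_id by simp
  ultimately show ?case by (simp add: id_def)
next
  case (Suc q)
  note S = smooth_atlas_iter_tangent[OF M, of q]
  have e: "(foot ^^ Suc q) \<xi> = (foot ^^ q) (foot \<xi>)" for \<xi> :: "('a, 'b) tpoint"
    by (simp only: funpow_Suc_right comp_apply)
  have "cw_smooth (iter_tangent M (Suc q)) (mcarrier (iter_tangent M (Suc q))) (base_manifold M) (\<lambda>\<xi>. (foot ^^ q) (foot \<xi>))"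
    using cw_smooth_compose[OF smooth_atlas_TB[OF S] S cw_smooth_foot(1)[OF S] Suc.IH[THEN conjunct1]]
    by (simp add: mcarrier_TB)
  moreover have "chart (base_manifold M) i ((foot ^^ q) (foot \<xi>)) = lo (mdim M) (chart (iter_tangent M (Suc q)) i \<xi>)"
    if i: "i \<in> idx M" and \<xi>: "\<xi> \<in> cdom (iter_tangent M (Suc q)) i" for i \<xi>
  proof -
    have "foot \<xi> \<in> cdom (iter_tangent M q) i" using \<xi> by (simp add: cdom_TB)
    then have "chart (base_manifold M) i ((foot ^^ q) (foot \<xi>)) = lo (mdim M) (chart (iter_tangent M q) i (foot \<xi>))"
      using Suc.IH i by blast
    also have "chart (iter_tangent M q) i (foot \<xi>) = lo (mdim (iter_tangent M q)) (chart (iter_tangent M (Suc q)) i \<xi>)"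
      using chart_TB_lo_hi(2)[OF S] i \<xi> by simp
    also have "lo (mdim M) \<dots> = lo (mdim M) (chart (iter_tangent M (Suc q)) i \<xi>)"
      using mdim_iter_tangent_ge[of M q] by (intro lo_cong) (simp add: lo_def)
    finally show ?thesis .
  qed
  ultimately show ?case unfolding e[abs_def] by simp
qed

lemma slashed_TM_iff:
  assumes M: "smooth_atlas M" and i: "i \<in> idx M" and \<xi>: "\<xi> \<in> cdom (TB (base_manifold M)) i"
  shows "\<xi> \<in> slashed_TM M \<longleftrightarrow> (\<exists>k<mdim M. comp \<xi> i k \<noteq> 0)"
proof -
  let ?B = "base_manifold M"
  have c: "\<xi> \<in> mcarrier (tangent_bundle ?B)" using i \<xi> by (auto simp: in_mcarrier)
  have v: "comp \<xi> \<in> tangent_space ?B (foot \<xi>)" "foot \<xi> \<in> cdom ?B i" using \<xi> by (simp_all add: cdom_TB)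
  have "comp \<xi> = (\<lambda>i k. 0)" if z: "\<forall>k<mdim M. comp \<xi> i k = 0"
  proof -
    have "tvec ?B i (foot \<xi>) (comp \<xi> i) = (\<lambda>i k. 0)"
      using z by (auto simp: tvec_def dirder_def fun_eq_iff)
    then show ?thesis using tangent_space_tvec[OF v(1) _ v(2)] i by simp
  qed
  then show ?thesis using c by (auto simp: slashed_TM_def)
qed

lemma slashed_mcarrier: "slashed M (Suc q) \<subseteq> mcarrier (iter_tangent M (Suc q))"
  by (auto simp: slashed_def slashed_TM_def)

text \<open>The iterated projection keeps leading coordinates, hence its tangent map keeps the
  leading fibre components. Nonvanishing of the projected vector can be tested in any one chart, by
  the transformation law. For \<open>q = 0\<close> the set is \<open>slashed_TM\<close> itself,
  without a tangent map.\<close>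

lemma slashed_iff:
  assumes M: "smooth_atlas M" and i: "i \<in> idx M" and \<xi>: "\<xi> \<in> cdom (iter_tangent M (Suc q)) i"
  shows "\<xi> \<in> slashed M (Suc q) \<longleftrightarrow> (\<exists>k<mdim M. comp \<xi> i k \<noteq> 0)"
proof (cases "q = 0")
  case True
  then show ?thesis using slashed_TM_iff[OF M i] \<xi> by (simp add: slashed_def)
next
  case False
  let ?N = "iter_tangent M q" and ?B = "base_manifold M"
  note S = smooth_atlas_iter_tangent[OF M, of q] and B = smooth_atlas_base[OF M]
  have i': "i \<in> idx ?N" using i by simp
  have \<xi>': "\<xi> \<in> cdom (tangent_bundle ?N) i" using \<xi> by simp
  have fc: "foot \<xi> \<in> mcarrier ?N" using \<xi>' i' by (auto simp: in_mcarrier cdom_TB)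
  note F = iter_foot[OF M, of q, THEN conjunct1]
  let ?\<eta> = "tangent_map ?N ?B (foot ^^ q) \<xi>" and ?X = "chart (tangent_bundle ?N) i \<xi>"
  note tm = tangent_map_chart[OF S B F i' \<xi>' fc]
  have \<eta>: "comp ?\<eta> i = hi (mdim M) (tlift (mdim ?N) (mdim M) (rep ?N ?B (foot ^^ q) i) ?X)"
    using chart_TB_lo_hi(3)[OF B _ tm(1)] i by (simp add: tm(2))
  have "comp ?\<eta> i k = comp \<xi> i k" if k: "k < mdim M" for k
  proof -
    have k': "k < mdim ?N" using k mdim_iter_tangent_ge[of M q] by simp
    have x: "lo (mdim ?N) ?X \<in> chart ?N i ` cdom ?N i"
      using chart_TB_lo_hi(2)[OF S i' \<xi>'] \<xi>' by (simp add: cdom_TB)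
    have "comp ?\<eta> i k = dirder (mdim ?N) (\<lambda>x. rep ?N ?B (foot ^^ q) i x k) (lo (mdim ?N) ?X) (hi (mdim ?N) ?X)"
      using k by (simp add: \<eta> tlift_def hi_join)
    also have "\<dots> = dirder (mdim ?N) (\<lambda>x. x k) (lo (mdim ?N) ?X) (hi (mdim ?N) ?X)"
    proof (rule dirder_cong[OF eopen_chart[OF S i'] x])
      fix y assume "y \<in> chart ?N i ` cdom ?N i"
      then show "rep ?N ?B (foot ^^ q) i y k = y k"
        using iter_foot[OF M, of q, THEN conjunct2] i k by (auto simp: rep_chart[OF S i'] lo_def)
    qed simp
    finally show ?thesis using k' chart_TB_lo_hi(3)[OF S i' \<xi>'] by (simp add: dirder_coord)
  qed
  then have "(\<exists>k<mdim M. comp ?\<eta> i k \<noteq> 0) \<longleftrightarrow> (\<exists>k<mdim M. comp \<xi> i k \<noteq> 0)" by auto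
  moreover have "\<xi> \<in> mcarrier (iter_tangent M (Suc q))" using \<xi> i by (auto simp: in_mcarrier)
  moreover have "\<not> Suc q \<le> 1" using False by simp
  ultimately show ?thesis
    using slashed_TM_iff[OF M i tm(1)] by (simp add: slashed_def)
qed

lemma eopen_slashed:
  assumes M: "smooth_atlas M" and i: "i \<in> idx M"
  shows "eopen (mdim (iter_tangent M (Suc q))) (chart (iter_tangent M (Suc q)) i ` (slashed M (Suc q) \<inter> cdom (iter_tangent M (Suc q)) i))"
    (is "eopen ?d ?W")
proof (rule eopenI)
  let ?N = "iter_tangent M q" and ?T = "iter_tangent M (Suc q)"
  note S = smooth_atlas_iter_tangent[OF M, of q] and T = smooth_atlas_iter_tangent[OF M, of "Suc q"]
  have i': "i \<in> idx ?N" "i \<in> idx ?T" using i by simp_all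
  show "?W \<subseteq> euc ?d" using chart_euc[OF T i'(2)] by auto
  have iff: "chart ?T i \<xi> \<in> ?W \<longleftrightarrow> (\<exists>k<mdim M. chart ?T i \<xi> (mdim ?N + k) \<noteq> 0)" if \<xi>: "\<xi> \<in> cdom ?T i" for \<xi>
  proof -
    have "chart ?T i \<xi> \<in> ?W \<longleftrightarrow> \<xi> \<in> slashed M (Suc q)"
      using chart_eqD[OF T i'(2)] \<xi> by auto
    moreover have "comp \<xi> i k = chart ?T i \<xi> (mdim ?N + k)" if "k < mdim M" for k
      using chart_TB[OF S i'(1)] \<xi> that mdim_iter_tangent_ge[of M q] by (simp add: join_def)
    ultimately show ?thesis using slashed_iff[OF M i \<xi>] by auto
  qed
  fix a assume a: "a \<in> ?W"
  then obtain \<xi> where \<xi>: "\<xi> \<in> cdom ?T i" "a = chart ?T i \<xi>" by auto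
  then obtain k where k: "k < mdim M" "a (mdim ?N + k) \<noteq> 0" using iff[OF \<xi>(1)] a by auto
  have kd: "mdim ?N + k < ?d" using k(1) mdim_iter_tangent_ge[of M q] by simp
  \<comment> \<open>A box whose radius is the modulus of a nonzero coordinate of its centre contains
    no point where that coordinate vanishes.\<close>
  let ?V = "{x \<in> euc ?d. \<forall>l<?d. \<bar>x l - a l\<bar> < \<bar>a (mdim ?N + k)\<bar>} \<inter> chart ?T i ` cdom ?T i"
  have "eopen ?d ?V" by (intro openin_Int box_eopen eopen_chart T i')
  moreover have "a \<in> ?V" using a k(2) \<xi> chart_euc[OF T i'(2) \<xi>(1)] by auto
  moreover have "?V \<subseteq> ?W"
  proof
    fix x assume x: "x \<in> ?V"
    then obtain \<eta> where \<eta>: "\<eta> \<in> cdom ?T i" "x = chart ?T i \<eta>" by auto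
    have "\<bar>x (mdim ?N + k) - a (mdim ?N + k)\<bar> < \<bar>a (mdim ?N + k)\<bar>" using x kd by blast
    then have "x (mdim ?N + k) \<noteq> 0" by auto
    then show "x \<in> ?W" using iff[OF \<eta>(1)] k(1) \<eta>(2) by blast
  qed
  ultimately show "\<exists>V. eopen ?d V \<and> a \<in> V \<and> V \<subseteq> ?W" by blast
qed

lemma slashed_tscale:
  assumes M: "smooth_atlas M" and \<xi>: "\<xi> \<in> slashed M (Suc q)" and a: "a > 0"
  shows "tscale a \<xi> \<in> slashed M (Suc q)"
proof -
  obtain i where i: "i \<in> idx M" "\<xi> \<in> cdom (iter_tangent M (Suc q)) i"
    using subsetD[OF slashed_mcarrier \<xi>] by (auto simp: in_mcarrier)
  have "tscale a \<xi> \<in> cdom (iter_tangent M (Suc q)) i"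
    using tscale_chart(1)[OF smooth_atlas_iter_tangent[OF M, of q]] i by simp
  from slashed_iff[OF M i(1) this] slashed_iff[OF M i] \<xi> a show ?thesis by (simp add: tscale_def)
qed

lemma slashed_sc:
  assumes M: "smooth_atlas M" and i: "i \<in> idx M" and a: "a > 0"
    and X: "X \<in> chart (iter_tangent M (Suc q)) i ` (slashed M (Suc q) \<inter> cdom (iter_tangent M (Suc q)) i)"
  shows "sc (mdim (iter_tangent M q)) a X \<in>
    chart (iter_tangent M (Suc q)) i ` (slashed M (Suc q) \<inter> cdom (iter_tangent M (Suc q)) i)"
proof -
  obtain \<xi> where \<xi>: "\<xi> \<in> slashed M (Suc q)" "\<xi> \<in> cdom (iter_tangent M (Suc q)) i" "X = chart (iter_tangent M (Suc q)) i \<xi>"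
    using X by auto
  then show ?thesis
    using tscale_chart[OF smooth_atlas_iter_tangent[OF M, of q], of i \<xi> a] slashed_tscale[OF M \<xi>(1) a] i
    by (intro image_eqI[where x = "tscale a \<xi>"]) auto
qed

section \<open>The lifts in charts\<close>

context
  fixes M :: "('i, 'a) atlas" and q :: nat
  assumes M: "smooth_atlas M"
begin

text \<open>With r = q + 1, the objects to be lifted live on \<open>N1\<close>, which is T^rM, and
  their lifts on \<open>N2\<close>; \<open>N3\<close> holds the values of the lifted fields.
  \<open>\<kappa>\<close> is the flip of \<open>N2\<close> and \<open>\<kappa>'\<close> that of
  \<open>N3\<close>.\<close>

private abbreviation (input) "N0 \<equiv> iter_tangent M q"
private abbreviation (input) "N1 \<equiv> tangent_bundle N0"
private abbreviation (input) "N2 \<equiv> tangent_bundle N1"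
private abbreviation (input) "N3 \<equiv> tangent_bundle N2"
private abbreviation (input) "m \<equiv> mdim N0"
private abbreviation (input) "\<kappa> \<equiv> kappa M (Suc (Suc q))"
private abbreviation (input) "\<kappa>' \<equiv> kappa M (Suc (Suc (Suc q)))"
private abbreviation (input) "U1 \<equiv> slashed M (Suc q)"
private abbreviation (input) "U2 \<equiv> slashed M (Suc (Suc q))"

private abbreviation (input) "W1 i \<equiv> chart N1 i ` (U1 \<inter> cdom N1 i)"
private abbreviation (input) "W2 i \<equiv> chart N2 i ` (U2 \<inter> cdom N2 i)"
text \<open>For X = (x, v, w, z) these are (x, w), the point of \<open>N1\<close> at which the
  lifted object is evaluated, and (v, z), the direction in which it is differentiated.\<close>

private abbreviation (input) "\<zeta>1 X \<equiv> lo (2 * m) (sflip m X)"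
private abbreviation (input) "\<zeta>2 X \<equiv> hi (2 * m) (sflip m X)"

lemma smooth_N0: "smooth_atlas N0" and smooth_N1: "smooth_atlas N1" and smooth_N2: "smooth_atlas N2" and smooth_N3: "smooth_atlas N3"
  by (intro smooth_atlas_TB smooth_atlas_iter_tangent M)+

lemma sc_U1: "i \<in> idx M \<Longrightarrow> X \<in> W1 i \<Longrightarrow> a > 0 \<Longrightarrow> sc m a X \<in> W1 i"
  and sc_U2: "i \<in> idx M \<Longrightarrow> X \<in> W2 i \<Longrightarrow> a > 0 \<Longrightarrow> sc (2 * m) a X \<in> W2 i"
  using slashed_sc[OF M, where q = q] slashed_sc[OF M, where q = "Suc q"] by simp_all

lemma kappa_eq: "\<xi> \<in> mcarrier N2 \<Longrightarrow> \<kappa> \<xi> = cflip N0 \<xi>"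
  by (simp add: kappa_def canonical_flip_eq[OF smooth_N0])

lemma kappa_Suc_eq: "\<xi> \<in> mcarrier N3 \<Longrightarrow> \<kappa>' \<xi> = cflip N1 \<xi>"
  using canonical_flip_eq[OF smooth_N1] by (simp add: kappa_def)

lemma in_mcarrierI: "i \<in> idx N \<Longrightarrow> p \<in> cdom N i \<Longrightarrow> p \<in> mcarrier N"
  by (auto simp: in_mcarrier)

lemma kappa_chart:
  assumes i: "i \<in> idx M" and \<xi>: "\<xi> \<in> cdom N2 i"
  shows "\<kappa> \<xi> \<in> cdom N2 i" "chart N2 i (\<kappa> \<xi>) = sflip m (chart N2 i \<xi>)"
    "foot (\<kappa> \<xi>) \<in> cdom N1 i" "chart N1 i (foot (\<kappa> \<xi>)) = lo (2 * m) (sflip m (chart N2 i \<xi>))"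
    "comp (\<kappa> \<xi>) i = hi (2 * m) (sflip m (chart N2 i \<xi>))"
proof -
  have i0: "i \<in> idx N0" and i1: "i \<in> idx N1" using i by simp_all
  have "\<xi> \<in> mcarrier N2" using in_mcarrierI[of i N2] i \<xi> by simp
  then have e: "\<kappa> \<xi> = cflip N0 \<xi>" by (rule kappa_eq)
  show c: "\<kappa> \<xi> \<in> cdom N2 i" "chart N2 i (\<kappa> \<xi>) = sflip m (chart N2 i \<xi>)"
    unfolding e using cflip_chart[OF smooth_N0 i0 \<xi>] by simp_all
  show "foot (\<kappa> \<xi>) \<in> cdom N1 i" using c(1) by (simp add: cdom_TB)
  show "chart N1 i (foot (\<kappa> \<xi>)) = lo (2 * m) (sflip m (chart N2 i \<xi>))"
    "comp (\<kappa> \<xi>) i = hi (2 * m) (sflip m (chart N2 i \<xi>))"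
    using chart_TB_lo_hi(2,3)[OF smooth_N1 i1 c(1)] by (simp_all add: c(2))
qed

lemma kappa_mcarrier: "\<xi> \<in> mcarrier N2 \<Longrightarrow> \<kappa> \<xi> \<in> mcarrier N2"
  by (simp add: kappa_eq cflip_mcarrier[OF smooth_N0])

lemma kappa_kappa: "\<xi> \<in> mcarrier N2 \<Longrightarrow> \<kappa> (\<kappa> \<xi>) = \<xi>"
  by (simp add: kappa_eq cflip_mcarrier[OF smooth_N0] cflip_cflip[OF smooth_N0])

lemma cw_kappa: "cw_smooth N2 (mcarrier N2) N2 \<kappa>"
  by (rule cw_smooth_cong[OF smooth_N2 cw_smooth_cflip(1)[OF smooth_N0]]) (simp add: kappa_eq)

lemma U2_mcarrier: "\<xi> \<in> U2 \<Longrightarrow> \<xi> \<in> mcarrier N2"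
  using slashed_mcarrier[of M "Suc q"] by auto

lemma U2_chart:
  assumes "\<xi> \<in> U2" obtains i where "i \<in> idx M" "\<xi> \<in> cdom N2 i"
  using U2_mcarrier[OF assms] by (auto simp: in_mcarrier)

text \<open>The slashed condition on \<open>N2\<close> tests the leading entries of the fibre pair
  (w, z), that is, of w; and w is precisely the fibre coordinate of (x, w).\<close>

lemma slashed_kappa:
  assumes \<xi>: "\<xi> \<in> U2" shows "foot (\<kappa> \<xi>) \<in> U1"
proof -
  obtain i where i: "i \<in> idx M" "\<xi> \<in> cdom N2 i" by (rule U2_chart[OF \<xi>])
  have i0: "i \<in> idx N0" and i1: "i \<in> idx N1" using i by simp_all
  let ?X = "chart N2 i \<xi>"
  obtain k where k: "k < mdim M" "comp \<xi> i k \<noteq> 0"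
    using slashed_iff[OF M i(1), of \<xi> "Suc q"] i \<xi> by auto
  have km: "k < m" using k(1) mdim_iter_tangent_ge[of M q] by simp
  have "comp (foot (\<kappa> \<xi>)) i = hi m (lo (2 * m) (sflip m ?X))"
    using chart_TB_lo_hi(3)[OF smooth_N0 i0 kappa_chart(3)[OF i]] by (simp add: kappa_chart(4)[OF i])
  also have "\<dots> = lo m (hi (2 * m) ?X)" by (rule sflip_blocks)
  also have "\<dots> = lo m (comp \<xi> i)"
    using chart_TB_lo_hi(3)[OF smooth_N1 i1 i(2)] by simp
  finally have "comp (foot (\<kappa> \<xi>)) i k = comp \<xi> i k" using km by (simp add: lo_def)
  then show ?thesis
    using slashed_iff[OF M i(1), of "foot (\<kappa> \<xi>)" q] kappa_chart(3)[OF i] k by auto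
qed

lemma cw_kappa_slashed: "cw_smooth N2 U2 N2 \<kappa>"
  using U2_mcarrier eopen_slashed[OF M, of _ "Suc q"]
  by (intro cw_smooth_subset[OF cw_kappa]) auto

lemma cw_foot_kappa: "cw_smooth N2 U2 N1 (\<lambda>\<xi>. foot (\<kappa> \<xi>))"
  by (rule cw_smooth_compose[OF smooth_N2 smooth_N2 cw_kappa_slashed cw_smooth_foot(1)[OF smooth_N1]])
    (simp add: kappa_mcarrier U2_mcarrier)

text \<open>The flip followed by the projection is the tangent map of the projection from
  \<open>N1\<close> to \<open>N0\<close>, hence linear on fibres. Homogeneity of the vertical lift
  of a function is immediate from this.\<close>

lemma foot_kappa_tscale:
  assumes \<xi>: "\<xi> \<in> U2" and a: "a > 0"
  shows "foot (\<kappa> (tscale a \<xi>)) = tscale a (foot (\<kappa> \<xi>))"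
proof -
  obtain i where i: "i \<in> idx M" "\<xi> \<in> cdom N2 i" by (rule U2_chart[OF \<xi>])
  have i0: "i \<in> idx N0" and i1: "i \<in> idx N1" using i by simp_all
  note t = tscale_chart[OF smooth_N1 i1 i(2), of a]
  show ?thesis
  proof (rule chart_eqD[OF smooth_N1 i1 kappa_chart(3)[OF i(1) t(1)] tscale_chart(1)[OF smooth_N0 i0 kappa_chart(3)[OF i]]])
    show "chart N1 i (foot (\<kappa> (tscale a \<xi>))) = chart N1 i (tscale a (foot (\<kappa> \<xi>)))"
      unfolding kappa_chart(4)[OF i(1) t(1)] tscale_chart(2)[OF smooth_N0 i0 kappa_chart(3)[OF i]] kappa_chart(4)[OF i] t(2)
      using sflip_sc(1)[of m a] by simp
  qed
qed

lemma sflip_chart_slashed: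
  assumes i: "i \<in> idx M" and X: "X \<in> W2 i"
  shows "\<zeta>1 X \<in> W1 i"
proof -
  obtain \<xi> where \<xi>: "\<xi> \<in> U2" "\<xi> \<in> cdom N2 i" "X = chart N2 i \<xi>" using X by auto
  show ?thesis
    using kappa_chart(3,4)[OF i \<xi>(2)] slashed_kappa[OF \<xi>(1)] by (metis IntI imageI \<xi>(3))
qed

section \<open>Vertical and complete lifts of functions\<close>

lemma vlift_fun_eq: "vlift_fun M (Suc q) f \<xi> = f (foot (\<kappa> \<xi>))"
  by (simp add: vlift_fun_def)

lemma clift_fun_eq: "clift_fun M (Suc q) f \<xi> = differential N1 f (\<kappa> \<xi>)"
  by (simp add: clift_fun_def)

lemma smooth_vlift_fun:
  assumes "smooth_fun_on N1 U1 f" shows "smooth_fun_on N2 U2 (vlift_fun M (Suc q) f)"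
  unfolding vlift_fun_eq[abs_def]
  by (rule smooth_fun_compose[OF smooth_N2 smooth_N1 cw_foot_kappa assms slashed_kappa])

lemma homogeneous_vlift_fun:
  assumes "homogeneous_fun M (Suc q) s f" shows "homogeneous_fun M (Suc (Suc q)) s (vlift_fun M (Suc q) f)"
  using assms foot_kappa_tscale slashed_kappa by (simp add: homogeneous_fun_def vlift_fun_eq)

lemma smooth_clift_fun:
  assumes "smooth_fun_on N1 U1 f" shows "smooth_fun_on N2 U2 (clift_fun M (Suc q) f)"
  unfolding clift_fun_eq[abs_def]
  by (rule smooth_fun_compose[OF smooth_N2 smooth_N2 cw_kappa_slashed smooth_fun_differential[OF smooth_N1 assms]])
    (simp add: kappa_mcarrier U2_mcarrier slashed_kappa)

lemma homogeneous_clift_fun: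
  assumes f: "smooth_fun_on N1 U1 f" and h: "homogeneous_fun M (Suc q) s f"
  shows "homogeneous_fun M (Suc (Suc q)) s (clift_fun M (Suc q) f)"
  unfolding homogeneous_fun_def
proof (intro ballI allI impI)
  fix \<xi> a assume \<xi>: "\<xi> \<in> U2" and a: "(a::real) > 0"
  obtain i where i: "i \<in> idx M" "\<xi> \<in> cdom N2 i" by (rule U2_chart[OF \<xi>])
  have i0: "i \<in> idx N0" and i1: "i \<in> idx N1" using i by simp_all
  let ?X = "chart N2 i \<xi>" and ?g = "\<lambda>x. f (chart_inv N1 i x)" and ?W = "W1 i"
  note t = tscale_chart[OF smooth_N1 i1 i(2), of a]
  have tU: "tscale a \<xi> \<in> U2" by (rule slashed_tscale[OF M \<xi> a])
  have g: "Cinf_on (2 * m) ?W ?g" using f i1 by (simp add: smooth_fun_on_def)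
  \<comment> \<open>Natural powers become real powers here and are converted back at the
    end.\<close>
  have hom: "hom_on m (real s) ?W ?g"
    unfolding hom_on_def
  proof (intro ballI allI impI)
    fix Y b assume Y: "Y \<in> ?W" and b: "(b::real) > 0"
    then obtain \<eta> where \<eta>: "\<eta> \<in> U1" "\<eta> \<in> cdom N1 i" "Y = chart N1 i \<eta>" by auto
    have "chart_inv N1 i (sc m b Y) = tscale b \<eta>"
      using tscale_chart[OF smooth_N0 i0 \<eta>(2), of b] chart_inv_chart[OF smooth_N1 i1] by (metis \<eta>(3))
    then show "?g (sc m b Y) = b powr real s * ?g Y"
      using h \<eta> b chart_inv_chart[OF smooth_N1 i1] by (simp add: homogeneous_fun_def powr_realpow)
  qed
  have d: "clift_fun M (Suc q) f \<eta> = dirder (2 * m) ?g (lo (2 * m) (sflip m (chart N2 i \<eta>))) (hi (2 * m) (sflip m (chart N2 i \<eta>)))"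
    if "\<eta> \<in> U2" "\<eta> \<in> cdom N2 i" for \<eta>
    using differential_chart[OF smooth_N1 f i1 kappa_chart(1)[OF i(1) that(2)] slashed_kappa[OF that(1)]]
    by (simp add: clift_fun_eq kappa_chart(4,5)[OF i(1) that(2)])
  have Z: "lo (2 * m) (sflip m ?X) \<in> ?W"
    using slashed_kappa[OF \<xi>] kappa_chart(3,4)[OF i] by (metis IntI imageI)
  have "clift_fun M (Suc q) f (tscale a \<xi>) =
      dirder (2 * m) ?g (sc m a (lo (2 * m) (sflip m ?X))) (sc m a (hi (2 * m) (sflip m ?X)))"
    using d[OF tU t(1)] by (simp add: t(2) sflip_sc)
  also have "\<dots> = a powr real s * clift_fun M (Suc q) f \<xi>"
    unfolding d[OF \<xi> i(2)] by (rule dirder_hom_on[OF g sc_U1[OF i(1)] hom Z a])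
  finally show "clift_fun M (Suc q) f (tscale a \<xi>) = a ^ s * clift_fun M (Suc q) f \<xi>"
    using a by (simp add: powr_realpow)
qed

lemma homogeneous_field_iff1:
  assumes "vector_field_on N1 U1 A"
  shows "homogeneous_field M (Suc q) s A \<longleftrightarrow> (\<forall>i\<in>idx M. \<forall>k<2 * m.
    hom_on m (if k < m then real s - 1 else real s) (W1 i) (\<lambda>X. rep N1 N2 A i X (2 * m + k)))"
proof -
  have "(\<forall>\<xi>\<in>U1. lie_bracket N1 (liouville M (Suc q)) A \<xi> = tscale (real s - 1) (A \<xi>)) \<longleftrightarrow> (\<forall>i\<in>idx N0. \<forall>k<2 * m.
    hom_on m (if k < m then real s - 1 else real s) (W1 i) (\<lambda>X. rep N1 N2 A i X (2 * m + k)))"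
    by (rule field_homogeneous_iff[OF smooth_N0 assms slashed_tscale[OF M]]) (simp_all add: liouville_def)
  then show ?thesis by (simp add: homogeneous_field_def)
qed

lemma homogeneous_field_iff2:
  assumes "vector_field_on N2 U2 A"
  shows "homogeneous_field M (Suc (Suc q)) s A \<longleftrightarrow> (\<forall>i\<in>idx M. \<forall>k<4 * m.
    hom_on (2 * m) (if k < 2 * m then real s - 1 else real s) (W2 i) (\<lambda>X. rep N2 N3 A i X (4 * m + k)))"
proof -
  have "(\<forall>\<xi>\<in>U2. lie_bracket N2 (liouville M (Suc (Suc q))) A \<xi> = tscale (real s - 1) (A \<xi>)) \<longleftrightarrow> (\<forall>i\<in>idx N1. \<forall>k<2 * mdim N1.
    hom_on (mdim N1) (if k < mdim N1 then real s - 1 else real s) (W2 i) (\<lambda>X. rep N2 N3 A i X (2 * mdim N1 + k)))"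
    by (rule field_homogeneous_iff[OF smooth_N1 assms slashed_tscale[OF M]]) (simp_all add: liouville_def)
  then show ?thesis by (simp add: homogeneous_field_def)
qed

text \<open>A pair of pairs (x1, x2), (y1, y2) is reordered to x1, y1, x2, y2. The shift by
  \<open>m\<close> reads y1 in the second block and x2 in the third; the shift by
  \<open>2 * m\<close> reads y2 in the fourth.\<close>

lemma sflip_join_nth:
  "sflip m (join (2 * m) x y) k = (if k < m then x k else if k < 2 * m then y (k - m)
    else if k < 3 * m then x (k - m) else if k < 4 * m then y (k - 2 * m) else 0)"
  by (auto simp: sflip_def join_def bperm_def algebra_simps intro!: arg_cong[of _ _ y])

text \<open>The swap is linear, so it is its own differential.\<close>

lemma hi_tlift_sflip:
  "hi (4 * m) (tlift (4 * m) (4 * m) (sflip m) Y) = sflip m (hi (4 * m) Y)"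
proof -
  have "dirder (4 * m) (\<lambda>x. sflip m x k) (lo (4 * m) Y) (hi (4 * m) Y) = sflip m (hi (4 * m) Y) k" if "k < 4 * m" for k
  proof -
    have "bperm m k < 4 * m" using that by (auto simp: bperm_def)
    then show ?thesis using that by (simp add: sflip_def dirder_coord)
  qed
  then show ?thesis by (simp add: tlift_def hi_join fun_eq_iff) (simp add: sflip_def)
qed

section \<open>Vector fields on the slashed bundle and their lifts\<close>

context
  fixes A :: "('i, 'a) tpoint \<Rightarrow> ('i, 'a) tpoint"
  assumes A: "vector_field_on N1 U1 A"
begin

private abbreviation (input) "R \<equiv> rep N1 N2 A"

lemma cw_A: "cw_smooth N1 U1 N2 A"
  by (rule vector_field_cw_smooth[OF smooth_N1 A])

lemma foot_A: "p \<in> U1 \<Longrightarrow> foot (A p) = p"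
  using A by (simp add: vector_field_on_def)

lemma A_cdom: "i \<in> idx M \<Longrightarrow> p \<in> U1 \<Longrightarrow> p \<in> cdom N1 i \<Longrightarrow> A p \<in> cdom N2 i"
  using cw_smoothD(4)[OF cw_A, of i] by simp

text \<open>Being a section fixes the first half of the local representative to be the identity; the
  information about the field is in the second half, (A1, A2).\<close>

lemma rep_A_lo_hi:
  assumes i: "i \<in> idx M" and p: "p \<in> U1" "p \<in> cdom N1 i"
  shows "lo (2 * m) (R i (chart N1 i p)) = chart N1 i p"
    "hi (2 * m) (R i (chart N1 i p)) = comp (A p) i"
  using chart_TB_lo_hi(2,3)[OF smooth_N1 _ A_cdom[OF assms]] i foot_A[OF p(1)]
  by (simp_all add: rep_chart[OF smooth_N1 _ p(2)])

private abbreviation (input) "vertical \<xi> \<equiv> velocity N2 (\<lambda>\<sigma>. tadd (\<kappa> \<xi>) (tscale \<sigma> (A (foot (\<kappa> \<xi>))))) 0"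

lemma vlift_field_eq: "vlift_field M (Suc q) A \<xi> = tangent_map N2 N2 \<kappa> (vertical \<xi>)"
  by (simp add: vlift_field_def Let_def)

lemma vertical_chart:
  assumes i: "i \<in> idx M" and \<xi>: "\<xi> \<in> U2" "\<xi> \<in> cdom N2 i"
  shows "vertical \<xi> \<in> cdom N3 i" "foot (vertical \<xi>) = \<kappa> \<xi>"
    "chart N3 i (vertical \<xi>) = join (4 * m) (sflip m (chart N2 i \<xi>))
       (join (2 * m) (\<lambda>k. 0) (hi (2 * m) (R i (lo (2 * m) (sflip m (chart N2 i \<xi>))))))"
proof -
  have i1: "i \<in> idx N1" using i by simp
  note k = kappa_chart[OF i \<xi>(2)] and U = slashed_kappa[OF \<xi>(1)]
  note v = vertical_velocity_chart[OF smooth_N1 i1 k(1) A_cdom[OF i U k(3)] foot_A[OF U]]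
  show "vertical \<xi> \<in> cdom N3 i" "foot (vertical \<xi>) = \<kappa> \<xi>" using v(1,2) .
  show "chart N3 i (vertical \<xi>) = join (4 * m) (sflip m (chart N2 i \<xi>))
       (join (2 * m) (\<lambda>k. 0) (hi (2 * m) (R i (lo (2 * m) (sflip m (chart N2 i \<xi>))))))"
    using v(3) rep_A_lo_hi(2)[OF i U k(3)] by (simp add: k(2,4))
qed

lemma Cinf_rep_A:
  assumes i: "i \<in> idx M" and k: "k < 4 * m"
  shows "Cinf_on (4 * m) (W2 i) (\<lambda>X. R i (\<zeta>1 X) k)"
proof -
  let ?W = "W2 i"
  have op: "eopen (4 * m) ?W" using eopen_slashed[OF M i, of "Suc q"] by simp
  have c: "Cinf_on (2 * m) (W1 i) (\<lambda>X. R i X k)"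
    using cw_smoothD(5)[OF cw_A, of i k] i k by simp
  show ?thesis
  proof (rule Cinf_on_compose[OF c op])
    show "Cinf_on (4 * m) ?W (\<lambda>X. \<zeta>1 X l)" if "l < 2 * m" for l
      using Cinf_on_coord[OF op] that by (simp add: lo_def sflip_def)
    show "\<zeta>1 X \<in> W1 i" if "X \<in> ?W" for X
      by (rule sflip_chart_slashed[OF i that])
  qed
qed

lemma cw_vertical: "cw_smooth N2 U2 N3 (\<lambda>\<xi>. vertical \<xi>)"
proof (rule cw_smoothI)
  fix i assume "i \<in> idx N2"
  then have i: "i \<in> idx M" "i \<in> idx N2" by simp_all
  show op: "eopen (mdim N2) (W2 i)"
    using eopen_slashed[OF M i(1), of "Suc q"] by simp
  show "vertical \<xi> \<in> cdom N3 i" if "\<xi> \<in> U2" "\<xi> \<in> cdom N2 i" for \<xi>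
    by (rule vertical_chart(1)[OF i(1) that])
  fix k assume k: "k < mdim N3"
  have "Cinf_on (mdim N2) (W2 i)
     (\<lambda>X. join (4 * m) (sflip m X) (join (2 * m) (\<lambda>k. 0) (hi (2 * m) (R i (\<zeta>1 X)))) k)"
  proof -
    \<comment> \<open>The three ranges are the swapped coordinates of the base point, the zeros of a
      vertical vector, and the components of \<open>A\<close>.\<close>
    consider "k < 4 * m" | "\<not> k < 4 * m" "k - 4 * m < 2 * m" | "\<not> k < 4 * m" "\<not> k - 4 * m < 2 * m" "k - 6 * m < 2 * m"
      using k by fastforce
    then show ?thesis
    proof cases
      case 1
      then show ?thesis using Cinf_on_coord[OF op] by (simp add: join_def sflip_def)
    next
      case 2
      then show ?thesis using Cinf_on_const[OF op] k by (simp add: join_def)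
    next
      case 3
      then have "k - 4 * m < 4 * m" "k - 4 * m - 2 * m < 2 * m" "2 * m + (k - 4 * m - 2 * m) = k - 4 * m"
        using k by simp_all
      with 3 show ?thesis using Cinf_rep_A[OF i(1), of "k - 4 * m"] k by (simp add: join_def hi_def)
    qed
  qed
  then show "Cinf_on (mdim N2) (W2 i) (\<lambda>X. rep N2 N3 (\<lambda>\<xi>. vertical \<xi>) i X k)"
    by (rule Cinf_on_cong) (use vertical_chart(3)[OF i(1)] in \<open>auto simp: rep_chart[OF smooth_N2 i(2)]\<close>)
qed (auto simp: U2_mcarrier)

private abbreviation (input) "D\<kappa> \<equiv> tangent_map N2 N2 \<kappa>"

lemma cw_Dkappa: "cw_smooth N3 {\<zeta> \<in> mcarrier N3. foot \<zeta> \<in> mcarrier N2} N3 D\<kappa>"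
  by (rule cw_smooth_tangent_map[OF smooth_N2 smooth_N2 cw_kappa])

text \<open>The flip is a linear swap in charts, so its tangent map swaps the fibre half in the same
  way. The base half is handled separately, through \<open>foot_tangent_map\<close> and the
  involution property.\<close>

lemma Dkappa_chart:
  assumes i: "i \<in> idx M" and \<zeta>: "\<zeta> \<in> cdom N3 i"
  shows "hi (4 * m) (chart N3 i (D\<kappa> \<zeta>)) = sflip m (hi (4 * m) (chart N3 i \<zeta>))"
proof -
  have i2: "i \<in> idx N2" and i0: "i \<in> idx N0" using i by simp_all
  have f: "foot \<zeta> \<in> cdom N2 i" using \<zeta> by (simp add: cdom_TB)
  have fc: "foot \<zeta> \<in> mcarrier N2" by (rule in_mcarrierI[OF i2 f])
  have "chart N3 i (D\<kappa> \<zeta>) = tlift (4 * m) (4 * m) (rep N2 N2 \<kappa> i) (chart N3 i \<zeta>)"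
    using tangent_map_chart(2)[OF smooth_N2 smooth_N2 cw_kappa i2 \<zeta> fc] by simp
  also have "\<dots> = tlift (4 * m) (4 * m) (sflip m) (chart N3 i \<zeta>)"
  proof (rule tlift_cong)
    show "eopen (4 * m) (chart N2 i ` cdom N2 i)" using eopen_chart[OF smooth_N2 i2] by simp
    show "lo (4 * m) (chart N3 i \<zeta>) \<in> chart N2 i ` cdom N2 i"
      using chart_TB_lo_hi(2)[OF smooth_N2 i2 \<zeta>] f by simp
    show "rep N2 N2 \<kappa> i X = sflip m X" if "X \<in> chart N2 i ` cdom N2 i" for X
      using that kappa_chart(2)[OF i] by (auto simp: rep_chart[OF smooth_N2 i2])
  qed
  finally show ?thesis by (simp add: hi_tlift_sflip)
qed

lemma cw_vlift_field: "cw_smooth N2 U2 N3 (vlift_field M (Suc q) A)"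
  unfolding vlift_field_eq[abs_def]
proof (rule cw_smooth_compose[OF smooth_N2 smooth_N3 cw_vertical cw_Dkappa])
  fix \<xi> assume \<xi>: "\<xi> \<in> U2"
  obtain i where i: "i \<in> idx M" "\<xi> \<in> cdom N2 i" by (rule U2_chart[OF \<xi>])
  show "vertical \<xi> \<in> {\<zeta> \<in> mcarrier N3. foot \<zeta> \<in> mcarrier N2}"
    using vertical_chart(1,2)[OF i(1) \<xi> i(2)] i in_mcarrierI[of i N3] kappa_mcarrier U2_mcarrier[OF \<xi>] by simp
qed

lemma vector_field_vlift: "vector_field_on N2 U2 (vlift_field M (Suc q) A)"
  unfolding vector_field_on_def
proof (intro conjI ballI)
  show "smooth_map_on N2 U2 N3 (vlift_field M (Suc q) A)"
    by (rule cw_smooth_smooth_map[OF smooth_N2 smooth_N3 cw_vlift_field])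
  fix \<xi> assume \<xi>: "\<xi> \<in> U2"
  obtain i where i: "i \<in> idx M" "\<xi> \<in> cdom N2 i" by (rule U2_chart[OF \<xi>])
  show "foot (vlift_field M (Suc q) A \<xi>) = \<xi>"
    using vertical_chart(2)[OF i(1) \<xi> i(2)] by (simp add: vlift_field_eq kappa_kappa U2_mcarrier[OF \<xi>])
qed

text \<open>Over the flipped point the vertical vector has fibre half (0, 0, A1, A2); the tangent
  map of the flip then exchanges its two middle blocks.\<close>

lemma rep_vlift_field:
  assumes i: "i \<in> idx M" and X: "X \<in> W2 i" and k: "k < 4 * m"
  shows "rep N2 N3 (vlift_field M (Suc q) A) i X (4 * m + k) =
    sflip m (join (2 * m) (\<lambda>k. 0) (hi (2 * m) (R i (\<zeta>1 X)))) k"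
proof -
  have i2: "i \<in> idx N2" using i by simp
  obtain \<xi> where \<xi>: "\<xi> \<in> U2" "\<xi> \<in> cdom N2 i" "X = chart N2 i \<xi>" using X by auto
  have "rep N2 N3 (vlift_field M (Suc q) A) i X (4 * m + k) = hi (4 * m) (chart N3 i (D\<kappa> (vertical \<xi>))) k"
    using k by (simp add: hi_def \<xi>(3) rep_chart[OF smooth_N2 i2 \<xi>(2)] vlift_field_eq)
  also have "\<dots> = sflip m (lo (4 * m) (join (2 * m) (\<lambda>k. 0) (hi (2 * m) (R i (\<zeta>1 X))))) k"
    by (simp add: Dkappa_chart[OF i vertical_chart(1)[OF i \<xi>(1,2)]] vertical_chart(3)[OF i \<xi>(1,2)] hi_join_lo \<xi>(3))
  also have "lo (4 * m) (join (2 * m) (\<lambda>k. 0) (hi (2 * m) (R i (\<zeta>1 X)))) =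
      join (2 * m) (\<lambda>k. 0) (hi (2 * m) (R i (\<zeta>1 X)))"
    using join_euc[of "2 * m"] by (intro lo_id) simp
  finally show ?thesis .
qed

section \<open>The complete lift of a vector field\<close>

private abbreviation (input) "DA \<equiv> tangent_map N1 N2 A"

lemma clift_field_eq: "clift_field M (Suc q) A \<xi> = D\<kappa> (\<kappa>' (DA (\<kappa> \<xi>)))"
  by (simp add: clift_field_def)

lemma kappa_slashed_dom: "\<xi> \<in> U2 \<Longrightarrow> \<kappa> \<xi> \<in> {\<eta> \<in> mcarrier N2. foot \<eta> \<in> U1}"
  by (simp add: kappa_mcarrier U2_mcarrier slashed_kappa)

lemma cw_DA: "cw_smooth N2 {\<eta> \<in> mcarrier N2. foot \<eta> \<in> U1} N3 DA"
  by (rule cw_smooth_tangent_map[OF smooth_N1 smooth_N2 cw_A])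

lemma cw_clift_field: "cw_smooth N2 U2 N3 (clift_field M (Suc q) A)"
proof -
  have 1: "cw_smooth N2 U2 N3 (\<lambda>\<xi>. DA (\<kappa> \<xi>))"
    by (rule cw_smooth_compose[OF smooth_N2 smooth_N2 cw_kappa_slashed cw_DA kappa_slashed_dom])
  have k': "cw_smooth N3 (mcarrier N3) N3 (\<kappa>')"
    by (rule cw_smooth_cong[OF smooth_N3 cw_smooth_cflip(1)[OF smooth_N1]]) (simp add: kappa_Suc_eq)
  have 2: "cw_smooth N2 U2 N3 (\<lambda>\<xi>. \<kappa>' (DA (\<kappa> \<xi>)))"
    by (rule cw_smooth_compose[OF smooth_N2 smooth_N3 1 k' cw_smooth_mcarrier[OF 1]])
  show ?thesis
    unfolding clift_field_eq[abs_def]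
    using cw_smooth_mcarrier[OF 2]
    by (intro cw_smooth_compose[OF smooth_N2 smooth_N3 2 cw_Dkappa]) (simp add: mcarrier_TB)
qed

text \<open>Put p = (x, w) and u = (v, z), so that the flipped point is (p, u). As \<open>A\<close>
  is a section, \<open>DA\<close> sends it to (p, A, u, dA(u)) in blocks of size
  \<open>2 * m\<close>, and \<open>\<kappa>'\<close> reorders this to (p, u, A, dA(u)). The result
  lies over the flipped point again, which is why the complete lift is a vector field.\<close>

lemma kappa_DA_chart:
  assumes i: "i \<in> idx M" and \<xi>: "\<xi> \<in> U2" "\<xi> \<in> cdom N2 i"
  defines "Y \<equiv> sflip m (chart N2 i \<xi>)" and "\<zeta> \<equiv> \<kappa>' (DA (\<kappa> \<xi>))"
  shows "\<zeta> \<in> cdom N3 i" "foot \<zeta> = \<kappa> \<xi>"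
    "hi (4 * m) (chart N3 i \<zeta>) = join (2 * m) (hi (2 * m) (R i (lo (2 * m) Y)))
      (\<lambda>k. dirder (2 * m) (\<lambda>x. R i x (2 * m + k)) (lo (2 * m) Y) (hi (2 * m) Y))"
proof -
  have i0: "i \<in> idx N0" and i1: "i \<in> idx N1" and i2: "i \<in> idx N2" using i by simp_all
  note k = kappa_chart[OF i \<xi>(2)] and U = slashed_kappa[OF \<xi>(1)]
  let ?W = "W1 i" and ?R = "R i"
  have ZW: "lo (2 * m) Y \<in> ?W" using U k(3,4) by (metis IntI imageI Y_def)
  have W: "eopen (2 * m) ?W" using cw_smoothD(3)[OF cw_A i1] by simp
  have DA: "DA (\<kappa> \<xi>) \<in> cdom N3 i" "chart N3 i (DA (\<kappa> \<xi>)) = tlift (2 * m) (4 * m) ?R Y"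
    using tangent_map_chart[OF smooth_N1 smooth_N2 cw_A i1 k(1) U] by (simp_all add: k(2) Y_def)
  have e: "\<zeta> = cflip N1 (DA (\<kappa> \<xi>))"
    unfolding \<zeta>_def by (rule kappa_Suc_eq) (use DA(1) i in_mcarrierI[of i N3] in simp)
  note fl = cflip_chart[OF smooth_N1 i1 DA(1), folded e]
  show \<zeta>: "\<zeta> \<in> cdom N3 i" by (rule fl(1))
  have c: "chart N3 i \<zeta> = sflip (2 * m) (tlift (2 * m) (4 * m) ?R Y)"
    using fl(2) DA(2) by simp
  note B = sflip_blocks[of "2 * m" "tlift (2 * m) (4 * m) ?R Y", folded c]
  have RZ: "?R (lo (2 * m) Y) \<in> euc (4 * m)"
    using chart_euc[OF smooth_N2 i2 A_cdom[OF i U k(3)]] rep_chart[OF smooth_N1 i1 k(3), of N2 A] by (simp add: k(4) Y_def)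
  have lo4: "lo (4 * m) (tlift (2 * m) (4 * m) ?R Y) = ?R (lo (2 * m) Y)"
    by (simp add: tlift_def lo_join[OF RZ])
  have hi4: "hi (4 * m) (tlift (2 * m) (4 * m) ?R Y) = lo (4 * m) (\<lambda>k. dirder (2 * m) (\<lambda>x. ?R x k) (lo (2 * m) Y) (hi (2 * m) Y))"
    by (simp add: tlift_def hi_join_lo)
  \<comment> \<open>The first half of the local form of \<open>A\<close> is the identity on the
    chart image of \<open>U1\<close>, so differentiating it returns the direction.\<close>
  have low: "lo (2 * m) (\<lambda>k. dirder (2 * m) (\<lambda>x. ?R x k) (lo (2 * m) Y) (hi (2 * m) Y)) = hi (2 * m) Y"
  proof
    fix l
    have "dirder (2 * m) (\<lambda>x. ?R x l) (lo (2 * m) Y) (hi (2 * m) Y) = dirder (2 * m) (\<lambda>x. x l) (lo (2 * m) Y) (hi (2 * m) Y)"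
      if l: "l < 2 * m"
    proof (rule dirder_cong[OF W ZW])
      fix y assume "y \<in> ?W"
      then obtain p where p: "p \<in> U1" "p \<in> cdom N1 i" "y = chart N1 i p" by auto
      from rep_A_lo_hi(1)[OF i p(1,2)] l show "?R y l = y l"
        by (auto simp: p(3) lo_def fun_eq_iff dest: spec[of _ l])
    qed simp
    then show "lo (2 * m) (\<lambda>k. dirder (2 * m) (\<lambda>x. ?R x k) (lo (2 * m) Y) (hi (2 * m) Y)) l = hi (2 * m) Y l"
      by (simp add: lo_def dirder_coord) (simp add: hi_def)
  qed
  have hi42: "lo (2 * m) (lo (4 * m) f) = lo (2 * m) f" "hi (2 * m) (lo (4 * m) f) = lo (2 * m) (\<lambda>k. f (2 * m + k))" for f
    using lo_lo_double[of "2 * m" f] hi_lo_double[of "2 * m" f] by simp_all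
  have "hi (4 * m) (chart N3 i \<zeta>) = join (2 * m) (hi (2 * m) (?R (lo (2 * m) Y)))
      (lo (2 * m) (\<lambda>k. dirder (2 * m) (\<lambda>x. ?R x (2 * m + k)) (lo (2 * m) Y) (hi (2 * m) Y)))"
    using join_lo_hi[of "hi (4 * m) (chart N3 i \<zeta>)" "2 * m"] B(3,4) by (simp add: lo4 hi4 hi42)
  then show "hi (4 * m) (chart N3 i \<zeta>) = join (2 * m) (hi (2 * m) (?R (lo (2 * m) Y)))
      (\<lambda>k. dirder (2 * m) (\<lambda>x. ?R x (2 * m + k)) (lo (2 * m) Y) (hi (2 * m) Y))"
    by (simp add: lo_def cong: join_cong)
  have "chart N2 i (foot \<zeta>) = lo (4 * m) (chart N3 i \<zeta>)"
    using chart_TB_lo_hi(2)[OF smooth_N2 i2 \<zeta>] by simp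
  also have "\<dots> = join (2 * m) (lo (2 * m) Y) (hi (2 * m) Y)"
    using join_lo_hi[of "lo (4 * m) (chart N3 i \<zeta>)" "2 * m"] B(1,2)
      rep_A_lo_hi(1)[OF i U k(3), unfolded k(4) Y_def[symmetric]]
    by (simp add: lo4 hi4 hi42 low)
  also have "\<dots> = chart N2 i (\<kappa> \<xi>)"
    using join_lo_hi[of Y "2 * m"] by (simp add: Y_def k(2))
  finally show "foot \<zeta> = \<kappa> \<xi>"
    using chart_eqD[OF smooth_N2 i2 _ k(1)] \<zeta> by (simp add: cdom_TB)
qed

lemma vector_field_clift: "vector_field_on N2 U2 (clift_field M (Suc q) A)"
  unfolding vector_field_on_def
proof (intro conjI ballI)
  show "smooth_map_on N2 U2 N3 (clift_field M (Suc q) A)"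
    by (rule cw_smooth_smooth_map[OF smooth_N2 smooth_N3 cw_clift_field])
  fix \<xi> assume \<xi>: "\<xi> \<in> U2"
  obtain i where i: "i \<in> idx M" "\<xi> \<in> cdom N2 i" by (rule U2_chart[OF \<xi>])
  show "foot (clift_field M (Suc q) A \<xi>) = \<xi>"
    using kappa_DA_chart(2)[OF i(1) \<xi> i(2)] by (simp add: clift_field_eq kappa_kappa U2_mcarrier[OF \<xi>])
qed

lemma rep_clift_field:
  assumes i: "i \<in> idx M" and X: "X \<in> W2 i" and k: "k < 4 * m"
  defines "Y \<equiv> sflip m X"
  shows "rep N2 N3 (clift_field M (Suc q) A) i X (4 * m + k) =
    sflip m (join (2 * m) (hi (2 * m) (R i (lo (2 * m) Y)))
      (\<lambda>k. dirder (2 * m) (\<lambda>x. R i x (2 * m + k)) (lo (2 * m) Y) (hi (2 * m) Y))) k"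
proof -
  have i2: "i \<in> idx N2" using i by simp
  obtain \<xi> where \<xi>: "\<xi> \<in> U2" "\<xi> \<in> cdom N2 i" "X = chart N2 i \<xi>" using X by auto
  note c = kappa_DA_chart[OF i \<xi>(1,2)]
  have "rep N2 N3 (clift_field M (Suc q) A) i X (4 * m + k) =
      hi (4 * m) (chart N3 i (D\<kappa> (\<kappa>' (DA (\<kappa> \<xi>))))) k"
    using k by (simp add: hi_def \<xi>(3) rep_chart[OF smooth_N2 i2 \<xi>(2)] clift_field_eq)
  then show ?thesis by (simp add: Dkappa_chart[OF i c(1)] c(3) Y_def \<xi>(3))
qed

section \<open>Homogeneity of the lifted fields\<close>

context
  fixes s :: nat
  assumes hom: "homogeneous_field M (Suc q) s A"
begin

lemma hom_rep_A:
  assumes i: "i \<in> idx M" and k: "k < 2 * m"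
  shows "hom_on m (if k < m then real s - 1 else real s) (W1 i) (\<lambda>X. R i X (2 * m + k))"
  using hom homogeneous_field_iff1[OF A] assms by blast

text \<open>By \<open>sflip_sc\<close>, dilating \<open>X\<close> dilates both halves of the swapped
  coordinates, so each component of \<open>A\<close> and its differential pick up the same power of
  \<open>a\<close>.\<close>

lemma rep_A_sc:
  assumes i: "i \<in> idx M" and X: "X \<in> W2 i" and a: "a > 0" and k: "k < 2 * m"
  shows "hi (2 * m) (R i (lo (2 * m) (sflip m (sc (2 * m) a X)))) k =
      a powr (if k < m then real s - 1 else real s) * hi (2 * m) (R i (\<zeta>1 X)) k"
    "dirder (2 * m) (\<lambda>x. R i x (2 * m + k)) (lo (2 * m) (sflip m (sc (2 * m) a X))) (hi (2 * m) (sflip m (sc (2 * m) a X))) =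
      a powr (if k < m then real s - 1 else real s) *
        dirder (2 * m) (\<lambda>x. R i x (2 * m + k)) (\<zeta>1 X) (\<zeta>2 X)"
proof -
  note h = hom_rep_A[OF i k] and Z = sflip_chart_slashed[OF i X]
  show "hi (2 * m) (R i (lo (2 * m) (sflip m (sc (2 * m) a X)))) k =
      a powr (if k < m then real s - 1 else real s) * hi (2 * m) (R i (\<zeta>1 X)) k"
    using h Z a k unfolding hom_on_def sflip_sc by (simp only: hi_def if_True)
  have "Cinf_on (2 * m) (W1 i) (\<lambda>x. R i x (2 * m + k))"
    using cw_smoothD(5)[OF cw_A, of i "2 * m + k"] i k by simp
  from dirder_hom_on[OF this sc_U1[OF i] h Z a]
  show "dirder (2 * m) (\<lambda>x. R i x (2 * m + k)) (lo (2 * m) (sflip m (sc (2 * m) a X))) (hi (2 * m) (sflip m (sc (2 * m) a X))) =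
      a powr (if k < m then real s - 1 else real s) *
        dirder (2 * m) (\<lambda>x. R i x (2 * m + k)) (\<zeta>1 X) (\<zeta>2 X)"
    unfolding sflip_sc .
qed

text \<open>The degree count behind both lifts: after the swap, the blocks below
  \<open>2 * m\<close> come from A1 or its differential and have degree s - 1, those from
  \<open>2 * m\<close> on come from A2 or its differential and have degree s. The inequalities on
  shifted indices let the case distinctions on either side be resolved together.\<close>

lemma block_cases:
  assumes "k < 4 * m"
  obtains "k < m" | "m \<le> k" "k - m < m" "k < 2 * m" "k - m < 2 * m"
    | "2 * m \<le> k" "m \<le> k - m" "k < 3 * m" "k - m < 2 * m" | "3 * m \<le> k" "m \<le> k - 2 * m" "k - 2 * m < 2 * m"
  using assms by linarith

lemma homogeneous_vlift_field: "homogeneous_field M (Suc (Suc q)) s (vlift_field M (Suc q) A)"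
  unfolding homogeneous_field_iff2[OF vector_field_vlift] hom_on_def
proof (intro ballI allI impI)
  fix i k X a assume *: "i \<in> idx M" "k < 4 * m" "X \<in> W2 i" "(a::real) > 0"
  show "rep N2 N3 (vlift_field M (Suc q) A) i (sc (2 * m) a X) (4 * m + k) =
      a powr (if k < 2 * m then real s - 1 else real s) * rep N2 N3 (vlift_field M (Suc q) A) i X (4 * m + k)"
    unfolding rep_vlift_field[OF *(1) sc_U2[OF *(1,3,4)] *(2)] rep_vlift_field[OF *(1,3,2)] sflip_join_nth
    using *(2) rep_A_sc(1)[OF *(1,3,4), of "k - m"] rep_A_sc(1)[OF *(1,3,4), of "k - 2 * m"]
    by (cases rule: block_cases) simp_all
qed

lemma homogeneous_clift_field: "homogeneous_field M (Suc (Suc q)) s (clift_field M (Suc q) A)"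
  unfolding homogeneous_field_iff2[OF vector_field_clift] hom_on_def
proof (intro ballI allI impI)
  fix i k X a assume *: "i \<in> idx M" "k < 4 * m" "X \<in> W2 i" "(a::real) > 0"
  show "rep N2 N3 (clift_field M (Suc q) A) i (sc (2 * m) a X) (4 * m + k) =
      a powr (if k < 2 * m then real s - 1 else real s) * rep N2 N3 (clift_field M (Suc q) A) i X (4 * m + k)"
    unfolding rep_clift_field[OF *(1) sc_U2[OF *(1,3,4)] *(2)] rep_clift_field[OF *(1,3,2)] sflip_join_nth
    using *(2) rep_A_sc[OF *(1,3,4), of k] rep_A_sc[OF *(1,3,4), of "k - m"] rep_A_sc[OF *(1,3,4), of "k - 2 * m"]
    by (cases rule: block_cases) simp_all
qed

end
end
end

theorem proposition5p2:
  fixes M :: "('i, 'a) atlas" and r s :: nat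
  assumes "smooth_manifold M" and "r \<ge> 1"
  shows
    "(\<forall>f. smooth_fun_on (iter_tangent M r) (slashed M r) f \<and> homogeneous_fun M r s f \<longrightarrow>
        smooth_fun_on (iter_tangent M (r + 1)) (slashed M (r + 1)) (vlift_fun M r f) \<and>
        homogeneous_fun M (r + 1) s (vlift_fun M r f) \<and>
        smooth_fun_on (iter_tangent M (r + 1)) (slashed M (r + 1)) (clift_fun M r f) \<and>
        homogeneous_fun M (r + 1) s (clift_fun M r f)) \<and>
     (\<forall>A. vector_field_on (iter_tangent M r) (slashed M r) A \<and> homogeneous_field M r s A \<longrightarrow>
        vector_field_on (iter_tangent M (r + 1)) (slashed M (r + 1)) (vlift_field M r A) \<and>
        homogeneous_field M (r + 1) s (vlift_field M r A) \<and>
        vector_field_on (iter_tangent M (r + 1)) (slashed M (r + 1)) (clift_field M r A) \<and>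
        homogeneous_field M (r + 1) s (clift_field M r A))"
proof -
  \<comment> \<open>Writing r = q + 1 exhibits T^(r+1)M as the second tangent bundle of T^qM, on
    which the flip acts.\<close>
  obtain q where r: "r = Suc q" using assms(2) by (cases r) auto
  have M: "smooth_atlas M" using assms(1) by (simp add: smooth_manifold_def)
  show ?thesis
    unfolding r
    using smooth_vlift_fun[OF M, of q] homogeneous_vlift_fun[OF M, of q s]
      smooth_clift_fun[OF M, of q] homogeneous_clift_fun[OF M, of q _ s]
      vector_field_vlift[OF M, of q] homogeneous_vlift_field[OF M, of q _ s]
      vector_field_clift[OF M, of q] homogeneous_clift_field[OF M, of q _ s]
    by simp
qed

end
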